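(* Let $\alpha\geq\omega$ be an ordinal and let $\gamma$ be the unique ordinal satisfying $\omega^{\omega^\gamma}\leq\alpha<\omega^{\omega^{\gamma+1}}$. Then the $w^*$-dentability index of the Banach space $C([0,\alpha])$ satisfies \[ Dz(C([0,\alpha]))=\omega^{1+\gamma+1}. \]
   Context: All arithmetic of ordinals (sums, products, powers) is ordinal arithmetic, and $\omega$ is the first infinite ordinal. For an ordinal $\alpha$, the interval $[0,\alpha]$ carries its order topology, under which it is a scattered compact Hausdorff space; $C([0,\alpha])$ is the Banach space of continuous scalar-valued functions on $[0,\alpha]$ with the supremum norm (it is an Asplund space). For the $w^*$-dentability index, Banach spaces are taken over the real scalars. For a Banach space $X$, $B_X=\{x\in X:\|x\|\leq 1\}$. $w^*$-dentability index: Let $X$ be a (real) Asplund space. For $x\in X$ and $t\in\mathbb{R}$ let $H(x,t)=\{x^*\in X^* : x^*(x)>t\}$. For $B\subseteq X^*$ and $\epsilon>0$ define \[ d_\epsilon(B)=\{x^*\in B : \operatorname{diam}(B\cap H(x,t))>\epsilon \text{ for every } x\in X,\ t\in\mathbb{R} \text{ with } x^*\in H(x,t)\}, \] where the diameter is with respect to the norm of $X^*$. Iterate transfinitely: $d_\epsilon^0(B)=B$, $d_\epsilon^{\beta+1}(B)=d_\epsilon(d_\epsilon^\beta(B))$ for every ordinal $\beta$, and $d_\epsilon^\beta(B)=\bigcap_{\sigma<\beta}d_\epsilon^\sigma(B)$ for $\beta$ a limit ordinal. Let $Dz(X,\epsilon)$ be the least ordinal $\beta$ with $d_\epsilon^\beta(B_{X^*})=\emptyset$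 (it exists since $X$ is Asplund), and $Dz(X)=\sup_{\epsilon>0}Dz(X,\epsilon)$. *)

theory Defs
  imports "HOL-Analysis.Analysis"
begin

section \<open>Ordinals\<close>

text \<open>
  The type \<open>'a ordinal\<close> is well-ordered with order type the successor cardinal \<open>\<kappa>\<^sup>+\<close>, where
  \<open>\<kappa> = max(|'a|, \<aleph>\<^sub>0)\<close>.  Its elements are the ordinals below \<open>\<kappa>\<^sup>+\<close>: an element \<open>\<alpha>\<close> stands for
  the order type of \<open>{..<\<alpha>}\<close>.  As \<open>\<kappa>\<^sup>+\<close> is regular and uncountable, this initial segment of
  the ordinals is closed under ordinal sums, products and powers and under suprema of families
  indexed by \<open>{..<\<beta>}\<close> (lemma \<open>bdd_above_image_lessThan\<close>).  Every ordinal occurs in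
  \<open>'a ordinal\<close> for a large enough \<open>'a\<close>, so a statement polymorphic in \<open>'a\<close> concerns all ordinals.
\<close>

typedef 'a ordinal = "Field (cardSuc (card_of (UNIV :: ('a + nat) set)))"
  morphisms ordinal_rep ordinal_abs
  using Field_cardSuc_not_empty[OF card_of_Card_order] by blast

lemma cardSuc_facts:
  shows "Well_order (cardSuc (card_of (UNIV :: ('a + nat) set)))"
    and "Refl (cardSuc (card_of (UNIV :: ('a + nat) set)))"
    and "trans (cardSuc (card_of (UNIV :: ('a + nat) set)))"
    and "antisym (cardSuc (card_of (UNIV :: ('a + nat) set)))"
    and "Total (cardSuc (card_of (UNIV :: ('a + nat) set)))"
    and "wf (cardSuc (card_of (UNIV :: ('a + nat) set)) - Id)"
  using cardSuc_Well_order[OF card_of_Card_order, of "UNIV :: ('a + nat) set"]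
  by (auto simp: well_order_on_def linear_order_on_def partial_order_on_def preorder_on_def)

instantiation ordinal :: (type) wellorder
begin

definition less_eq_ordinal :: "'a ordinal \<Rightarrow> 'a ordinal \<Rightarrow> bool" where
  "x \<le> y \<longleftrightarrow> (ordinal_rep x, ordinal_rep y) \<in> cardSuc (card_of (UNIV :: ('a + nat) set))"

definition less_ordinal :: "'a ordinal \<Rightarrow> 'a ordinal \<Rightarrow> bool" where
  "(x :: 'a ordinal) < y \<longleftrightarrow> x \<le> y \<and> x \<noteq> y"

instance
proof
  fix x y z :: "'a ordinal"
  show anti: "x \<le> y \<Longrightarrow> y \<le> x \<Longrightarrow> x = y" for x y :: "'a ordinal"
    using cardSuc_facts(4)[where 'a='a] unfolding less_eq_ordinal_def
    by (metis antisymD ordinal_rep_inject)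
  show "x < y \<longleftrightarrow> x \<le> y \<and> \<not> y \<le> x"
    using anti cardSuc_facts(2)[where 'a='a] ordinal_rep[of x]
    by (auto simp: less_ordinal_def less_eq_ordinal_def refl_on_def)
  show "x \<le> x"
    using cardSuc_facts(2)[where 'a='a] ordinal_rep[of x]
    by (auto simp: less_eq_ordinal_def refl_on_def)
  show "x \<le> y \<Longrightarrow> y \<le> z \<Longrightarrow> x \<le> z"
    using cardSuc_facts(3)[where 'a='a] unfolding less_eq_ordinal_def by (meson transD)
  show "x \<le> y \<or> y \<le> x"
    using cardSuc_facts(5)[where 'a='a] cardSuc_facts(2)[where 'a='a]
      ordinal_rep[of x] ordinal_rep[of y]
    unfolding less_eq_ordinal_def total_on_def refl_on_def
    by (cases "ordinal_rep x = ordinal_rep y") auto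
next
  fix P :: "'a ordinal \<Rightarrow> bool" and a :: "'a ordinal"
  assume step: "\<And>x. (\<And>y. y < x \<Longrightarrow> P y) \<Longrightarrow> P x"
  have "wf (inv_image (cardSuc (card_of (UNIV :: ('a + nat) set)) - Id)
              (ordinal_rep :: 'a ordinal \<Rightarrow> _))"
    by (rule wf_inv_image[OF cardSuc_facts(6)])
  moreover have "{(x, y). x < (y :: 'a ordinal)}
      \<subseteq> inv_image (cardSuc (card_of (UNIV :: ('a + nat) set)) - Id) ordinal_rep"
    by (auto simp: less_ordinal_def less_eq_ordinal_def ordinal_rep_inject inv_image_def)
  ultimately have "wf {(x, y). x < (y :: 'a ordinal)}"
    by (rule wf_subset)
  then show "P a"
    by (induction a rule: wf_induct_rule) (auto intro: step)
qed

end

instantiation ordinal :: (type) conditionally_complete_linorder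
begin

definition inf_ordinal :: "'a ordinal \<Rightarrow> 'a ordinal \<Rightarrow> 'a ordinal" where
  "(inf :: 'a ordinal \<Rightarrow> _) = min"

definition sup_ordinal :: "'a ordinal \<Rightarrow> 'a ordinal \<Rightarrow> 'a ordinal" where
  "(sup :: 'a ordinal \<Rightarrow> _) = max"

definition Inf_ordinal :: "'a ordinal set \<Rightarrow> 'a ordinal" where
  "Inf (A :: 'a ordinal set) = (LEAST x. x \<in> A)"

definition Sup_ordinal :: "'a ordinal set \<Rightarrow> 'a ordinal" where
  "Sup (A :: 'a ordinal set) = (LEAST x. \<forall>a\<in>A. a \<le> x)"

instance
proof
  fix x z :: "'a ordinal" and X :: "'a ordinal set"
  show "x \<in> X \<Longrightarrow> bdd_below X \<Longrightarrow> Inf X \<le> x"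
    by (simp add: Inf_ordinal_def Least_le)
  show "X \<noteq> {} \<Longrightarrow> (\<And>x. x \<in> X \<Longrightarrow> z \<le> x) \<Longrightarrow> z \<le> Inf X"
    unfolding Inf_ordinal_def by (metis LeastI equals0I)
  show "X \<noteq> {} \<Longrightarrow> (\<And>x. x \<in> X \<Longrightarrow> x \<le> z) \<Longrightarrow> Sup X \<le> z"
    unfolding Sup_ordinal_def by (simp add: Least_le)
  assume "x \<in> X" and "bdd_above X"
  then obtain u where "\<forall>a\<in>X. a \<le> u"
    by (auto simp: bdd_above_def)
  then have "\<forall>a\<in>X. a \<le> Sup X"
    unfolding Sup_ordinal_def by (rule LeastI[of "\<lambda>u. \<forall>a\<in>X. a \<le> u"])
  then show "x \<le> Sup X"
    using \<open>x \<in> X\<close> by blast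
qed (auto simp: inf_ordinal_def sup_ordinal_def)

end

instantiation ordinal :: (type) linorder_topology
begin

definition open_ordinal :: "'a ordinal set \<Rightarrow> bool" where
  "(open :: 'a ordinal set \<Rightarrow> bool) = generate_topology (range (\<lambda>a. {..<a}) \<union> range (\<lambda>a. {a<..}))"

instance
  by standard (rule open_ordinal_def)

end

lemma bdd_above_ordinal:
  fixes A :: "'a ordinal set"
  assumes "ordLeq3 (card_of A) (card_of (UNIV :: ('a + nat) set))"
  shows "bdd_above A"
proof -
  let ?r = "card_of (UNIV :: ('a + nat) set)"
  have img: "ordLeq3 (card_of (ordinal_rep ` A)) ?r"
    using card_of_image ordLeq_transitive assms by metis
  have "\<exists>i\<in>Field (cardSuc ?r). ordinal_rep ` A \<subseteq> under (cardSuc ?r) i"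
  proof (rule cardSuc_UNION[OF card_of_Card_order _ _ _ img])
    show "infinite (Field ?r)"
      by (simp add: Field_card_of)
    show "relChain (cardSuc ?r) (under (cardSuc ?r))"
      using cardSuc_facts(3)[where 'a='a] unfolding relChain_def under_def
      by (auto dest: transD)
    show "ordinal_rep ` A \<subseteq> (\<Union>i\<in>Field (cardSuc ?r). under (cardSuc ?r) i)"
      using cardSuc_facts(2)[where 'a='a] ordinal_rep
      unfolding under_def refl_on_def by fastforce
  qed
  then obtain i where i: "i \<in> Field (cardSuc ?r)"
    and sub: "ordinal_rep ` A \<subseteq> under (cardSuc ?r) i"
    by blast
  have "x \<le> ordinal_abs i" if "x \<in> A" for x
    using that sub i by (auto simp: less_eq_ordinal_def under_def ordinal_abs_inverse)
  then show ?thesis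
    by (auto simp: bdd_above_def)
qed

lemma card_of_lessThan_ordinal:
  fixes \<beta> :: "'a ordinal"
  shows "ordLeq3 (card_of {..<\<beta>}) (card_of (UNIV :: ('a + nat) set))"
proof -
  let ?r = "card_of (UNIV :: ('a + nat) set)"
  have "ordLess2 (card_of (underS (cardSuc ?r) (ordinal_rep \<beta>))) (cardSuc ?r)"
    using card_of_underS[OF cardSuc_Card_order[OF card_of_Card_order]] ordinal_rep by blast
  then have "ordLeq3 (card_of (underS (cardSuc ?r) (ordinal_rep \<beta>))) ?r"
    using cardSuc_ordLeq_ordLess[OF card_of_Card_order card_of_Card_order] by blast
  moreover have "ordinal_rep ` {..<\<beta>} \<subseteq> underS (cardSuc ?r) (ordinal_rep \<beta>)"
    by (auto simp: underS_def less_ordinal_def less_eq_ordinal_def ordinal_rep_inject)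
  then have "ordLeq3 (card_of {..<\<beta>}) (card_of (underS (cardSuc ?r) (ordinal_rep \<beta>)))"
    using card_of_ordLeq[of "{..<\<beta>}" "underS (cardSuc ?r) (ordinal_rep \<beta>)"]
    by (metis (no_types, lifting) inj_onI ordinal_rep_inject)
  ultimately show ?thesis
    using ordLeq_transitive by blast
qed

lemma bdd_above_image_lessThan:
  fixes f :: "'a ordinal \<Rightarrow> 'a ordinal"
  shows "bdd_above (f ` {..<\<beta>})"
  by (rule bdd_above_ordinal)
    (rule ordLeq_transitive[OF card_of_image card_of_lessThan_ordinal])

lemma bdd_above_countable:
  fixes A :: "'a ordinal set"
  assumes "countable A"
  shows "bdd_above A"
proof (rule bdd_above_ordinal)
  have "inj_on (\<lambda>x. Inr (to_nat_on A x) :: 'a + nat) A"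
    using inj_on_to_nat_on[OF assms] by (auto simp: inj_on_def)
  then show "ordLeq3 (card_of A) (card_of (UNIV :: ('a + nat) set))"
    using card_of_ordLeq by blast
qed

lemma ordinal_no_greatest: "\<exists>y. (x :: 'a ordinal) < y"
proof (rule ccontr)
  let ?r = "card_of (UNIV :: ('a + nat) set)"
  assume "\<not> ?thesis"
  then have top: "y \<le> x" for y
    by (auto simp: not_less)
  have "infinite (Field (cardSuc ?r))"
    using cardSuc_finite[OF card_of_Card_order, of "UNIV :: ('a + nat) set"]
    by (simp add: Field_card_of)
  then obtain a where "a \<in> Field (cardSuc ?r)" "ordinal_rep x \<noteq> a"
    "(ordinal_rep x, a) \<in> cardSuc ?r"
    using infinite_Card_order_limit[OF cardSuc_Card_order[OF card_of_Card_order]] ordinal_rep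
    by blast
  then have "x \<le> ordinal_abs a" "x \<noteq> ordinal_abs a"
    by (auto simp: less_eq_ordinal_def ordinal_abs_inverse)
  with top show False
    using order.antisym by blast
qed

definition osuc :: "'a ordinal \<Rightarrow> 'a ordinal" where
  "osuc x = (LEAST y. x < y)"

lemma less_osuc: "x < osuc x"
  unfolding osuc_def using ordinal_no_greatest by (rule LeastI_ex)

lemma osuc_le_iff: "osuc x \<le> y \<longleftrightarrow> x < y"
  by (metis Least_le less_osuc order_less_le_trans osuc_def)

lemma osuc_inject [simp]: "osuc x = osuc y \<longleftrightarrow> x = y"
  by (metis less_osuc neqE not_less osuc_le_iff)

instantiation ordinal :: (type) "{zero, one}"
begin

definition zero_ordinal :: "'a ordinal" where "(0 :: 'a ordinal) = (LEAST x. True)"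

definition one_ordinal :: "'a ordinal" where "(1 :: 'a ordinal) = osuc 0"

instance ..

end

lemma zero_le_ordinal [simp]: "(0 :: 'a ordinal) \<le> x"
  by (simp add: zero_ordinal_def Least_le)

lemma osuc_neq_zero [simp]: "osuc x \<noteq> 0"
  by (metis less_osuc not_less zero_le_ordinal)

definition limit_ordinal :: "'a ordinal \<Rightarrow> bool" where
  "limit_ordinal \<beta> \<longleftrightarrow> \<beta> \<noteq> 0 \<and> (\<forall>\<delta>. \<beta> \<noteq> osuc \<delta>)"

lemma ex_limit_ordinal: "\<exists>\<beta> :: 'a ordinal. limit_ordinal \<beta>"
proof -
  let ?A = "range (\<lambda>n. (osuc ^^ n) (0 :: 'a ordinal))"
  have bdd: "bdd_above ?A"
    by (rule bdd_above_countable) auto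
  have less: "(osuc ^^ n) 0 < Sup ?A" for n
  proof -
    have "(osuc ^^ Suc n) 0 \<le> Sup ?A"
      by (rule cSup_upper[OF _ bdd]) blast
    then show ?thesis
      by (simp add: osuc_le_iff)
  qed
  have "Sup ?A \<noteq> osuc \<delta>" for \<delta>
  proof
    assume eq: "Sup ?A = osuc \<delta>"
    have "a \<le> \<delta>" if "a \<in> ?A" for a
    proof -
      from that have "a < osuc \<delta>"
        unfolding eq[symmetric] using less by blast
      then show ?thesis
        using osuc_le_iff[of \<delta> a] by (simp add: not_le not_less flip: not_le)
    qed
    then have "Sup ?A \<le> \<delta>"
      by (intro cSup_least) auto
    with eq show False
      by (metis leD less_osuc)
  qed
  moreover have "Sup ?A \<noteq> 0"
    using less[of 0] by auto
  ultimately show ?thesis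
    by (auto simp: limit_ordinal_def)
qed

text \<open>Transfinite recursion with start value \<open>z\<close>, successor step \<open>s\<close> and limit step \<open>l\<close>, the
  latter applied to the set of all earlier values.\<close>

function ord_rec :: "'b \<Rightarrow> ('b \<Rightarrow> 'b) \<Rightarrow> ('b set \<Rightarrow> 'b) \<Rightarrow> 'a ordinal \<Rightarrow> 'b" where
  "ord_rec z s l \<beta> =
     (if \<beta> = 0 then z
      else if \<exists>\<delta>. \<beta> = osuc \<delta> then s (ord_rec z s l (THE \<delta>. \<beta> = osuc \<delta>))
      else l (ord_rec z s l ` {..<\<beta>}))"
  by pat_completeness auto
termination
  by (relation "inv_image {(x, y). x < y} (\<lambda>(z, s, l, \<beta>). \<beta>)")
    (auto simp: less_osuc intro!: wf_inv_image wellorder_class.wf)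

declare ord_rec.simps [simp del]

lemma ord_rec_0: "ord_rec z s l 0 = z"
  by (simp add: ord_rec.simps)

lemma ord_rec_osuc: "ord_rec z s l (osuc \<delta>) = s (ord_rec z s l \<delta>)"
  by (subst ord_rec.simps) simp

lemma ord_rec_limit:
  "limit_ordinal \<beta> \<Longrightarrow> ord_rec z s l \<beta> = l (ord_rec z s l ` {..<\<beta>})"
  by (subst ord_rec.simps) (auto simp: limit_ordinal_def)

instantiation ordinal :: (type) "{plus, times}"
begin

definition plus_ordinal :: "'a ordinal \<Rightarrow> 'a ordinal \<Rightarrow> 'a ordinal" where
  "(\<alpha> :: 'a ordinal) + \<beta> = ord_rec \<alpha> osuc Sup \<beta>"

definition times_ordinal :: "'a ordinal \<Rightarrow> 'a ordinal \<Rightarrow> 'a ordinal" where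
  "(\<alpha> :: 'a ordinal) * \<beta> = ord_rec 0 (\<lambda>x. x + \<alpha>) Sup \<beta>"

instance ..

end

lemma plus_ordinal_simps:
  fixes \<alpha> \<beta> :: "'a ordinal"
  shows "\<alpha> + 0 = \<alpha>"
    and "\<alpha> + osuc \<beta> = osuc (\<alpha> + \<beta>)"
    and "limit_ordinal \<beta> \<Longrightarrow> \<alpha> + \<beta> = (SUP \<delta>\<in>{..<\<beta>}. \<alpha> + \<delta>)"
  by (simp_all add: plus_ordinal_def ord_rec_0 ord_rec_osuc ord_rec_limit)

lemma times_ordinal_simps:
  fixes \<alpha> \<beta> :: "'a ordinal"
  shows "\<alpha> * 0 = 0"
    and "\<alpha> * osuc \<beta> = \<alpha> * \<beta> + \<alpha>"
    and "limit_ordinal \<beta> \<Longrightarrow> \<alpha> * \<beta> = (SUP \<delta>\<in>{..<\<beta>}. \<alpha> * \<delta>)"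
  by (simp_all add: times_ordinal_def ord_rec_0 ord_rec_osuc ord_rec_limit)

definition omega :: "'a ordinal" where
  "omega = (LEAST \<beta>. limit_ordinal \<beta>)"

text \<open>\<open>omega_pow \<beta>\<close> is the ordinal power \<open>\<omega>\<^sup>\<beta>\<close>.\<close>

definition omega_pow :: "'a ordinal \<Rightarrow> 'a ordinal" where
  "omega_pow \<beta> = ord_rec 1 (\<lambda>x. x * omega) Sup \<beta>"


lemma omega_pow_simps:
  fixes \<beta> :: "'a ordinal"
  shows "omega_pow 0 = (1 :: 'a ordinal)"
    and "omega_pow (osuc \<beta>) = omega_pow \<beta> * omega"
    and "limit_ordinal \<beta> \<Longrightarrow> omega_pow \<beta> = (SUP \<delta>\<in>{..<\<beta>}. omega_pow \<delta>)"
  by (simp_all add: omega_pow_def ord_rec_0 ord_rec_osuc ord_rec_limit)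

section \<open>The \<open>w\<^sup>*\<close>-dentability index\<close>

text \<open>The dual of a real normed space \<open>'x\<close> is \<open>'x \<Rightarrow>\<^sub>L real\<close> with the operator norm; the
  definitions below do not use completeness of \<open>'x\<close>.
  The Banach space \<open>C([0,\<alpha>])\<close> is \<open>'k \<Rightarrow>\<^sub>C real\<close> for a type \<open>'k\<close> whose universe is homeomorphic to
  \<open>{..\<alpha>}\<close>; it is compact, so every continuous function on it is bounded.  The subspace topology
  of the initial segment \<open>{..\<alpha>}\<close> is its order topology.\<close>

definition halfspace :: "'x::real_normed_vector \<Rightarrow> real \<Rightarrow> ('x \<Rightarrow>\<^sub>L real) set" where
  "halfspace x t = {f. blinfun_apply f x > t}"

text \<open>\<open>diameter\<close> has no useful value on unbounded sets; here it is only needed for subsets of the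
  dual unit ball.\<close>

definition dent_deriv :: "real \<Rightarrow> ('x::real_normed_vector \<Rightarrow>\<^sub>L real) set \<Rightarrow> ('x \<Rightarrow>\<^sub>L real) set" where
  "dent_deriv \<epsilon> B =
     {f \<in> B. \<forall>x t. f \<in> halfspace x t \<longrightarrow> diameter (B \<inter> halfspace x t) > \<epsilon>}"

definition dent_deriv_iter ::
    "real \<Rightarrow> 'a ordinal \<Rightarrow> ('x::real_normed_vector \<Rightarrow>\<^sub>L real) set \<Rightarrow> ('x \<Rightarrow>\<^sub>L real) set" where
  "dent_deriv_iter \<epsilon> \<beta> B = ord_rec B (dent_deriv \<epsilon>) Inter \<beta>"

text \<open>\<open>Dz_eps X \<epsilon>\<close> is unspecified if no iterate indexed by \<open>'a ordinal\<close> is empty; results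
  about \<open>Dz\<close> have to include that this does not happen.  The supremum defining \<open>Dz\<close> is then one of
  a bounded set: \<open>Dz_eps X \<epsilon>\<close> decreases in \<open>\<epsilon>\<close>, so it suffices to consider the countably many
  values \<open>\<epsilon> = 1/n\<close>, and countable sets are bounded (lemma \<open>bdd_above_countable\<close>).\<close>

definition Dz_eps :: "'x::real_normed_vector itself \<Rightarrow> real \<Rightarrow> 'a ordinal" where
  "Dz_eps X \<epsilon> = (LEAST \<beta>. dent_deriv_iter \<epsilon> \<beta> (cball 0 1 :: ('x \<Rightarrow>\<^sub>L real) set) = {})"

definition Dz :: "'x::real_normed_vector itself \<Rightarrow> 'a ordinal" where
  "Dz X = (SUP \<epsilon>\<in>{0<..}. Dz_eps X \<epsilon>)"

end

theory Submission
  imports Defs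
begin

text \<open>
  A functional \<open>f\<close> on \<open>C([0,\<alpha>])\<close> is coded by the function \<open>x \<mapsto> f(1\<^bsub>[0,x]\<^esub>)\<close> of bounded variation,
  and its norm is a variation.

  Upper bound.  The intersection of two slices is not a slice, so the contraction argument is run for
  a Szlenk-type derivation instead, applied to random functions (periodic sequences of functions of
  bounded variation, with the averaged variation as distance and a weak topology given by averages).
  A point of the \<open>\<beta>\<close>-th dentability derived set, seen as a constant sequence, lies in the \<open>\<beta>\<close>-th
  Szlenk derived set, because it is a weak* limit of means of points of the previous set far away from
  it, and rapidly oscillating sequences realise such means.  For \<open>\<kappa> = \<omega>\<^bsup>\<omega>\<^sup>\<gamma>\<^esup>\<close> and a disjoint union of copies of
  \<open>[0,\<kappa>)\<close>, truncation to finitely many initial segments \<open>[0,\<eta>]\<close> is additive for the norm; if all these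
  truncated balls vanish in fewer than \<open>\<theta> = \<omega>\<^bsup>1+\<gamma>\<^esup>\<close> steps, then \<open>\<theta>\<close> steps lower the norm by a fixed
  amount, and \<open>\<theta>m\<close> steps empty the ball.  Since \<open>[0,\<kappa>\<^sup>n)\<close> splits, up to equivalence of norms, into
  blocks of length \<open>\<kappa>\<close> through expansions in base \<open>\<kappa>\<close>, this is an induction on \<open>\<gamma>\<close>; its start is the
  uniform convexity of a finite-dimensional \<open>L\<^sup>2\<close>.

  Lower bound.  The evaluation at \<open>\<xi> + \<omega>\<^sup>\<beta>\<close> survives \<open>\<omega>\<beta>\<close> steps: it is a weak* limit of means of
  \<open>2\<^sup>n\<close> distinct evaluations at points \<open>\<xi>' + \<omega>\<^sup>\<sigma>\<close>, and halving such a set moves its mean by \<open>1\<close>.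
  Homogeneity turns survival of \<open>\<omega>\<^bsup>1+\<gamma>\<^esup>\<close> steps into survival of \<open>\<omega>\<^bsup>1+\<gamma>\<^esup>\<cdot>2\<^sup>n\<close> steps.
\<close>

section \<open>Ordinals\<close>

text \<open>The contraction argument must stay among functions whose truncation keeps norm above
  \<open>c - \<epsilon>\<close>. By lower semicontinuity this persists near any such function, so
  weak neighbourhoods can be shrunk to it, whereas the corresponding part of a slice need not be a
  slice. Random functions are the price, as in the classical comparison of the dentability index of
  a space X with the Szlenk index of a Bochner space L^p(X); periodic sequences stand in for
  measurable functions, with finite sums for integrals. The distance is an L^1 average because
  truncation is then additive: the norm that a truncation misses is the distance to it. The summand
  1 in \<open>1 + \<gamma>\<close> has two sources. From above, a ball in finitely many dimensions
  vanishes after finitely many steps, but their number is bounded only in terms of the dimension and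
  \<open>\<epsilon>\<close>, so the induction starts at \<open>omega\<close>. From below, passing
  from \<open>\<beta>\<close> to \<open>osuc \<beta>\<close> is worth \<open>omega\<close> steps,
  because means of \<open>2 ^ n\<close> evaluations survive \<open>n\<close> halvings, for every
  \<open>n\<close>.\<close>

lemma limit_ordinalD: "limit_ordinal \<beta> \<Longrightarrow> \<delta> < \<beta> \<Longrightarrow> osuc \<delta> < \<beta>"
  by (metis limit_ordinal_def order_le_less osuc_le_iff)

lemma less_osuc_iff: "x < osuc y \<longleftrightarrow> x \<le> y"
  by (metis leD leI osuc_le_iff)

lemma ordinal_gt_zero: "x \<noteq> 0 \<longleftrightarrow> 0 < (x :: 'a ordinal)"
  by (metis order_le_less zero_le_ordinal less_irrefl)

lemma not_less_zero_ordinal [simp]: "\<not> x < (0 :: 'a ordinal)"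
  by (simp add: not_less)

lemma zero_less_osuc [simp]: "0 < osuc x"
  by (simp add: less_osuc_iff)

lemma limit_ordinalI: "\<beta> \<noteq> 0 \<Longrightarrow> (\<And>\<delta>. \<delta> < \<beta> \<Longrightarrow> osuc \<delta> < \<beta>) \<Longrightarrow> limit_ordinal \<beta>"
  unfolding limit_ordinal_def by (metis less_irrefl less_osuc)

lemma limit_ordinal_pos: "limit_ordinal \<beta> \<Longrightarrow> 0 < \<beta>"
  by (simp add: limit_ordinal_def ordinal_gt_zero)

lemma ordinal_cases [case_names zero suc limit]:
  obtains "\<beta> = 0" | \<delta> where "\<beta> = osuc \<delta>" | "limit_ordinal \<beta>"
  by (auto simp: limit_ordinal_def)

lemma ordinal_induct [case_names zero suc limit]:
  fixes \<beta> :: "'a ordinal"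
  assumes "P 0" "\<And>\<delta>. P \<delta> \<Longrightarrow> P (osuc \<delta>)"
    "\<And>\<beta>. limit_ordinal \<beta> \<Longrightarrow> (\<And>\<delta>. \<delta> < \<beta> \<Longrightarrow> P \<delta>) \<Longrightarrow> P \<beta>"
  shows "P \<beta>"
proof (induction \<beta> rule: less_induct)
  case (less \<beta>)
  then show ?case
    by (cases \<beta> rule: ordinal_cases) (use assms less_osuc in auto)
qed

subsection \<open>Normal functions\<close>

definition normal_fun :: "('a ordinal \<Rightarrow> 'a ordinal) \<Rightarrow> bool" where
  "normal_fun f \<longleftrightarrow> (\<forall>\<beta>. f \<beta> < f (osuc \<beta>)) \<and>
     (\<forall>\<beta>. limit_ordinal \<beta> \<longrightarrow> f \<beta> = (SUP \<delta>\<in>{..<\<beta>}. f \<delta>))"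

lemma less_SUP_lessThan_iff:
  fixes f :: "'a ordinal \<Rightarrow> 'a ordinal"
  assumes "limit_ordinal \<beta>"
  shows "y < (SUP \<delta>\<in>{..<\<beta>}. f \<delta>) \<longleftrightarrow> (\<exists>\<delta><\<beta>. y < f \<delta>)"
proof -
  have "{..<\<beta>} \<noteq> {}"
    using limit_ordinal_pos[OF assms] by auto
  then show ?thesis
    using less_cSUP_iff[OF _ bdd_above_image_lessThan, of \<beta> y f] by auto
qed

lemma normal_fun_less_limit:
  "normal_fun f \<Longrightarrow> limit_ordinal \<beta> \<Longrightarrow> y < f \<beta> \<longleftrightarrow> (\<exists>\<delta><\<beta>. y < f \<delta>)"
  by (simp add: normal_fun_def less_SUP_lessThan_iff)

lemma normal_fun_strict_mono:
  assumes f: "normal_fun f"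
  shows "strict_mono f"
proof (rule strict_monoI)
  fix a b :: "'a ordinal"
  assume "a < b"
  then show "f a < f b"
  proof (induction b rule: ordinal_induct)
    case (suc \<delta>)
    then have "f a \<le> f \<delta>"
      by (auto simp: less_osuc_iff order_le_less)
    also have "f \<delta> < f (osuc \<delta>)"
      using f by (simp add: normal_fun_def)
    finally show ?case .
  next
    case (limit \<beta>)
    then have "osuc a < \<beta>"
      using limit_ordinalD by blast
    then show ?case
      using f limit normal_fun_less_limit[OF f] by (auto simp: normal_fun_def)
  qed simp
qed

lemma normal_funD:
  assumes "normal_fun f"
  shows "f x < f y \<longleftrightarrow> x < y" "f x \<le> f y \<longleftrightarrow> x \<le> y" "f x = f y \<longleftrightarrow> x = y"
  using normal_fun_strict_mono[OF assms]
  by (simp_all add: strict_mono_less strict_mono_less_eq strict_mono_eq)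

lemma normal_fun_le:
  assumes f: "normal_fun f"
  shows "x \<le> f x"
proof (induction x rule: less_induct)
  case (less x)
  then show ?case
    by (metis f leI less_irrefl normal_funD(1) order_le_less_trans)
qed

lemma normal_fun_limit:
  assumes f: "normal_fun f" and \<beta>: "limit_ordinal \<beta>"
  shows "limit_ordinal (f \<beta>)"
proof (rule limit_ordinalI)
  show "f \<beta> \<noteq> 0"
    by (metis \<beta> f limit_ordinal_pos normal_fun_le leD)
  fix y assume "y < f \<beta>"
  then show "osuc y < f \<beta>"
    by (metis \<beta> f normal_fun_less_limit normal_funD(1) order_le_less_trans osuc_le_iff)
qed

text \<open>The least argument whose value exceeds \<open>x\<close> is no limit, since values at
  limits are suprema of earlier ones; hence it is a successor. Subtraction and division of ordinals
  are both instances.\<close>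

lemma normal_fun_floor:
  assumes f: "normal_fun f" and "f 0 \<le> x"
  shows "\<exists>q. f q \<le> x \<and> x < f (osuc q)"
proof -
  define q' where "q' = (LEAST q. x < f q)"
  have ex: "x < f (osuc x)"
    using normal_fun_le[OF f, of "osuc x"] less_osuc[of x] by order
  have q': "x < f q'"
    unfolding q'_def using ex by (rule LeastI)
  have least: "f d \<le> x" if "d < q'" for d
    using that not_less_Least unfolding q'_def by (metis not_less)
  show ?thesis
  proof (cases q' rule: ordinal_cases)
    case zero
    then show ?thesis using q' assms(2) by auto
  next
    case (suc \<delta>)
    then show ?thesis using q' least less_osuc by metis
  next
    case limit
    then show ?thesis using q' least normal_fun_less_limit[OF f limit] by (metis leD)
  qed
qed

lemma less_limit_iff: "limit_ordinal \<beta> \<Longrightarrow> y < \<beta> \<longleftrightarrow> (\<exists>\<delta><\<beta>. y < \<delta>)"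
  by (meson less_osuc less_trans limit_ordinalD)

text \<open>The values \<open>f d\<close> with \<open>d < c\<close> are cofinal in
  \<open>f c\<close>. This is the limit case of both associative laws, of distributivity and of the
  exponent law.\<close>

lemma ex_less_normal_fun_iff:
  assumes f: "normal_fun f" and g: "normal_fun g" and c: "limit_ordinal c"
  shows "(\<exists>e<f c. y < g e) \<longleftrightarrow> (\<exists>d<c. y < g (f d))"
proof
  assume "\<exists>e<f c. y < g e"
  then obtain e d where "y < g e" "d < c" "e < f d"
    using normal_fun_less_limit[OF f c] by blast
  moreover have "g e < g (f d)"
    using \<open>e < f d\<close> normal_funD(1)[OF g] by blast
  ultimately show "\<exists>d<c. y < g (f d)"
    using less_trans by blast
next
  assume "\<exists>d<c. y < g (f d)"
  then show "\<exists>e<f c. y < g e"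
    using normal_funD(1)[OF f] by blast
qed

lemma ordinal_eqI: "(\<And>y. y < a \<longleftrightarrow> y < b) \<Longrightarrow> a = (b :: 'a ordinal)"
  by (metis less_irrefl linorder_cases)

subsection \<open>Ordinal arithmetic\<close>

lemma normal_fun_plus: "normal_fun ((+) a)"
  by (simp add: normal_fun_def plus_ordinal_simps less_osuc)

lemmas plus_less_iff [simp] = normal_funD[OF normal_fun_plus]
lemmas less_plus_limit = normal_fun_less_limit[OF normal_fun_plus]

lemma zero_plus_ordinal [simp]: "0 + (a :: 'a ordinal) = a"
proof (induction a rule: ordinal_induct)
  case (limit \<beta>)
  then show ?case
    by (intro ordinal_eqI) (simp add: less_plus_limit less_limit_iff[OF limit(1), symmetric] cong: conj_cong)
qed (auto simp: plus_ordinal_simps)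

lemma plus_zero_ordinal [simp]: "(a :: 'a ordinal) + 0 = a"
  by (simp add: plus_ordinal_simps)

lemma le_plus_ordinal [simp]: "a \<le> a + (b :: 'a ordinal)"
  by (metis plus_less_iff(2) plus_zero_ordinal zero_le_ordinal)

lemma plus_one_ordinal: "a + 1 = osuc (a :: 'a ordinal)"
  by (simp add: one_ordinal_def plus_ordinal_simps)

lemma plus_assoc_ordinal: "(a + b) + c = a + (b + c :: 'a ordinal)"
proof (induction c rule: ordinal_induct)
  case (limit c)
  have lim: "limit_ordinal (b + c)"
    using normal_fun_limit[OF normal_fun_plus limit(1)] .
  show ?case
  proof (rule ordinal_eqI)
    fix y
    have "y < (a + b) + c \<longleftrightarrow> (\<exists>d<c. y < a + (b + d))"
      using limit by (auto simp: less_plus_limit)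
    also have "\<dots> \<longleftrightarrow> (\<exists>e<b+c. y < a + e)"
      using ex_less_normal_fun_iff[OF normal_fun_plus normal_fun_plus limit(1)] by blast
    finally show "y < (a + b) + c \<longleftrightarrow> y < a + (b + c)"
      by (simp add: less_plus_limit[OF lim])
  qed
qed (simp_all add: plus_ordinal_simps)

lemma ordinal_le_imp_plus: "a \<le> x \<Longrightarrow> \<exists>r. x = a + (r :: 'a ordinal)"
  using normal_fun_floor[OF normal_fun_plus, of a x]
  by (metis less_osuc_iff order.antisym plus_ordinal_simps(2) plus_zero_ordinal)

lemma normal_fun_times: "0 < a \<Longrightarrow> normal_fun ((*) a)"
  using plus_less_iff(1)[of _ 0 a] by (simp add: normal_fun_def times_ordinal_simps)

lemma zero_times_ordinal [simp]: "0 * (a :: 'a ordinal) = 0"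
proof (induction a rule: ordinal_induct)
  case (limit a)
  then show ?case
    using limit_ordinal_pos[OF limit(1)] by (auto simp: times_ordinal_simps image_constant_conv)
qed (auto simp: times_ordinal_simps)

lemma times_zero_ordinal [simp]: "(a :: 'a ordinal) * 0 = 0"
  by (simp add: times_ordinal_simps)

lemma times_one_ordinal [simp]: "(a :: 'a ordinal) * 1 = a"
  by (simp add: one_ordinal_def times_ordinal_simps)

lemma one_times_ordinal [simp]: "1 * (a :: 'a ordinal) = a"
proof (induction a rule: ordinal_induct)
  case (limit \<beta>)
  have "0 < (1 :: 'a ordinal)" by (simp add: one_ordinal_def)
  note * = normal_fun_less_limit[OF normal_fun_times[OF this] limit(1)]
  show ?case
    using limit(2) by (intro ordinal_eqI) (simp add: * less_limit_iff[OF limit(1), symmetric] cong: conj_cong)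
qed (auto simp: times_ordinal_simps plus_one_ordinal)

lemmas times_less_iff = normal_funD[OF normal_fun_times]
lemmas less_times_limit = normal_fun_less_limit[OF normal_fun_times]
lemmas times_limit = normal_fun_limit[OF normal_fun_times]

lemma times_plus_ordinal: "a * (b + c) = a * b + a * (c :: 'a ordinal)"
proof (cases "a = 0")
  case False
  then have a: "0 < a" by (simp add: ordinal_gt_zero)
  show ?thesis
  proof (induction c rule: ordinal_induct)
    case (limit c)
    have lim: "limit_ordinal (b + c)" "limit_ordinal (a * c)"
      using normal_fun_limit[OF normal_fun_plus limit(1)] times_limit[OF a limit(1)] by auto
    show ?case
    proof (rule ordinal_eqI)
      fix y
      have "y < a * (b + c) \<longleftrightarrow> (\<exists>e<b+c. y < a * e)"
        by (simp add: less_times_limit[OF a lim(1)])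
      also have "\<dots> \<longleftrightarrow> (\<exists>d<c. y < a * (b + d))"
        using ex_less_normal_fun_iff[OF normal_fun_plus normal_fun_times[OF a] limit(1)] by blast
      also have "\<dots> \<longleftrightarrow> (\<exists>d<c. y < a * b + a * d)"
        using limit by auto
      also have "\<dots> \<longleftrightarrow> (\<exists>e<a*c. y < a * b + e)"
        using ex_less_normal_fun_iff[OF normal_fun_times[OF a] normal_fun_plus limit(1)] by blast
      finally show "y < a * (b + c) \<longleftrightarrow> y < a * b + a * c"
        by (simp add: less_plus_limit[OF lim(2)])
    qed
  qed (simp_all add: times_ordinal_simps plus_ordinal_simps plus_assoc_ordinal)
qed simp

lemma times_assoc_ordinal: "(a * b) * c = a * (b * c :: 'a ordinal)"
proof (cases "a = 0 \<or> b = 0")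
  case False
  then have a: "0 < a" and b: "0 < b" by (auto simp: ordinal_gt_zero)
  have ab: "0 < a * b"
    using times_less_iff(1)[OF a, of 0 b] b by simp
  show ?thesis
  proof (induction c rule: ordinal_induct)
    case (limit c)
    have lim: "limit_ordinal (b * c)"
      using times_limit[OF b limit(1)] by auto
    show ?case
    proof (rule ordinal_eqI)
      fix y
      have "y < (a * b) * c \<longleftrightarrow> (\<exists>d<c. y < a * (b * d))"
        using limit by (auto simp: less_times_limit[OF ab])
      also have "\<dots> \<longleftrightarrow> (\<exists>e<b*c. y < a * e)"
        using ex_less_normal_fun_iff[OF normal_fun_times[OF b] normal_fun_times[OF a] limit(1)] by blast
      finally show "y < (a * b) * c \<longleftrightarrow> y < a * (b * c)"
        by (simp add: less_times_limit[OF a lim])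
    qed
  qed (simp_all add: times_ordinal_simps times_plus_ordinal)
qed auto

lemma ordinal_division:
  assumes "0 < k"
  shows "\<exists>q r. x = k * q + r \<and> r < (k :: 'a ordinal)"
proof -
  obtain q where q: "k * q \<le> x" "x < k * osuc q"
    using normal_fun_floor[OF normal_fun_times[OF assms], of x] by auto
  then obtain r where "x = k * q + r"
    using ordinal_le_imp_plus by blast
  with q show ?thesis
    by (auto simp: times_ordinal_simps)
qed

lemma ordinal_division_less:
  assumes "q < q'" "r < k"
  shows "k * q + r < k * (q' :: 'a ordinal)"
proof -
  have k: "0 < k" using assms(2) by (metis not_less_zero_ordinal ordinal_gt_zero)
  have "k * q + r < k * osuc q"
    using assms by (simp add: times_ordinal_simps)
  also have "\<dots> \<le> k * q'"
    using assms by (simp add: times_less_iff[OF k] osuc_le_iff)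
  finally show ?thesis .
qed

subsection \<open>Finite ordinals and powers of omega\<close>

definition fin_ord :: "nat \<Rightarrow> 'a ordinal" where
  "fin_ord n = (osuc ^^ n) 0"

lemma fin_ord_simps [simp]: "fin_ord 0 = 0" "fin_ord (Suc n) = osuc (fin_ord n)"
  by (simp_all add: fin_ord_def)

lemma limit_omega: "limit_ordinal omega"
  unfolding omega_def using ex_limit_ordinal by (rule LeastI_ex)

lemma less_omega_iff: "x < omega \<longleftrightarrow> (\<exists>n. x = fin_ord n)"
proof
  show "x < omega \<Longrightarrow> \<exists>n. x = fin_ord n"
  proof (induction x rule: ordinal_induct)
    case zero
    then show ?case by (metis fin_ord_simps(1))
  next
    case (suc \<delta>)
    then show ?case by (metis fin_ord_simps(2) less_osuc less_trans)
  next
    case (limit \<beta>)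
    then show ?case using not_less_Least unfolding omega_def by blast
  qed
  have "fin_ord n < omega" for n
    by (induction n) (use limit_omega limit_ordinalD limit_ordinal_pos in auto)
  then show "\<exists>n. x = fin_ord n \<Longrightarrow> x < omega" by blast
qed

lemma fin_ord_less_omega [simp]: "fin_ord n < omega"
  using less_omega_iff by blast

lemma finite_atMost_fin_ord: "finite {..(fin_ord n :: 'a ordinal)}"
proof (induction n)
  case (Suc n)
  have "{..fin_ord (Suc n) :: 'a ordinal} = insert (fin_ord (Suc n)) {..fin_ord n}"
    by (auto simp: less_osuc_iff order_le_less)
  then show ?case using Suc by simp
qed (auto simp: order.antisym intro: finite_subset[of _ "{0}"])

lemma fin_ord_mono: "m \<le> n \<Longrightarrow> fin_ord m \<le> (fin_ord n :: 'a ordinal)"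
  by (induction rule: dec_induct) (auto intro: order_trans less_imp_le[OF less_osuc])

lemma less_omega_mult: "y < \<theta> * omega \<longleftrightarrow> (\<exists>n. y < \<theta> * fin_ord n)"
proof (cases "\<theta> = 0")
  case False
  then show ?thesis
    using less_times_limit[OF _ limit_omega, of \<theta>] less_omega_iff
    by (metis ordinal_gt_zero)
qed simp

lemma times_fin_ord_add: "\<theta> * fin_ord m + \<theta> * fin_ord n = \<theta> * fin_ord (m + n)"
  by (induction n) (simp_all add: times_ordinal_simps flip: plus_assoc_ordinal)

lemma normal_fun_omega_pow: "normal_fun omega_pow"
proof -
  have pos: "0 < omega_pow \<beta>" for \<beta> :: "'a ordinal"
  proof (induction \<beta> rule: ordinal_induct)
    case (suc \<delta>)
    then show ?case
      using times_less_iff(1)[OF suc, of 0 omega] limit_ordinal_pos[OF limit_omega]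
      by (simp add: omega_pow_simps)
  next
    case (limit \<beta>)
    then show ?case
      using limit_ordinal_pos by (auto simp: omega_pow_simps less_SUP_lessThan_iff)
  qed (simp add: omega_pow_simps one_ordinal_def)
  have "1 < (omega :: 'a ordinal)"
    using limit_ordinalD[OF limit_omega limit_ordinal_pos[OF limit_omega]] by (simp add: one_ordinal_def)
  then have "omega_pow \<beta> < omega_pow \<beta> * omega" for \<beta> :: "'a ordinal"
    using times_less_iff(1)[OF pos[of \<beta>], of 1 omega] by simp
  then show ?thesis
    by (simp add: normal_fun_def omega_pow_simps)
qed

lemmas omega_pow_less_iff [simp] = normal_funD[OF normal_fun_omega_pow]
lemmas less_omega_pow_limit = normal_fun_less_limit[OF normal_fun_omega_pow]

lemma omega_pow_pos [simp]: "0 < omega_pow \<beta>"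
proof -
  have "omega_pow 0 \<le> omega_pow \<beta>"
    by simp
  then show ?thesis
    using zero_less_osuc[of 0] by (simp add: omega_pow_simps one_ordinal_def osuc_le_iff)
qed

lemma omega_pow_one [simp]: "omega_pow 1 = omega"
  using omega_pow_simps(2)[of 0] by (simp add: omega_pow_simps(1) one_ordinal_def[symmetric])

lemma limit_omega_pow: "\<beta> \<noteq> 0 \<Longrightarrow> limit_ordinal (omega_pow \<beta>)"
  by (cases \<beta> rule: ordinal_cases)
    (auto simp: omega_pow_simps(2) times_limit limit_omega normal_fun_limit[OF normal_fun_omega_pow])

lemma omega_pow_plus: "omega_pow (a + b) = omega_pow a * omega_pow b"
proof (induction b rule: ordinal_induct)
  case (limit b)
  have lim: "limit_ordinal (a + b)" "limit_ordinal (omega_pow b)"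
    using normal_fun_limit[OF normal_fun_plus limit(1)] limit_omega_pow limit(1)
    by (auto simp: limit_ordinal_def)
  show ?case
  proof (rule ordinal_eqI)
    fix y
    have "y < omega_pow (a + b) \<longleftrightarrow> (\<exists>e<a+b. y < omega_pow e)"
      by (simp add: less_omega_pow_limit[OF lim(1)])
    also have "\<dots> \<longleftrightarrow> (\<exists>d<b. y < omega_pow (a + d))"
      using ex_less_normal_fun_iff[OF normal_fun_plus normal_fun_omega_pow limit(1)] by blast
    also have "\<dots> \<longleftrightarrow> (\<exists>d<b. y < omega_pow a * omega_pow d)"
      using limit by auto
    also have "\<dots> \<longleftrightarrow> (\<exists>e<omega_pow b. y < omega_pow a * e)"
      using ex_less_normal_fun_iff[OF normal_fun_omega_pow normal_fun_times[OF omega_pow_pos] limit(1)] by blast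
    finally show "y < omega_pow (a + b) \<longleftrightarrow> y < omega_pow a * omega_pow b"
      by (simp add: less_times_limit[OF omega_pow_pos lim(2)])
  qed
qed (simp_all add: omega_pow_simps plus_ordinal_simps times_assoc_ordinal)

lemma omega_times_omega_pow: "omega * omega_pow \<gamma> = omega_pow (1 + \<gamma>)"
  by (simp add: omega_pow_plus)

section \<open>Variation\<close>

text \<open>A triple \<open>(u, x, y)\<close> is the interval from \<open>x\<close> to \<open>y\<close> in the copy with index \<open>u\<close>.  Lists and degenerate
  intervals are admitted so that a monotone map of the points acts on a family by \<open>map\<close>.\<close>

definition nonov :: "'o::linorder set \<Rightarrow> ('u \<times> 'o \<times> 'o) list \<Rightarrow> bool" where
  "nonov S Q \<longleftrightarrow> (\<forall>(u, x, y)\<in>set Q. x \<le> y \<and> x \<in> S \<and> y \<in> S) \<and>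
     sorted_wrt (\<lambda>(u, x, y) (u', x', y'). u = u' \<longrightarrow> y \<le> x' \<or> y' \<le> x) Q"

definition qsum :: "('u \<times> 'o \<times> 'o) list \<Rightarrow> ('u \<Rightarrow> 'o \<Rightarrow> real) \<Rightarrow> real" where
  "qsum Q h = (\<Sum>(u, x, y)\<leftarrow>Q. \<bar>h u y - h u x\<bar>)"

definition var_le :: "'o::linorder set \<Rightarrow> ('u \<Rightarrow> 'o \<Rightarrow> real) \<Rightarrow> real \<Rightarrow> bool" where
  "var_le S h c \<longleftrightarrow> (\<forall>Q. nonov S Q \<longrightarrow> qsum Q h \<le> c)"

text \<open>A supremum of reals, meaningful only if the sums are bounded. This is why lemmas that
  estimate a quantity by \<open>tvar\<close> from above carry a hypothesis
  \<open>var_le\<close>.\<close>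

definition tvar :: "'o::linorder set \<Rightarrow> ('u \<Rightarrow> 'o \<Rightarrow> real) \<Rightarrow> real" where
  "tvar S h = (SUP Q\<in>{Q. nonov S Q}. qsum Q h)"

lemma nonov_Nil [simp]: "nonov S []"
  by (simp add: nonov_def)

lemma qsum_Nil [simp]: "qsum [] h = 0"
  by (simp add: qsum_def)

lemma qsum_Cons: "qsum ((u, x, y) # Q) h = \<bar>h u y - h u x\<bar> + qsum Q h"
  by (simp add: qsum_def)

lemma qsum_append: "qsum (Q @ Q') h = qsum Q h + qsum Q' h"
  by (simp add: qsum_def)

lemma nonov_mono: "nonov S Q \<Longrightarrow> S \<subseteq> S' \<Longrightarrow> nonov S' Q"
  unfolding nonov_def by fastforce

lemma var_le_mono: "var_le S h c \<Longrightarrow> S' \<subseteq> S \<Longrightarrow> c \<le> c' \<Longrightarrow> var_le S' h c'"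
  unfolding var_le_def by (meson nonov_mono order_trans)

lemma var_leD: "var_le S h c \<Longrightarrow> nonov S Q \<Longrightarrow> qsum Q h \<le> c"
  by (simp add: var_le_def)

lemma var_le_bdd: "var_le S h c \<Longrightarrow> bdd_above ((\<lambda>Q. qsum Q h) ` {Q. nonov S Q})"
  by (auto simp: var_le_def bdd_above_def)

lemma tvar_le: "var_le S h c \<Longrightarrow> tvar S h \<le> c"
  unfolding tvar_def by (rule cSUP_least) (auto simp: var_le_def intro: nonov_Nil)

lemma qsum_le_tvar: "var_le S h c \<Longrightarrow> nonov S Q \<Longrightarrow> qsum Q h \<le> tvar S h"
  unfolding tvar_def by (rule cSUP_upper[OF _ var_le_bdd]) auto

lemma var_le_tvar: "var_le S h c \<Longrightarrow> var_le S h (tvar S h)"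
  using qsum_le_tvar unfolding var_le_def by blast

lemma tvar_nonneg: "var_le S h c \<Longrightarrow> 0 \<le> tvar S h"
  using qsum_le_tvar[of S h c "[]"] by simp

lemma less_tvarE:
  assumes "c' < tvar S h"
  obtains Q where "nonov S Q" "c' < qsum Q h"
proof -
  have "\<not> (\<forall>Q. nonov S Q \<longrightarrow> qsum Q h \<le> c')"
    using assms tvar_le[of S h c'] by (auto simp: var_le_def)
  with that show ?thesis
    by (meson not_le)
qed

lemma tvar_mono: "var_le S h c \<Longrightarrow> S' \<subseteq> S \<Longrightarrow> tvar S' h \<le> tvar S h"
  by (meson order_refl tvar_le var_le_mono var_le_tvar)

lemma qsum_diff_le:
  "qsum Q (\<lambda>u x. h u x - k u x) \<le> qsum Q (\<lambda>u x. h u x - l u x) + qsum Q (\<lambda>u x. l u x - k u x)"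
proof (induction Q)
  case (Cons q Q)
  obtain u x y where q: "q = (u, x, y)" by (cases q)
  have "\<bar>(h u y - k u y) - (h u x - k u x)\<bar>
      \<le> \<bar>(h u y - l u y) - (h u x - l u x)\<bar> + \<bar>(l u y - k u y) - (l u x - k u x)\<bar>"
    by linarith
  then show ?case
    using Cons by (simp add: q qsum_Cons)
qed simp

lemma qsum_uminus: "qsum Q (\<lambda>u x. k u x - h u x) = qsum Q (\<lambda>u x. h u x - k u x)"
  unfolding qsum_def by (rule arg_cong[where f = sum_list], rule map_cong) auto

lemma qsum_diff_le': "qsum Q (\<lambda>u x. h u x - k u x) \<le> qsum Q h + qsum Q k"
  using qsum_diff_le[of Q h k "\<lambda>_ _. 0"] qsum_uminus[of Q k "\<lambda>_ _. 0"] by simp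

lemma qsum_cmult: "qsum Q (\<lambda>u x. c * h u x) = \<bar>c\<bar> * qsum Q h"
proof (induction Q)
  case (Cons q Q)
  then show ?case
    by (cases q) (simp add: qsum_Cons distrib_left abs_mult flip: right_diff_distrib)
qed simp

lemma var_le_diff:
  "var_le S h c \<Longrightarrow> var_le S k d \<Longrightarrow> var_le S (\<lambda>u x. h u x - k u x) (c + d)"
  unfolding var_le_def using qsum_diff_le'[of _ h k] by (meson add_mono order_trans)

lemma tvar_diff_triangle:
  assumes "var_le S h a" "var_le S k b" "var_le S l c"
  shows "tvar S (\<lambda>u x. h u x - k u x) \<le> tvar S (\<lambda>u x. h u x - l u x) + tvar S (\<lambda>u x. l u x - k u x)"
proof (rule tvar_le, unfold var_le_def, intro allI impI)
  fix Q :: "('b \<times> 'a \<times> 'a) list"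
  assume "nonov S Q"
  then show "qsum Q (\<lambda>u x. h u x - k u x)
      \<le> tvar S (\<lambda>u x. h u x - l u x) + tvar S (\<lambda>u x. l u x - k u x)"
    using qsum_diff_le[of Q h k l] qsum_le_tvar[OF var_le_diff[OF assms(1,3)], of Q]
      qsum_le_tvar[OF var_le_diff[OF assms(3,2)], of Q] by linarith
qed

lemma tvar_diff_commute: "tvar S (\<lambda>u x. h u x - k u x) = tvar S (\<lambda>u x. k u x - h u x)"
  unfolding tvar_def by (subst qsum_uminus) simp

text \<open>The map \<open>\<phi>\<close> may merge copies. Within one copy monotonicity of
  \<open>\<rho>\<close> keeps intervals apart; \<open>disj\<close> takes care of intervals from
  different copies that land in the same one, as happens when blocks are put back into the interval
  they come from.\<close>

lemma nonov_map:
  assumes Q: "nonov S Q"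
    and mono: "\<And>u x y. x \<in> S \<Longrightarrow> y \<in> S \<Longrightarrow> x \<le> y \<Longrightarrow> \<rho> u x \<le> \<rho> u y"
    and mem: "\<And>u x. x \<in> S \<Longrightarrow> \<rho> u x \<in> S'"
    and disj: "\<And>u v x y x' y'. (u, x, y) \<in> set Q \<Longrightarrow> (v, x', y') \<in> set Q \<Longrightarrow> \<phi> u = \<phi> v \<Longrightarrow> u \<noteq> v \<Longrightarrow>
      \<rho> u y \<le> \<rho> v x' \<or> \<rho> v y' \<le> \<rho> u x"
  shows "nonov S' (map (\<lambda>(u, x, y). (\<phi> u, \<rho> u x, \<rho> u y)) Q)"
  unfolding nonov_def sorted_wrt_map
proof (intro conjI)
  have "sorted_wrt (\<lambda>(u, x, y) (u', x', y'). u = u' \<longrightarrow> y \<le> x' \<or> y' \<le> x) Q"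
    using Q by (simp add: nonov_def)
  then show "sorted_wrt (\<lambda>a b. (\<lambda>(u, x, y) (u', x', y'). u = u' \<longrightarrow> y \<le> x' \<or> y' \<le> x)
      ((\<lambda>(u, x, y). (\<phi> u, \<rho> u x, \<rho> u y)) a) ((\<lambda>(u, x, y). (\<phi> u, \<rho> u x, \<rho> u y)) b)) Q"
  proof (rule sorted_wrt_mono_rel[rotated])
    fix a b
    assume ab: "a \<in> set Q" "b \<in> set Q"
      "(\<lambda>(u, x, y) (u', x', y'). u = u' \<longrightarrow> y \<le> x' \<or> y' \<le> x) a b"
    obtain u x y v x' y' where [simp]: "a = (u, x, y)" "b = (v, x', y')"
      by (cases a, cases b)
    have "x \<in> S" "y \<in> S" "x' \<in> S" "y' \<in> S"
      using ab Q by (auto simp: nonov_def)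
    then show "(\<lambda>(u, x, y) (u', x', y'). u = u' \<longrightarrow> y \<le> x' \<or> y' \<le> x)
      ((\<lambda>(u, x, y). (\<phi> u, \<rho> u x, \<rho> u y)) a) ((\<lambda>(u, x, y). (\<phi> u, \<rho> u x, \<rho> u y)) b)"
      using ab disj[of u x y v x' y'] mono[of y x' u] mono[of y' x u] by auto
  qed
qed (use assms in \<open>auto simp: nonov_def\<close>)

lemma nonov_filter: "nonov S Q \<Longrightarrow> nonov S (filter P Q)"
  by (auto simp: nonov_def sorted_wrt_filter)

lemma qsum_map:
  "qsum (map (\<lambda>(u, x, y). (\<phi> u, \<rho> u x, \<rho> u y)) Q) h = qsum Q (\<lambda>u x. h (\<phi> u) (\<rho> u x))"
  by (induction Q) (auto simp: qsum_Cons)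

lemma qsum_cong:
  assumes "\<And>u x y. (u, x, y) \<in> set Q \<Longrightarrow> \<bar>h u y - h u x\<bar> = \<bar>k u y - k u x\<bar>"
  shows "qsum Q h = qsum Q k"
  using assms unfolding qsum_def by (intro arg_cong[where f = sum_list] map_cong) auto

lemma qsum_filter:
  assumes "\<And>u x y. (u, x, y) \<in> set Q \<Longrightarrow> \<not> P (u, x, y) \<Longrightarrow> h u y = h u x"
  shows "qsum (filter P Q) h = qsum Q h"
  unfolding qsum_def using assms by (intro sum_list_map_filter) auto

lemma nonov_append:
  assumes "nonov S Q" "nonov S Q'"
    and "\<And>u x y x' y'. (u, x, y) \<in> set Q \<Longrightarrow> (u, x', y') \<in> set Q' \<Longrightarrow> y \<le> x' \<or> y' \<le> x"
  shows "nonov S (Q @ Q')"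
  using assms unfolding nonov_def by (fastforce simp: sorted_wrt_append)

subsection \<open>Truncation\<close>

text \<open>The function is stopped at \<open>\<eta>\<close> and not reset to 0 beyond it, so no
  jump is created there.\<close>

definition trunc :: "'u set \<Rightarrow> 'o::linorder \<Rightarrow> ('u \<Rightarrow> 'o \<Rightarrow> real) \<Rightarrow> 'u \<Rightarrow> 'o \<Rightarrow> real" where
  "trunc J \<eta> h u x = (if u \<in> J then h u (min x \<eta>) else 0)"

text \<open>Clipping the ends at \<open>\<eta>\<close> moves all points into \<open>S\<close>;
  intervals beyond \<open>\<eta>\<close> become degenerate, and copies outside \<open>J\<close>
  contribute nothing.\<close>

lemma trunc_qsum:
  assumes "nonov UNIV Q" "{..\<eta>} \<subseteq> S"
  obtains Q' where "nonov S Q'" "qsum Q (trunc J \<eta> h) = qsum Q' h"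
    "\<And>u x y. (u, x, y) \<in> set Q' \<Longrightarrow> u \<in> J \<and> y \<le> \<eta>"
proof
  define Q' where "Q' = map (\<lambda>(u, x, y). (u, min x \<eta>, min y \<eta>)) (filter (\<lambda>(u, x, y). u \<in> J) Q)"
  show "nonov S Q'"
    unfolding Q'_def
    by (rule nonov_map[OF nonov_filter[OF assms(1)], where \<phi> = "\<lambda>u. u" and \<rho> = "\<lambda>_ x. min x \<eta>"])
      (use assms(2) in \<open>auto simp: min_def\<close>)
  have "qsum Q (trunc J \<eta> h) = qsum (filter (\<lambda>(u, x, y). u \<in> J) Q) (trunc J \<eta> h)"
    by (rule qsum_filter[symmetric]) (auto simp: trunc_def)
  also have "\<dots> = qsum Q' h"
    unfolding Q'_def qsum_map[of "\<lambda>u. u" "\<lambda>_ x. min x \<eta>"]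
    by (rule qsum_cong) (auto simp: trunc_def)
  finally show "qsum Q (trunc J \<eta> h) = qsum Q' h" .
  show "u \<in> J \<and> y \<le> \<eta>" if "(u, x, y) \<in> set Q'" for u x y
    using that by (auto simp: Q'_def)
qed

lemma trunc_compl_qsum:
  assumes "nonov S Q" "\<eta> \<in> S"
  obtains Q' where "nonov S Q'" "qsum Q (\<lambda>u x. h u x - trunc J \<eta> h u x) = qsum Q' h"
    "\<And>u x y. (u, x, y) \<in> set Q' \<Longrightarrow> u \<in> J \<Longrightarrow> \<eta> \<le> x"
proof
  define Q' where "Q' = map (\<lambda>(u, x, y). (u, if u \<in> J then max x \<eta> else x, if u \<in> J then max y \<eta> else y)) Q"
  show "nonov S Q'"
    unfolding Q'_def
    by (rule nonov_map[OF assms(1), where \<phi> = "\<lambda>u. u" and \<rho> = "\<lambda>u x. if u \<in> J then max x \<eta> else x"])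
      (use assms(2) in \<open>auto simp: max_def\<close>)
  show "qsum Q (\<lambda>u x. h u x - trunc J \<eta> h u x) = qsum Q' h"
    unfolding Q'_def qsum_map[of "\<lambda>u. u" "\<lambda>u x. if u \<in> J then max x \<eta> else x"]
    by (rule qsum_cong) (use assms(1) in \<open>auto simp: trunc_def max_def min_def nonov_def\<close>)
  show "\<eta> \<le> x" if "(u, x, y) \<in> set Q'" "u \<in> J" for u x y
    using that by (auto simp: Q'_def)
qed

lemma var_le_trunc:
  assumes "var_le S h c" "{..\<eta>} \<subseteq> S"
  shows "var_le UNIV (trunc J \<eta> h) c"
  unfolding var_le_def using assms by (metis trunc_qsum var_leD)

text \<open>A family that tests the truncation can be clipped to lie below \<open>\<eta>\<close>,
  one that tests the remainder to lie above \<open>\<eta>\<close> in the copies of \<open>J\<close>.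
  Together they form one family that tests \<open>h\<close>; the two suprema are then taken one
  after the other.\<close>

lemma tvar_trunc_add:
  assumes h: "var_le S h c" and \<eta>: "{..\<eta>} \<subseteq> S"
  shows "tvar S (trunc J \<eta> h) + tvar S (\<lambda>u x. h u x - trunc J \<eta> h u x) \<le> tvar S h"
proof -
  have *: "qsum Q (trunc J \<eta> h) + qsum R (\<lambda>u x. h u x - trunc J \<eta> h u x) \<le> tvar S h"
    if Q: "nonov S Q" and R: "nonov S R" for Q R
  proof -
    obtain Q' where Q': "nonov S Q'" "qsum Q (trunc J \<eta> h) = qsum Q' h"
      "\<And>u x y. (u, x, y) \<in> set Q' \<Longrightarrow> u \<in> J \<and> y \<le> \<eta>"
      using trunc_qsum[OF nonov_mono[OF Q] \<eta>] by blast
    obtain R' where R': "nonov S R'" "qsum R (\<lambda>u x. h u x - trunc J \<eta> h u x) = qsum R' h"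
      "\<And>u x y. (u, x, y) \<in> set R' \<Longrightarrow> u \<in> J \<Longrightarrow> \<eta> \<le> x"
      using trunc_compl_qsum[OF R] \<eta> by blast
    have "nonov S (Q' @ R')"
      using Q' R' by (intro nonov_append) (meson order_trans)+
    then show ?thesis
      using qsum_le_tvar[OF h] Q' R' by (metis qsum_append)
  qed
  have "tvar S (trunc J \<eta> h) \<le> tvar S h - qsum R (\<lambda>u x. h u x - trunc J \<eta> h u x)"
    if "nonov S R" for R
    using * that by (intro tvar_le) (simp add: var_le_def algebra_simps)
  then have "tvar S (\<lambda>u x. h u x - trunc J \<eta> h u x) \<le> tvar S h - tvar S (trunc J \<eta> h)"
    by (intro tvar_le) (simp add: var_le_def algebra_simps)
  then show ?thesis
    by simp
qed

subsection \<open>Variation along ordinal blocks\<close>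

text \<open>Write \<open>x\<close> and \<open>y\<close> through their blocks \<open>q x\<close> and
  \<open>q y\<close>. An interval inside one block goes to \<open>m1\<close> unchanged. Otherwise
  \<open>m1\<close> runs from the start of the block of \<open>y\<close> to \<open>y\<close>,
  \<open>m3\<close> joins the starts of the two blocks, and \<open>m2\<close> runs from the start of
  the block of \<open>x\<close> to \<open>x\<close>, which is the piece that \<open>m3\<close>
  counts in excess. In each copy at most one interval enters a given block and at most one leaves
  it, so each family is non-overlapping; but pieces of \<open>m1\<close> and \<open>m2\<close> may
  overlap each other, so they stay separate.\<close>

lemma block_qsum:
  fixes k \<mu> :: "'a ordinal"
  assumes Q: "nonov {..<k * \<mu>} Q" and k: "0 < k"
  shows "\<exists>Q1 Q2 Q3. nonov {..<k} Q1 \<and> nonov {..<k} Q2 \<and> nonov {..<\<mu>} Q3 \<and>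
    qsum Q h \<le> qsum Q1 (\<lambda>(\<xi>, u) x. h u (k * \<xi> + x)) + qsum Q2 (\<lambda>(\<xi>, u) x. h u (k * \<xi> + x))
       + qsum Q3 (\<lambda>u x. h u (k * x))"
proof -
  obtain q r :: "'a ordinal \<Rightarrow> 'a ordinal" where qr: "x = k * q x + r x" "r x < k" for x
    using ordinal_division[OF k] by metis
  have q_less: "k * \<xi> + y < k * q x" if "\<xi> < q x" "y < k" for x y \<xi>
    using that ordinal_division_less by blast
  have q_mono: "q x \<le> q y" if "x \<le> y" for x y
  proof (rule ccontr)
    assume "\<not> q x \<le> q y"
    then have "k * q y + r y < k * q x"
      using qr by (intro ordinal_division_less) auto
    also have "\<dots> \<le> x"
      using qr(1)[of x] by (metis le_plus_ordinal)
    finally show False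
      using that qr(1)[of y] by simp
  qed
  have r_mono: "r x \<le> r y" if "x \<le> y" "q x = q y" for x y
    using that qr(1)[of x] qr(1)[of y] by (metis plus_less_iff(2))
  have ltq: "x < k * \<xi>" if "q x < \<xi>" for x \<xi>
    using that qr by (metis ordinal_division_less)
  have leq: "k * q x \<le> x" for x
    using qr(1)[of x] by (metis le_plus_ordinal)
  have q_less_mu: "q x < \<mu>" if "x < k * \<mu>" for x
    using that leq[of x] times_less_iff(1)[OF k] by (meson order_le_less_trans)
  define m1 where "m1 = (\<lambda>(u::'b, x, y). ((q y, u), if q x = q y then r x else 0, r y))"
  define m2 where "m2 = (\<lambda>(u::'b, x, y). ((q x, u), 0 :: 'a ordinal, if q x = q y then 0 else r x))"
  define m3 where "m3 = (\<lambda>(u::'b, x, y). (u, q x, q y))"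
  let ?R = "\<lambda>(u, x, y) (u', x', y'). u = u' \<longrightarrow> y \<le> x' \<or> y' \<le> (x :: 'a ordinal)"
  have sorted: "sorted_wrt ?R Q" and Q_le: "\<And>u x y. (u, x, y) \<in> set Q \<Longrightarrow> x \<le> y \<and> y < k * \<mu> \<and> x < k * \<mu>"
    using Q by (auto simp: nonov_def)
  have R1: "?R (m1 a) (m1 b)" and R2: "?R (m2 a) (m2 b)" and R3: "?R (m3 a) (m3 b)"
    if ab: "a \<in> set Q" "b \<in> set Q" "?R a b" for a b
  proof -
    obtain u x y v x' y' where e: "a = (u, x, y)" "b = (v, x', y')"
      by (cases a, cases b)
    have le: "x \<le> y" "x' \<le> y'"
      using ab Q_le e by blast+
    have nov: "y \<le> x' \<or> y' \<le> x" if "u = v"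
      using ab(3) that e by simp
    show "?R (m1 a) (m1 b)"
      using le nov r_mono[of y x'] r_mono[of y' x] q_mono[of y x'] q_mono[of y' x]
        q_mono[OF le(1)] q_mono[OF le(2)]
      by (auto simp: m1_def e)
    show "?R (m2 a) (m2 b)"
      using le nov q_mono[of y x'] q_mono[of y' x] q_mono[OF le(1)] q_mono[OF le(2)]
      by (auto simp: m2_def e)
    show "?R (m3 a) (m3 b)"
      using nov q_mono[of y x'] q_mono[of y' x] by (auto simp: m3_def e)
  qed
  have "nonov {..<k} (map m1 Q)"
    unfolding nonov_def sorted_wrt_map
    using R1 sorted_wrt_mono_rel[OF _ sorted, of "\<lambda>a b. ?R (m1 a) (m1 b)"] qr(2) k r_mono Q_le
    by (auto simp: m1_def)
  moreover have "nonov {..<k} (map m2 Q)"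
    unfolding nonov_def sorted_wrt_map
    using R2 sorted_wrt_mono_rel[OF _ sorted, of "\<lambda>a b. ?R (m2 a) (m2 b)"] qr(2) k
    by (auto simp: m2_def)
  moreover have "nonov {..<\<mu>} (map m3 Q)"
    unfolding nonov_def sorted_wrt_map
    using R3 sorted_wrt_mono_rel[OF _ sorted, of "\<lambda>a b. ?R (m3 a) (m3 b)"] q_mono Q_le q_less_mu
    by (auto simp: m3_def)
  moreover have "qsum Q h \<le> qsum (map m1 Q) (\<lambda>(\<xi>, u) x. h u (k * \<xi> + x))
      + qsum (map m2 Q) (\<lambda>(\<xi>, u) x. h u (k * \<xi> + x)) + qsum (map m3 Q) (\<lambda>u x. h u (k * x))"
  proof (induction Q)
    case (Cons a Q)
    obtain u x y where a: "a = (u, x, y)" by (cases a)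
    have e: "k * q x + r x = x" "k * q y + r y = y"
      using qr(1) by metis+
    have "qsum [a] h \<le> qsum [m1 a] (\<lambda>(\<xi>, u) x. h u (k * \<xi> + x))
      + qsum [m2 a] (\<lambda>(\<xi>, u) x. h u (k * \<xi> + x)) + qsum [m3 a] (\<lambda>u x. h u (k * x))"
      using e by (auto simp: a m1_def m2_def m3_def qsum_def)
    then show ?case
      using Cons by (simp add: qsum_def)
  qed simp
  ultimately show ?thesis
    by blast
qed

section \<open>Iterated derivations\<close>

lemma iter_subset:
  assumes "\<And>X. d X \<subseteq> X"
  shows "ord_rec A d Inter \<beta> \<subseteq> A"
proof (induction \<beta> rule: ordinal_induct)
  case (limit \<beta>)
  then show ?case
    using limit_ordinal_pos[OF limit(1)] by (auto simp: ord_rec_limit ord_rec_0)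
qed (use assms in \<open>auto simp: ord_rec_0 ord_rec_osuc\<close>)

lemma iter_antimono:
  assumes d: "\<And>X. d X \<subseteq> X" and "\<beta> \<le> \<gamma>"
  shows "ord_rec A d Inter \<gamma> \<subseteq> ord_rec A d Inter \<beta>"
  using \<open>\<beta> \<le> \<gamma>\<close>
proof (induction \<gamma> rule: ordinal_induct)
  case (suc \<delta>)
  then show ?case
    using d by (cases "\<beta> = osuc \<delta>") (auto simp: ord_rec_osuc less_osuc_iff order_le_less)
next
  case (limit \<delta>)
  then show ?case
    by (cases "\<beta> = \<delta>") (auto simp: ord_rec_limit)
qed (metis order.antisym order_refl zero_le_ordinal)

lemma iter_plus:
  assumes d: "\<And>X. d X \<subseteq> X"
  shows "ord_rec A d Inter (\<beta> + \<gamma>) = ord_rec (ord_rec A d Inter \<beta>) d Inter \<gamma>"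
proof (induction \<gamma> rule: ordinal_induct)
  case (limit \<gamma>)
  have lim: "limit_ordinal (\<beta> + \<gamma>)"
    using normal_fun_limit[OF normal_fun_plus limit(1)] .
  have "(\<Inter>\<delta><\<beta> + \<gamma>. ord_rec A d Inter \<delta>) = (\<Inter>\<delta><\<gamma>. ord_rec A d Inter (\<beta> + \<delta>))"
  proof (intro equalityI INT_greatest)
    fix \<delta> assume "\<delta> \<in> {..<\<gamma>}"
    then show "(\<Inter>\<delta><\<beta> + \<gamma>. ord_rec A d Inter \<delta>) \<subseteq> ord_rec A d Inter (\<beta> + \<delta>)"
      by (intro INT_lower) simp
  next
    fix \<delta> assume "\<delta> \<in> {..<\<beta> + \<gamma>}"
    then obtain \<delta>' where "\<delta>' < \<gamma>" "\<delta> < \<beta> + \<delta>'"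
      using less_plus_limit[OF limit(1)] by auto
    then show "(\<Inter>\<delta><\<gamma>. ord_rec A d Inter (\<beta> + \<delta>)) \<subseteq> ord_rec A d Inter \<delta>"
      using iter_antimono[OF d, of \<delta> "\<beta> + \<delta>'" A] by fastforce
  qed
  then show ?case
    using limit(2) by (auto simp: ord_rec_limit[OF lim] ord_rec_limit[OF limit(1)])
qed (simp_all add: ord_rec_0 ord_rec_osuc plus_ordinal_simps)

text \<open>One transfinite induction serves every comparison below: inclusions, images under maps,
  lifts to random functions and, with a trivial second iteration, invariants of a single
  iteration.\<close>

lemma iter_rel:
  fixes \<beta> :: "'a ordinal"
  assumes base: "Rel A A'"
    and step: "\<And>X Y. X \<subseteq> A \<Longrightarrow> Y \<subseteq> A' \<Longrightarrow> Rel X Y \<Longrightarrow> Rel (d X) (d' Y)"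
    and inter: "\<And>(I :: 'a ordinal set) X Y. I \<noteq> {} \<Longrightarrow> (\<And>i. i \<in> I \<Longrightarrow> Rel (X i) (Y i)) \<Longrightarrow>
      Rel (\<Inter>i\<in>I. X i) (\<Inter>i\<in>I. Y i)"
    and d: "\<And>X. d X \<subseteq> X" and d': "\<And>Y. d' Y \<subseteq> Y"
  shows "Rel (ord_rec A d Inter \<beta>) (ord_rec A' d' Inter \<beta>)"
proof (induction \<beta> rule: ordinal_induct)
  case (suc \<delta>)
  then show ?case
    using step[OF iter_subset[OF d] iter_subset[OF d']] by (simp add: ord_rec_osuc)
next
  case (limit \<beta>)
  then show ?case
    using inter[of "{..<\<beta>}" "ord_rec A d Inter" "ord_rec A' d' Inter"] limit_ordinal_pos[OF limit(1)]
    by (auto simp: ord_rec_limit)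
qed (simp add: base ord_rec_0)

lemma iter_mono:
  fixes \<beta> :: "'a ordinal" and A A' :: "'b set"
  assumes "A \<subseteq> A'" and "\<And>X Y. X \<subseteq> Y \<Longrightarrow> d X \<subseteq> d Y" and "\<And>X. d X \<subseteq> X"
  shows "ord_rec A d Inter \<beta> \<subseteq> ord_rec A' d Inter \<beta>"
proof (rule iter_rel[where Rel = "(\<subseteq>)"])
  fix I :: "'a ordinal set" and X Y :: "'a ordinal \<Rightarrow> 'b set"
  assume "\<And>i. i \<in> I \<Longrightarrow> X i \<subseteq> Y i"
  then show "(\<Inter>i\<in>I. X i) \<subseteq> (\<Inter>i\<in>I. Y i)"
    by blast
qed (use assms in \<open>simp_all\<close>)

section \<open>Averages of periodic sequences\<close>

definition per :: "nat \<Rightarrow> (nat \<Rightarrow> 'b) \<Rightarrow> bool" where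
  "per p f \<longleftrightarrow> 0 < p \<and> (\<forall>i. f (i + p) = f i)"

definition periodic :: "(nat \<Rightarrow> 'b) \<Rightarrow> bool" where
  "periodic f \<longleftrightarrow> (\<exists>p. per p f)"

text \<open>\<open>avg a\<close> is meaningful only for periodic \<open>a\<close>.\<close>

definition avg :: "(nat \<Rightarrow> real) \<Rightarrow> real" where
  "avg a = (let p = LEAST p. per p a in (\<Sum>i<p. a i) / p)"

lemma per_add_mult: "per p f \<Longrightarrow> f (i + p * k) = f i"
proof (induction k)
  case (Suc k)
  have "f ((i + p * k) + p) = f (i + p * k)"
    using Suc.prems unfolding per_def by blast
  then show ?case
    using Suc by (simp add: ac_simps)
qed simp

lemma per_mod: "per p f \<Longrightarrow> f (i mod p) = f i"
  using per_add_mult[of p f "i mod p" "i div p"] by simp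

lemma per_mult: "per p f \<Longrightarrow> 0 < q \<Longrightarrow> per (p * q) f"
  using per_add_mult[of p f _ q] by (auto simp: per_def)

lemma per_comp: "per p f \<Longrightarrow> per p (\<lambda>i. F (f i))"
  by (simp add: per_def)

lemma per_comp2: "per p f \<Longrightarrow> per p g \<Longrightarrow> per p (\<lambda>i. F (f i) (g i))"
  by (simp add: per_def)

lemma per_i_mod: "0 < p \<Longrightarrow> per p (\<lambda>i. F (i mod p))"
  by (simp add: per_def)

lemma periodicI: "per p f \<Longrightarrow> periodic f"
  by (auto simp: periodic_def)

lemma common_per:
  assumes "periodic f" "periodic g"
  obtains p where "per p f" "per p g"
  using assms unfolding periodic_def by (metis mult.commute per_def per_mult)

lemma periodic_const [simp, intro]: "periodic (\<lambda>i. c)"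
  by (auto simp: periodic_def per_def)

lemma periodic_comp: "periodic f \<Longrightarrow> periodic (\<lambda>i. F (f i))"
  unfolding periodic_def using per_comp by blast

lemma periodic_comp2: "periodic f \<Longrightarrow> periodic g \<Longrightarrow> periodic (\<lambda>i. F (f i) (g i))"
  by (erule (1) common_per) (blast intro: periodicI per_comp2)

lemma periodic_sum: "(\<And>t. t \<in> T \<Longrightarrow> periodic (\<lambda>i. a t i)) \<Longrightarrow> periodic (\<lambda>i. \<Sum>t\<in>T. a t i)"
  by (induction T rule: infinite_finite_induct) (auto intro: periodic_comp2)

lemma sum_lessThan_plus:
  fixes a :: "nat \<Rightarrow> 'b::comm_monoid_add"
  shows "(\<Sum>i<m + n. a i) = (\<Sum>i<m. a i) + (\<Sum>i<n. a (m + i))"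
  by (induction n) (simp_all add: add.assoc)

lemma sum_per_mult:
  assumes "per p a"
  shows "(\<Sum>i<p * q. a i) = real q * (\<Sum>i<p. a i)"
proof (induction q)
  case (Suc q)
  have "(\<Sum>i<p. a (p * q + i)) = (\<Sum>i<p. a i)"
    using per_add_mult[OF assms] by (simp add: add.commute)
  then show ?case
    using Suc sum_lessThan_plus[of a "p * q" p] by (simp add: algebra_simps)
qed simp

text \<open>Two periods are compared over their product, where both sums become multiples. Any
  common period may then be used for computations.\<close>

lemma avg_eq:
  assumes "per p a"
  shows "avg a = (\<Sum>i<p. a i) / p"
proof -
  define q where "q = (LEAST p. per p a)"
  have q: "per q a"
    unfolding q_def using assms by (rule LeastI)
  have "real p * (\<Sum>i<q. a i) = real q * (\<Sum>i<p. a i)"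
    using sum_per_mult[OF q, of p] sum_per_mult[OF assms, of q] by (simp add: mult.commute)
  moreover have "0 < p" "0 < q"
    using assms q by (auto simp: per_def)
  ultimately show ?thesis
    by (simp add: avg_def Let_def field_simps flip: q_def)
qed

lemma avg_const [simp]: "avg (\<lambda>i. c) = c"
  by (subst avg_eq[of 1]) (auto simp: per_def)

lemma avg_add:
  assumes "periodic a" "periodic b"
  shows "avg (\<lambda>i. a i + b i) = avg a + avg b"
proof -
  obtain p where p: "per p a" "per p b"
    using common_per[OF assms] .
  then show ?thesis
    by (simp add: avg_eq[OF p(1)] avg_eq[OF p(2)] avg_eq[OF per_comp2[OF p]] sum.distrib add_divide_distrib)
qed

lemma avg_cmult:
  assumes "periodic a"
  shows "avg (\<lambda>i. c * a i) = c * avg a"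
proof -
  obtain p where p: "per p a"
    using assms by (auto simp: periodic_def)
  show ?thesis
    by (simp add: avg_eq[OF p] avg_eq[OF per_comp[OF p]] sum_distrib_left)
qed

lemma avg_diff:
  assumes "periodic a" "periodic b"
  shows "avg (\<lambda>i. a i - b i) = avg a - avg b"
  using avg_add[OF assms(1) periodic_comp[OF assms(2), of "\<lambda>x. (-1) * x"]]
    avg_cmult[OF assms(2), of "-1"] by simp

lemma avg_mono:
  assumes "periodic a" "periodic b" "\<And>i. a i \<le> b i"
  shows "avg a \<le> avg b"
proof -
  obtain p where p: "per p a" "per p b"
    using common_per[OF assms(1,2)] .
  then show ?thesis
    using assms(3) by (simp add: avg_eq[OF p(1)] avg_eq[OF p(2)] divide_right_mono sum_mono)
qed

lemma avg_strict_mono: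
  assumes "periodic a" "periodic b" "\<And>i. a i < b i"
  shows "avg a < avg b"
proof -
  obtain p where p: "per p a" "per p b"
    using common_per[OF assms(1,2)] .
  then have "0 < p" by (simp add: per_def)
  then show ?thesis
    using assms(3) by (auto simp: avg_eq[OF p(1)] avg_eq[OF p(2)] intro!: divide_strict_right_mono sum_strict_mono)
qed

lemma avg_nonneg: "periodic a \<Longrightarrow> (\<And>i. 0 \<le> a i) \<Longrightarrow> 0 \<le> avg a"
  using avg_mono[of "\<lambda>_. 0" a] by simp

lemma avg_le: "periodic a \<Longrightarrow> (\<And>i. a i \<le> c) \<Longrightarrow> avg a \<le> c"
  using avg_mono[of a "\<lambda>_. c"] by simp

lemma avg_sum:
  assumes "\<And>t. t \<in> T \<Longrightarrow> periodic (a t)"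
  shows "avg (\<lambda>i. \<Sum>t\<in>T. a t i) = (\<Sum>t\<in>T. avg (a t))"
  using assms
proof (induction T rule: infinite_finite_induct)
  case (insert t T)
  then show ?case
    by (simp add: avg_add periodic_sum)
qed auto

section \<open>Periodic random block functions\<close>

type_synonym ('u, 'o) rfun = "nat \<Rightarrow> 'u \<Rightarrow> 'o \<Rightarrow> real"

text \<open>The neighbourhood filter of the weak topology whose tests are averages of the values at
  one point against a periodic weight. The weights let a test look at selected residue classes of
  indices. The principal filter confines everything to periodic sequences, where \<open>avg\<close>
  has its meaning.\<close>

definition nhd :: "('u, 'o) rfun \<Rightarrow> ('u, 'o) rfun filter" where
  "nhd f = inf (INF (c, u, x)\<in>{c. periodic c} \<times> UNIV.
       filtercomap (\<lambda>g. avg (\<lambda>i. c i * g i u x)) (nhds (avg (\<lambda>i. c i * f i u x))))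
     (principal {g. periodic g})"

lemma tendsto_nhd:
  assumes "periodic c"
  shows "((\<lambda>g. avg (\<lambda>i. c i * g i u x)) \<longlongrightarrow> avg (\<lambda>i. c i * f i u x)) (nhd f)"
proof -
  have "nhd f \<le> (INF (c, u, x)\<in>{c. periodic c} \<times> UNIV.
       filtercomap (\<lambda>g. avg (\<lambda>i. c i * g i u x)) (nhds (avg (\<lambda>i. c i * f i u x))))"
    unfolding nhd_def by (rule inf_le1)
  also have "\<dots> \<le> filtercomap (\<lambda>g. avg (\<lambda>i. c i * g i u x)) (nhds (avg (\<lambda>i. c i * f i u x)))"
    using assms by (intro INF_lower2[of "(c, u, x)"]) auto
  finally show ?thesis
    by (simp add: filterlim_iff_le_filtercomap)
qed

lemma eventually_nhd_periodic: "eventually periodic (nhd f)"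
  unfolding nhd_def eventually_inf_principal by simp

lemma filterlim_nhdI:
  assumes "\<And>g. periodic g \<Longrightarrow> periodic (\<Phi> g)"
    and "\<And>c u x. periodic c \<Longrightarrow>
      ((\<lambda>g. avg (\<lambda>i. c i * \<Phi> g i u x)) \<longlongrightarrow> avg (\<lambda>i. c i * \<Phi> f i u x)) (nhd f)"
  shows "filterlim \<Phi> (nhd (\<Phi> f)) (nhd f)"
proof -
  have "eventually (\<lambda>g. periodic (\<Phi> g)) (nhd f)"
    using eventually_nhd_periodic assms(1) by (rule eventually_mono)
  then show ?thesis
    unfolding nhd_def[of "\<Phi> f"]
    using assms(2) by (auto simp: filterlim_inf filterlim_INF filterlim_principal filterlim_filtercomap_iff o_def)
qed

text \<open>Reduces a neighbourhood to finitely many tests with a common tolerance, the form needed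
  to construct an oscillating sequence inside it.\<close>

lemma eventually_nhdE:
  assumes "eventually P (nhd f)"
  obtains T \<epsilon> where "finite T" "\<And>c u x. (c, u, x) \<in> T \<Longrightarrow> periodic c" "0 < \<epsilon>"
    "\<And>g. periodic g \<Longrightarrow> (\<And>c u x. (c, u, x) \<in> T \<Longrightarrow>
       \<bar>avg (\<lambda>i. c i * g i u x) - avg (\<lambda>i. c i * f i u x)\<bar> < \<epsilon>) \<Longrightarrow> P g"
proof -
  define F where "F = (\<lambda>(c, u, x). filtercomap (\<lambda>g. avg (\<lambda>i. c i * g i u x)) (nhds (avg (\<lambda>i. c i * f i u x))))"
  have "eventually (\<lambda>g. periodic g \<longrightarrow> P g) (INF t\<in>{c. periodic c} \<times> UNIV. F t)"
    using assms by (simp add: nhd_def eventually_inf_principal F_def)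
  from eventually_INF[THEN iffD1, OF this]
  obtain T where T: "finite T" "T \<subseteq> {c. periodic c} \<times> UNIV"
    and ev: "eventually (\<lambda>g. periodic g \<longrightarrow> P g) (INF t\<in>T. F t)"
    by blast
  have "\<exists>\<epsilon>>0. \<forall>g. (\<forall>(c, u, x)\<in>T. \<bar>avg (\<lambda>i. c i * g i u x) - avg (\<lambda>i. c i * f i u x)\<bar> < \<epsilon>) \<longrightarrow> Q g"
    if "eventually Q (INF t\<in>T. F t)" for Q
    using T(1) that
  proof (induction T arbitrary: Q rule: finite_induct)
    case empty
    then show ?case by (auto simp: eventually_top intro: exI[of _ 1])
  next
    case (insert t T)
    obtain c u x where t: "t = (c, u, x)" by (cases t)
    obtain Q1 Q2 where Q: "eventually Q1 (F t)" "eventually Q2 (INF t\<in>T. F t)"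
      "\<And>g. Q1 g \<Longrightarrow> Q2 g \<Longrightarrow> Q g"
      using insert.prems by (auto simp: eventually_inf)
    obtain S where S: "open S" "avg (\<lambda>i. c i * f i u x) \<in> S"
      "\<And>g. avg (\<lambda>i. c i * g i u x) \<in> S \<Longrightarrow> Q1 g"
      using Q(1) by (auto simp: F_def t eventually_filtercomap eventually_nhds)
    then obtain e1 where e1: "0 < e1" "\<And>y. dist y (avg (\<lambda>i. c i * f i u x)) < e1 \<Longrightarrow> y \<in> S"
      by (meson open_dist)
    obtain e2 where e2: "0 < e2"
      "\<And>g. (\<forall>(c, u, x)\<in>T. \<bar>avg (\<lambda>i. c i * g i u x) - avg (\<lambda>i. c i * f i u x)\<bar> < e2) \<Longrightarrow> Q2 g"
      using insert.IH[OF Q(2)] by blast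
    have "Q g" if g: "\<forall>(c, u, x)\<in>insert t T.
      \<bar>avg (\<lambda>i. c i * g i u x) - avg (\<lambda>i. c i * f i u x)\<bar> < min e1 e2" for g
    proof (rule Q(3))
      show "Q1 g"
        using g by (intro S(3) e1(2)) (simp add: t dist_real_def)
      show "Q2 g"
        using g by (intro e2(2)) auto
    qed
    then show ?case
      using e1 e2 by (intro exI[of _ "min e1 e2"]) auto
  qed
  from this[OF ev] obtain \<epsilon> where "0 < \<epsilon>" and "\<And>g. periodic g \<Longrightarrow>
      (\<forall>(c, u, x)\<in>T. \<bar>avg (\<lambda>i. c i * g i u x) - avg (\<lambda>i. c i * f i u x)\<bar> < \<epsilon>) \<Longrightarrow> P g"
    by blast
  with T show ?thesis
    by (intro that[of T \<epsilon>]) blast+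
qed

section \<open>Averaged variation and the Szlenk-type derivation\<close>

definition rdist :: "'o::linorder set \<Rightarrow> ('u, 'o) rfun \<Rightarrow> ('u, 'o) rfun \<Rightarrow> real" where
  "rdist S f g = avg (\<lambda>i. tvar S (\<lambda>u x. f i u x - g i u x))"

definition rnorm :: "'o::linorder set \<Rightarrow> ('u, 'o) rfun \<Rightarrow> real" where
  "rnorm S f = avg (\<lambda>i. tvar S (f i))"

text \<open>The usual Szlenk derivation asks for large diameter of every neighbourhood. Here the
  distance is measured from \<open>f\<close> itself, which is equivalent up to a factor 2 in
  \<open>\<epsilon>\<close> and can be stated with the neighbourhood filter.\<close>

definition sz_deriv :: "'o::linorder set \<Rightarrow> real \<Rightarrow> ('u, 'o) rfun set \<Rightarrow> ('u, 'o) rfun set" where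
  "sz_deriv S \<epsilon> A = {f \<in> A. \<exists>\<^sub>F g in nhd f. g \<in> A \<and> \<epsilon> < rdist S f g}"

definition sz_iter :: "'o::linorder set \<Rightarrow> real \<Rightarrow> 'a ordinal \<Rightarrow> ('u, 'o) rfun set \<Rightarrow> ('u, 'o) rfun set" where
  "sz_iter S \<epsilon> \<beta> A = ord_rec A (sz_deriv S \<epsilon>) Inter \<beta>"

lemma sz_deriv_subset: "sz_deriv S \<epsilon> A \<subseteq> A"
  by (auto simp: sz_deriv_def)

lemma sz_deriv_mono: "A \<subseteq> B \<Longrightarrow> sz_deriv S \<epsilon> A \<subseteq> sz_deriv S \<epsilon> B"
  by (auto simp: sz_deriv_def elim: frequently_elim1)

lemma sz_iter_subset: "sz_iter S \<epsilon> \<beta> A \<subseteq> A"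
  unfolding sz_iter_def by (rule iter_subset) (rule sz_deriv_subset)

lemma sz_iter_antimono: "\<beta> \<le> \<gamma> \<Longrightarrow> sz_iter S \<epsilon> \<gamma> A \<subseteq> sz_iter S \<epsilon> \<beta> A"
  unfolding sz_iter_def by (rule iter_antimono) (rule sz_deriv_subset)

lemma sz_iter_mono: "A \<subseteq> B \<Longrightarrow> sz_iter S \<epsilon> \<beta> A \<subseteq> sz_iter S \<epsilon> \<beta> B"
  unfolding sz_iter_def by (rule iter_mono) (auto simp: sz_deriv_mono sz_deriv_subset)

lemma sz_iter_plus: "sz_iter S \<epsilon> (\<beta> + \<gamma>) A = sz_iter S \<epsilon> \<gamma> (sz_iter S \<epsilon> \<beta> A)"
  unfolding sz_iter_def by (rule iter_plus) (rule sz_deriv_subset)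

text \<open>Separation needs to be transported only between points that satisfy \<open>C\<close>. By
  \<open>ev\<close> the condition holds near \<open>f\<close> on all of \<open>A\<close>, so the far
  points that witness survival can be chosen with \<open>C\<close>. This shrinking of a
  neighbourhood is what slices would not permit.\<close>

lemma sz_iter_image:
  fixes \<beta> :: "'a ordinal"
  assumes A: "\<And>f. f \<in> A \<Longrightarrow> C f \<Longrightarrow> \<Phi> f \<in> A'"
    and lim: "\<And>f. f \<in> A \<Longrightarrow> C f \<Longrightarrow> filterlim \<Phi> (nhd (\<Phi> f)) (nhd f)"
    and ev: "\<And>f. f \<in> A \<Longrightarrow> C f \<Longrightarrow> eventually (\<lambda>g. g \<in> A \<longrightarrow> C g) (nhd f)"
    and dist: "\<And>f g. f \<in> A \<Longrightarrow> g \<in> A \<Longrightarrow> C f \<Longrightarrow> C g \<Longrightarrow> \<epsilon> < rdist S f g \<Longrightarrow> \<epsilon>' < rdist S' (\<Phi> f) (\<Phi> g)"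
    and f: "f \<in> sz_iter S \<epsilon> \<beta> A" "C f"
  shows "\<Phi> f \<in> sz_iter S' \<epsilon>' \<beta> A'"
proof -
  define Rel where "Rel = (\<lambda>X Y. \<forall>f\<in>X. C f \<longrightarrow> \<Phi> f \<in> Y)"
  have "Rel (ord_rec A (sz_deriv S \<epsilon>) Inter \<beta>) (ord_rec A' (sz_deriv S' \<epsilon>') Inter \<beta>)"
  proof (rule iter_rel)
    fix X Y
    assume X: "X \<subseteq> A" and Y: "Y \<subseteq> A'" and rel: "Rel X Y"
    have "\<Phi> f \<in> sz_deriv S' \<epsilon>' Y" if f: "f \<in> sz_deriv S \<epsilon> X" and Cf: "C f" for f
    proof -
      have fX: "f \<in> X" and fr: "\<exists>\<^sub>F g in nhd f. g \<in> X \<and> \<epsilon> < rdist S f g"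
        using f by (auto simp: sz_deriv_def)
      have "\<exists>\<^sub>F g in nhd f. \<Phi> g \<in> Y \<and> \<epsilon>' < rdist S' (\<Phi> f) (\<Phi> g)"
      proof (rule frequently_rev_mp[OF fr], rule eventually_mono[OF ev])
        show "f \<in> A" "C f" using fX X Cf by auto
        fix g assume "g \<in> A \<longrightarrow> C g"
        then show "g \<in> X \<and> \<epsilon> < rdist S f g \<longrightarrow> \<Phi> g \<in> Y \<and> \<epsilon>' < rdist S' (\<Phi> f) (\<Phi> g)"
          using rel X fX Cf dist[of f g] by (auto simp: Rel_def)
      qed
      then have "\<exists>\<^sub>F g in nhd (\<Phi> f). g \<in> Y \<and> \<epsilon>' < rdist S' (\<Phi> f) g"
        using lim[of f] fX X Cf by (auto simp: frequently_def filterlim_iff)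
      then show ?thesis
        using rel fX Cf by (auto simp: sz_deriv_def Rel_def)
    qed
    then show "Rel (sz_deriv S \<epsilon> X) (sz_deriv S' \<epsilon>' Y)"
      by (simp add: Rel_def)
  qed (use A in \<open>auto simp: Rel_def sz_deriv_subset\<close>)
  then show ?thesis
    using f by (simp add: Rel_def sz_iter_def)
qed

lemma per_via2:
  assumes "per p f" "per p g" "\<And>i j. f i = f j \<Longrightarrow> g i = g j \<Longrightarrow> a i = a j"
  shows "per p a"
  using assms unfolding per_def by metis

lemma periodic_via:
  assumes "periodic f" "\<And>i j. f i = f j \<Longrightarrow> a i = a j"
  shows "periodic a"
  using assms unfolding periodic_def per_def by metis

lemma periodic_via2:
  assumes "periodic f" "periodic g" "\<And>i j. f i = f j \<Longrightarrow> g i = g j \<Longrightarrow> a i = a j"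
  shows "periodic a"
  using common_per[OF assms(1,2)] per_via2[of _ f g a] assms(3) periodicI by metis

section \<open>The contraction theorem\<close>

text \<open>Fixing the value 0 at the left end removes the constants, which variation does not see;
  the values are then controlled by the variation.\<close>

definition rball :: "'a ordinal set \<Rightarrow> ('u, 'a ordinal) rfun set" where
  "rball S = {f. periodic f \<and> (\<forall>i. var_le S (f i) 1) \<and> (\<forall>i u. f i u 0 = 0)}"

definition rtrunc :: "'u set \<Rightarrow> 'a ordinal \<Rightarrow> ('u, 'a ordinal) rfun \<Rightarrow> ('u, 'a ordinal) rfun" where
  "rtrunc J \<eta> f = (\<lambda>i. trunc J \<eta> (f i))"

definition fin_rball :: "'u set \<Rightarrow> 'a ordinal \<Rightarrow> ('u, 'a ordinal) rfun set" where
  "fin_rball J \<eta> = {f \<in> rball UNIV. rtrunc J \<eta> f = f}"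

lemma rballD:
  assumes "f \<in> rball S"
  shows "periodic f" "var_le S (f i) 1" "f i u 0 = 0"
  using assms by (auto simp: rball_def)

lemma rtrunc_in_fin_rball:
  assumes "f \<in> rball S" "{..\<eta>} \<subseteq> S"
  shows "rtrunc J \<eta> f \<in> fin_rball J \<eta>"
proof -
  have "periodic (rtrunc J \<eta> f)"
    unfolding rtrunc_def using rballD(1)[OF assms(1)] by (rule periodic_comp)
  moreover have "var_le UNIV (rtrunc J \<eta> f i) 1" for i
    unfolding rtrunc_def using var_le_trunc[OF rballD(2)[OF assms(1)] assms(2)] .
  ultimately show ?thesis
    using rballD(3)[OF assms(1)]
    by (auto simp: fin_rball_def rball_def rtrunc_def trunc_def fun_eq_iff min.absorb1)
qed

lemma rball_mono: "S' \<subseteq> S \<Longrightarrow> rball S \<subseteq> rball S'"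
  unfolding rball_def using var_le_mono by blast

lemma fin_rball_subset: "fin_rball J \<eta> \<subseteq> rball UNIV"
  by (auto simp: fin_rball_def)

lemma rdist_triangle:
  assumes "f \<in> rball S" "g \<in> rball S" "h \<in> rball S"
  shows "rdist S f h \<le> rdist S f g + rdist S g h"
proof -
  have p: "periodic f" "periodic g" "periodic h"
    using assms by (auto simp: rball_def)
  have pd: "periodic (\<lambda>i. tvar S (\<lambda>u x. f i u x - g i u x))" "periodic (\<lambda>i. tvar S (\<lambda>u x. g i u x - h i u x))"
    "periodic (\<lambda>i. tvar S (\<lambda>u x. f i u x - h i u x))"
    by (rule periodic_via2[OF p(1,2)] periodic_via2[OF p(2,3)] periodic_via2[OF p(1,3)]; simp)+
  show ?thesis
    unfolding rdist_def using assms
    by (auto intro!: avg_mono pd periodic_comp2[OF pd(1,2)] tvar_diff_triangle rballD(2) simp flip: avg_add[OF pd(1,2)])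
qed

lemma rdist_commute: "rdist S f g = rdist S g f"
  unfolding rdist_def by (subst tvar_diff_commute) simp

text \<open>The averaged form of \<open>tvar_trunc_add\<close>: if truncation loses little norm, it
  moves the function little.\<close>

lemma rdist_rtrunc:
  assumes f: "f \<in> rball S" and "{..\<eta>} \<subseteq> S"
  shows "rdist S f (rtrunc J \<eta> f) \<le> rnorm S f - rnorm S (rtrunc J \<eta> f)"
proof -
  have p: "periodic (\<lambda>i. tvar S (\<lambda>u x. f i u x - trunc J \<eta> (f i) u x))" "periodic (\<lambda>i. tvar S (f i))"
    "periodic (\<lambda>i. tvar S (trunc J \<eta> (f i)))"
    by (rule periodic_via[OF rballD(1)[OF f]]; simp)+
  have "tvar S (\<lambda>u x. f i u x - trunc J \<eta> (f i) u x) \<le> tvar S (f i) - tvar S (trunc J \<eta> (f i))" for i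
    using tvar_trunc_add[OF rballD(2)[OF f, of i] assms(2), of J] by simp
  then show ?thesis
    unfolding rdist_def rnorm_def rtrunc_def avg_diff[OF p(2,3), symmetric]
    by (intro avg_mono p periodic_comp2[OF p(2,3)])
qed

lemma rdist_mono:
  assumes "S' \<subseteq> S" "f \<in> rball S" "g \<in> rball S"
  shows "rdist S' f g \<le> rdist S f g"
  unfolding rdist_def
  by (intro avg_mono tvar_mono[OF var_le_diff[OF rballD(2) rballD(2)]] assms
      periodic_via2[OF rballD(1)[OF assms(2)] rballD(1)[OF assms(3)]]) simp_all

section \<open>Approximation and lower semicontinuity of the averaged norm\<close>

lemma rnorm_le_one: "f \<in> rball S \<Longrightarrow> rnorm S f \<le> 1"
  unfolding rnorm_def by (intro avg_le tvar_le rballD periodic_via[of f]) auto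

lemma rnorm_nonneg: "f \<in> rball S \<Longrightarrow> 0 \<le> rnorm S f"
  unfolding rnorm_def by (intro avg_nonneg tvar_nonneg[OF rballD(2)] periodic_via[OF rballD(1)]) auto

text \<open>A nearly optimal family is chosen for each residue modulo the period, so that only
  finitely many families occur.\<close>

lemma rnorm_approx:
  assumes "per p f" "c < rnorm S f"
  obtains Q where "\<And>i. nonov S (Q i)" "c < avg (\<lambda>i. qsum (Q (i mod p)) (f i))"
proof -
  have per: "periodic f" and "0 < p"
    using assms(1) by (auto intro: periodicI simp: per_def)
  define e where "e = (rnorm S f - c) / 2"
  have e: "0 < e" using assms by (simp add: e_def)
  have "\<exists>Q. nonov S Q \<and> tvar S (f i) - e < qsum Q (f i)" for i
    using less_tvarE[of "tvar S (f i) - e" S "f i"] e by auto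
  then obtain Q where Q: "\<And>i. nonov S (Q i)" "\<And>i. tvar S (f i) - e < qsum (Q i) (f i)"
    by metis
  have pt: "periodic (\<lambda>i. tvar S (f i))"
    using per by (rule periodic_comp)
  have "c < rnorm S f - e"
    using assms by (simp add: e_def field_simps)
  also have "\<dots> = avg (\<lambda>i. tvar S (f i) - e)"
    by (simp add: rnorm_def avg_diff[OF pt periodic_const])
  also have "\<dots> < avg (\<lambda>i. qsum (Q (i mod p)) (f i))"
  proof (rule avg_strict_mono)
    show "periodic (\<lambda>i. tvar S (f i) - e)"
      using pt by (rule periodic_comp)
    show "periodic (\<lambda>i. qsum (Q (i mod p)) (f i))"
      by (rule periodicI[OF per_via2[OF assms(1) per_i_mod[OF \<open>0 < p\<close>, of Q]]]) simp
    show "tvar S (f i) - e < qsum (Q (i mod p)) (f i)" for i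
      using Q(2)[of "i mod p"] by (simp add: per_mod[OF assms(1)])
  qed
  finally show ?thesis
    using that Q(1) by blast
qed

text \<open>The finitely many intervals that nearly attain the norm meet finitely many copies and
  end below a common \<open>\<eta> < \<kappa>\<close>, so a truncation that keeps them all keeps the
  sum.\<close>

lemma rnorm_truncation:
  assumes f: "f \<in> rball S" and c: "c < rnorm S f" and S: "S = {..<\<kappa>}" "0 < \<kappa>"
  obtains J \<eta> where "finite J" "\<eta> < \<kappa>" "c < rnorm S (rtrunc J \<eta> f)"
proof -
  obtain p where p: "per p f"
    using rballD(1)[OF f] by (auto simp: periodic_def)
  then have "0 < p" by (simp add: per_def)
  obtain Q where Q: "\<And>i. nonov S (Q i)" "c < avg (\<lambda>i. qsum (Q (i mod p)) (f i))"
    using rnorm_approx[OF p c] by blast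
  define T where "T = (\<Union>i<p. set (Q i))"
  have T: "finite T" "\<And>u x y. (u, x, y) \<in> T \<Longrightarrow> x \<le> y \<and> y < \<kappa>"
    using Q(1) S by (auto simp: T_def nonov_def) fastforce+
  define J where "J = fst ` T"
  \<comment> \<open>The inserted 0 gives the maximum a meaning when all the families are
    empty.\<close>
  define \<eta> where "\<eta> = Max (insert 0 ((\<lambda>(u, x, y). y) ` T))"
  have fin: "finite (insert 0 ((\<lambda>(u, x, y). y) ` T))"
    using T by simp
  have "\<eta> \<in> insert 0 ((\<lambda>(u, x, y). y) ` T)"
    unfolding \<eta>_def by (rule Max_in[OF fin]) simp
  then have \<eta>: "\<eta> < \<kappa>"
    using T(2) S by auto
  have T\<eta>: "u \<in> J" "x \<le> \<eta>" "y \<le> \<eta>" if "(u, x, y) \<in> T" for u x y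
  proof -
    show "u \<in> J" using that by (force simp: J_def)
    show "y \<le> \<eta>" unfolding \<eta>_def by (rule Max_ge[OF fin]) (use that in force)
    then show "x \<le> \<eta>" using T(2) that by fastforce
  qed
  have eq: "qsum (Q (i mod p)) (f i) = qsum (Q (i mod p)) (trunc J \<eta> (f i))" for i
  proof (rule qsum_cong)
    fix u x y assume "(u, x, y) \<in> set (Q (i mod p))"
    then have "(u, x, y) \<in> T"
      using \<open>0 < p\<close> by (auto simp: T_def intro!: bexI[of _ "i mod p"])
    then show "\<bar>f i u y - f i u x\<bar> = \<bar>trunc J \<eta> (f i) u y - trunc J \<eta> (f i) u x\<bar>"
      using T\<eta> by (simp add: trunc_def min.absorb1)
  qed
  have sub: "{..\<eta>} \<subseteq> S"
    using \<eta> S by auto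
  have tr: "rtrunc J \<eta> f \<in> rball S"
    using rtrunc_in_fin_rball[OF f sub] fin_rball_subset rball_mono[OF subset_UNIV] by blast
  have "avg (\<lambda>i. qsum (Q (i mod p)) (f i)) \<le> rnorm S (rtrunc J \<eta> f)"
    unfolding rnorm_def eq rtrunc_def
  proof (intro avg_mono)
    show "periodic (\<lambda>i. qsum (Q (i mod p)) (trunc J \<eta> (f i)))"
      by (rule periodicI[OF per_via2[OF p per_i_mod[OF \<open>0 < p\<close>, of Q]]]) simp
    show "periodic (\<lambda>i. tvar S (trunc J \<eta> (f i)))"
      by (rule periodic_via[OF periodicI[OF p]]) simp
    show "qsum (Q (i mod p)) (trunc J \<eta> (f i)) \<le> tvar S (trunc J \<eta> (f i))" for i
      using qsum_le_tvar[OF rballD(2)[OF tr, of i] Q(1)] by (simp add: rtrunc_def)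
  qed
  then have "c < rnorm S (rtrunc J \<eta> f)"
    using Q(2) by linarith
  moreover have "finite J"
    using T(1) by (simp add: J_def)
  ultimately show ?thesis
    using that \<eta> by blast
qed

text \<open>With the families and the signs of the increments chosen for \<open>f\<close>, the
  functional \<open>L\<close> is a finite combination of tests. It is therefore continuous, it is at
  most the norm on the whole ball, and it exceeds \<open>c\<close> at \<open>f\<close>.\<close>

lemma rnorm_lsc:
  assumes f: "f \<in> rball S" and c: "c < rnorm S f"
  shows "\<forall>\<^sub>F g in nhd f. g \<in> rball S \<longrightarrow> c < rnorm S g"
proof -
  obtain p where p: "per p f"
    using rballD(1)[OF f] by (auto simp: periodic_def)
  then have p0: "0 < p" by (simp add: per_def)
  obtain Q where Q: "\<And>i. nonov S (Q i)" "c < avg (\<lambda>i. qsum (Q (i mod p)) (f i))"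
    using rnorm_approx[OF p c] by blast
  define s where "s = (\<lambda>r (u, x, y). sgn (f r u y - f r u x))"
  \<comment> \<open>The weight is a sign on the indices congruent to \<open>r\<close> modulo
    \<open>p\<close> and 0 elsewhere. It applies the family chosen for that residue also to
    sequences \<open>g\<close> whose period is not \<open>p\<close>.\<close>
  define w where "w = (\<lambda>r q i. if i mod p = r then s r q else 0)"
  define lin where "lin = (\<lambda>r (h :: 'a \<Rightarrow> 'b ordinal \<Rightarrow> real). \<Sum>j<length (Q r). s r (Q r ! j) * (case Q r ! j of (u, x, y) \<Rightarrow> h u y - h u x))"
  define L where "L = (\<lambda>g. \<Sum>r<p. \<Sum>j<length (Q r). case Q r ! j of (u, x, y) \<Rightarrow>
     avg (\<lambda>i. w r (Q r ! j) i * g i u y) - avg (\<lambda>i. w r (Q r ! j) i * g i u x))"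
  have pw: "periodic (w r q)" for r q
    using per_i_mod[OF p0] unfolding w_def by (rule periodicI)
  have "(L \<longlongrightarrow> L f) (nhd f)"
    unfolding L_def by (intro tendsto_sum) (auto split: prod.split intro!: tendsto_diff tendsto_nhd pw)
  have L: "L g = avg (\<lambda>i. lin (i mod p) (g i))" if g: "periodic g" for g
  proof -
    have pg: "periodic (\<lambda>i. w r q i * g i u x)" for r q u x
      using pw g by (rule periodic_comp2)
    have "L g = (\<Sum>r<p. \<Sum>j<length (Q r). avg (\<lambda>i. w r (Q r ! j) i * (case Q r ! j of (u, x, y) \<Rightarrow> g i u y - g i u x)))"
      unfolding L_def by (intro sum.cong refl) (auto split: prod.split simp: avg_diff[OF pg pg, symmetric] right_diff_distrib)
    also have "\<dots> = avg (\<lambda>i. \<Sum>r<p. \<Sum>j<length (Q r). w r (Q r ! j) i * (case Q r ! j of (u, x, y) \<Rightarrow> g i u y - g i u x))"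
      by (subst avg_sum, intro periodic_sum periodic_comp2[OF pw g], subst avg_sum, intro periodic_comp2[OF pw g], rule refl)
    also have "(\<lambda>i. \<Sum>r<p. \<Sum>j<length (Q r). w r (Q r ! j) i * (case Q r ! j of (u, x, y) \<Rightarrow> g i u y - g i u x))
        = (\<lambda>i. \<Sum>r<p. if r = i mod p then lin (i mod p) (g i) else 0)"
      by (intro ext sum.cong refl) (auto simp: w_def lin_def)
    also have "\<dots> = (\<lambda>i. lin (i mod p) (g i))"
      using p0 by (simp add: sum.delta)
    finally show ?thesis .
  qed
  have qsum_nth: "qsum (Q r) h = (\<Sum>j<length (Q r). case Q r ! j of (u, x, y) \<Rightarrow> \<bar>h u y - h u x\<bar>)" for r h
    unfolding qsum_def sum_list_sum_nth by (intro sum.cong) auto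
  have le: "L g \<le> rnorm S g" if g: "g \<in> rball S" for g
    unfolding L[OF rballD(1)[OF g]] rnorm_def
  proof (intro avg_mono)
    have pg: "periodic g" using rballD(1)[OF g] .
    show "periodic (\<lambda>i. lin (i mod p) (g i))"
      using periodicI[OF per_i_mod[OF p0, of lin]] pg by (rule periodic_comp2)
    show "periodic (\<lambda>i. tvar S (g i))"
      using pg by (rule periodic_comp)
    fix i
    have "lin (i mod p) (g i) \<le> qsum (Q (i mod p)) (g i)"
      unfolding lin_def qsum_nth
      by (intro sum_mono) (auto split: prod.split simp: s_def sgn_if)
    also have "\<dots> \<le> tvar S (g i)"
      using Q(1) rballD(2)[OF g] by (rule qsum_le_tvar[rotated])
    finally show "lin (i mod p) (g i) \<le> tvar S (g i)" .
  qed
  have "lin (i mod p) (f i) = qsum (Q (i mod p)) (f i)" for i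
    unfolding lin_def qsum_nth
    by (intro sum.cong refl) (auto split: prod.split simp: s_def per_mod[OF p] sgn_if)
  then have "c < L f"
    using Q(2) by (simp add: L[OF rballD(1)[OF f]])
  with \<open>(L \<longlongrightarrow> L f) (nhd f)\<close> have "\<forall>\<^sub>F g in nhd f. c < L g"
    by (rule order_tendstoD(1))
  then show ?thesis
    by (rule eventually_mono) (use le order_less_le_trans in blast)
qed

lemma filterlim_rtrunc: "filterlim (rtrunc J \<eta>) (nhd (rtrunc J \<eta> f)) (nhd f)"
proof (rule filterlim_nhdI)
  show "periodic (rtrunc J \<eta> g)" if "periodic g" for g :: "('a, 'b ordinal) rfun"
    unfolding rtrunc_def by (rule periodic_via[OF that]) simp
  show "((\<lambda>g. avg (\<lambda>i. c i * rtrunc J \<eta> g i u x)) \<longlongrightarrow> avg (\<lambda>i. c i * rtrunc J \<eta> f i u x)) (nhd f)"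
    if "periodic c" for c u x
    using tendsto_nhd[OF that] by (cases "u \<in> J") (simp_all add: rtrunc_def trunc_def)
qed

text \<open>Suppose that the truncation of \<open>f\<close> keeps norm above
  \<open>c - \<epsilon>\<close>. The members of the set near \<open>f\<close> then do so too, each
  of them is closer than \<open>\<epsilon>\<close> to its truncation, and of a separation
  \<open>3 * \<epsilon>\<close> more than \<open>\<epsilon>\<close> remains between truncations.
  Hence the truncation of \<open>f\<close> survives the \<open>\<sigma>\<close> steps that empty
  \<open>fin_rball J \<eta>\<close>, a contradiction.\<close>

lemma rball_contraction:
  fixes \<kappa> \<theta> :: "'a ordinal" and c :: real
  assumes \<kappa>: "0 < \<kappa>"
    and fin: "\<And>(J :: 'u set) \<eta>. finite J \<Longrightarrow> \<eta> < \<kappa> \<Longrightarrow> \<exists>\<sigma><\<theta>. sz_iter UNIV \<epsilon> \<sigma> (fin_rball J \<eta>) = {}"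
  shows "sz_iter {..<\<kappa>} (3 * \<epsilon>) \<theta> {f \<in> rball {..<\<kappa>}. rnorm {..<\<kappa>} f \<le> c}
    \<subseteq> {f \<in> rball {..<\<kappa>} :: ('u, 'a ordinal) rfun set. rnorm {..<\<kappa>} f \<le> c - \<epsilon>}"
proof
  let ?S = "{..<\<kappa>}"
  let ?A = "{f \<in> rball ?S :: ('u, 'a ordinal) rfun set. rnorm ?S f \<le> c}"
  fix f :: "('u, 'a ordinal) rfun"
  assume f: "f \<in> sz_iter ?S (3 * \<epsilon>) \<theta> ?A"
  then have fA: "f \<in> ?A"
    using sz_iter_subset by blast
  show "f \<in> {f \<in> rball ?S. rnorm ?S f \<le> c - \<epsilon>}"
  proof (rule ccontr)
    assume "f \<notin> {f \<in> rball ?S. rnorm ?S f \<le> c - \<epsilon>}"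
    then have "c - \<epsilon> < rnorm ?S f"
      using fA by auto
    then obtain J \<eta> where J: "finite J" "\<eta> < \<kappa>" and nf: "c - \<epsilon> < rnorm ?S (rtrunc J \<eta> f)"
      using rnorm_truncation[of f ?S "c - \<epsilon>" \<kappa>] fA \<kappa> by blast
    obtain \<sigma> where \<sigma>: "\<sigma> < \<theta>" "sz_iter UNIV \<epsilon> \<sigma> (fin_rball J \<eta>) = {}"
      using fin[OF J] by blast
    have sub: "{..\<eta>} \<subseteq> ?S" using J by auto
    have tr: "rtrunc J \<eta> g \<in> rball UNIV" "rtrunc J \<eta> g \<in> rball ?S" if "g \<in> rball ?S" for g :: "('u, 'a ordinal) rfun"
      using rtrunc_in_fin_rball[OF that sub] fin_rball_subset rball_mono[OF subset_UNIV] by blast+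
    let ?C = "\<lambda>g. c - \<epsilon> < rnorm ?S (rtrunc J \<eta> g)"
    have mem: "rtrunc J \<eta> g \<in> fin_rball J \<eta>" if "g \<in> ?A" for g
      using that rtrunc_in_fin_rball sub by blast
    have ev: "\<forall>\<^sub>F h in nhd g. h \<in> ?A \<longrightarrow> ?C h" if g: "g \<in> ?A" "?C g" for g
    proof -
      have "\<forall>\<^sub>F h in nhd (rtrunc J \<eta> g). h \<in> rball ?S \<longrightarrow> c - \<epsilon> < rnorm ?S h"
        using g tr by (intro rnorm_lsc) auto
      then have "\<forall>\<^sub>F h in nhd g. rtrunc J \<eta> h \<in> rball ?S \<longrightarrow> ?C h"
        by (rule eventually_compose_filterlim[OF _ filterlim_rtrunc])
      then show ?thesis
        by (rule eventually_mono) (use tr in blast)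
    qed
    have dist: "\<epsilon> < rdist UNIV (rtrunc J \<eta> g) (rtrunc J \<eta> h)"
      if g: "g \<in> ?A" and h: "h \<in> ?A" and C: "?C g" "?C h" and d: "3 * \<epsilon> < rdist ?S g h" for g h
    proof -
      have gh: "g \<in> rball ?S" "h \<in> rball ?S" using g h by auto
      have "rdist ?S g h \<le> rdist ?S g (rtrunc J \<eta> g) + rdist ?S (rtrunc J \<eta> g) (rtrunc J \<eta> h)
          + rdist ?S (rtrunc J \<eta> h) h"
        using rdist_triangle[OF gh(1) tr(2)[OF gh(1)] gh(2)]
          rdist_triangle[OF tr(2)[OF gh(1)] tr(2)[OF gh(2)] gh(2)] by linarith
      moreover have "rdist ?S (rtrunc J \<eta> h) h < \<epsilon>" "rdist ?S g (rtrunc J \<eta> g) < \<epsilon>"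
        using rdist_rtrunc[OF gh(1) sub, of J] rdist_rtrunc[OF gh(2) sub, of J] g h C
        by (auto simp: rdist_commute)
      moreover have "rdist ?S (rtrunc J \<eta> g) (rtrunc J \<eta> h) \<le> rdist UNIV (rtrunc J \<eta> g) (rtrunc J \<eta> h)"
        using rdist_mono[OF subset_UNIV tr(1)[OF gh(1)] tr(1)[OF gh(2)]] .
      ultimately show ?thesis
        using d by linarith
    qed
    have "f \<in> sz_iter ?S (3 * \<epsilon>) \<sigma> ?A"
      using f sz_iter_antimono[OF less_imp_le[OF \<sigma>(1)], of ?S "3 * \<epsilon>" ?A] by blast
    from sz_iter_image[of ?A ?C "rtrunc J \<eta>", OF mem filterlim_rtrunc ev dist this nf]
    have "rtrunc J \<eta> f \<in> sz_iter UNIV \<epsilon> \<sigma> (fin_rball J \<eta>)" .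
    with \<sigma>(2) show False by simp
  qed
qed

lemma rball_iter_empty:
  fixes \<kappa> \<theta> :: "'a ordinal"
  assumes \<kappa>: "0 < \<kappa>" and \<epsilon>: "0 < \<epsilon>"
    and fin: "\<And>(J :: 'u set) \<eta>. finite J \<Longrightarrow> \<eta> < \<kappa> \<Longrightarrow> \<exists>\<sigma><\<theta>. sz_iter UNIV \<epsilon> \<sigma> (fin_rball J \<eta>) = {}"
  shows "\<exists>m. sz_iter {..<\<kappa>} (3 * \<epsilon>) (\<theta> * fin_ord m) (rball {..<\<kappa>} :: ('u, 'a ordinal) rfun set) = {}"
proof -
  let ?S = "{..<\<kappa>}"
  let ?B = "rball ?S :: ('u, 'a ordinal) rfun set"
  have *: "sz_iter ?S (3 * \<epsilon>) (\<theta> * fin_ord m) ?B \<subseteq> {f \<in> ?B. rnorm ?S f \<le> 1 - m * \<epsilon>}" for m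
  proof (induction m)
    case 0
    then show ?case
      using rnorm_le_one by (auto simp: sz_iter_def ord_rec_0)
  next
    case (Suc m)
    have "sz_iter ?S (3 * \<epsilon>) (\<theta> * fin_ord (Suc m)) ?B
        \<subseteq> sz_iter ?S (3 * \<epsilon>) \<theta> {f \<in> ?B. rnorm ?S f \<le> 1 - m * \<epsilon>}"
      using sz_iter_mono[OF Suc] by (simp add: times_ordinal_simps sz_iter_plus)
    also have "\<dots> \<subseteq> {f \<in> ?B. rnorm ?S f \<le> 1 - m * \<epsilon> - \<epsilon>}"
      by (rule rball_contraction[OF \<kappa> fin])
    finally show ?case
      by (simp add: algebra_simps)
  qed
  obtain m :: nat where "1 < m * \<epsilon>"
    using reals_Archimedean3[OF \<epsilon>] by blast
  then have "sz_iter ?S (3 * \<epsilon>) (\<theta> * fin_ord m) ?B = {}"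
    using *[of m] rnorm_nonneg by fastforce
  then show ?thesis ..
qed

lemma fin_rballD:
  assumes "f \<in> fin_rball J \<eta>"
  shows "f \<in> rball UNIV" "trunc J \<eta> (f i) = f i"
  using assms by (auto simp: fin_rball_def rtrunc_def fun_eq_iff)

lemma trunc_diff:
  "trunc J \<eta> (\<lambda>u x. h u x - k u x) = (\<lambda>u x. trunc J \<eta> h u x - trunc J \<eta> k u x)"
  by (auto simp: trunc_def fun_eq_iff)

section \<open>The finite case\<close>

lemma sorted_wrt_neq: "sorted_wrt (\<noteq>) xs \<Longrightarrow> distinct xs"
  by (induction xs) auto

text \<open>Among non-overlapping nondegenerate intervals each point is a left end at most once and
  a right end at most once, whence the factor 2. Degenerate intervals could repeat a point and are
  removed beforehand.\<close>

lemma var_le_finite: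
  fixes h :: "'u \<Rightarrow> 'o::linorder \<Rightarrow> real"
  assumes h: "trunc J \<eta> h = h" and fin: "finite (J \<times> {..\<eta>})"
  shows "var_le UNIV h (2 * (\<Sum>(u, x)\<in>J \<times> {..\<eta>}. \<bar>h u x\<bar>))"
  unfolding var_le_def
proof (intro allI impI)
  fix Q :: "('u \<times> 'o \<times> 'o) list"
  assume "nonov UNIV Q"
  then obtain Q' where Q': "nonov UNIV Q'" "qsum Q h = qsum Q' h"
    "\<And>u x y. (u, x, y) \<in> set Q' \<Longrightarrow> u \<in> J \<and> y \<le> \<eta>"
    using trunc_qsum[of Q \<eta> UNIV J h] h by auto
  define R where "R = filter (\<lambda>(u, x, y). x < y) Q'"
  have R: "\<And>u x y. (u, x, y) \<in> set R \<Longrightarrow> u \<in> J \<and> x \<le> \<eta> \<and> y \<le> \<eta> \<and> x < y"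
    using Q'(3) by (force simp: R_def)
  have sR: "sorted_wrt (\<lambda>(u, x, y) (u', x', y'). u = u' \<longrightarrow> y \<le> x' \<or> y' \<le> x) R"
    using nonov_filter[OF Q'(1)] by (auto simp: R_def nonov_def)
  have eq: "qsum Q' h = qsum R h"
    unfolding R_def using Q'(1) by (intro qsum_filter[symmetric]) (fastforce simp: nonov_def)
  have le: "qsum R h \<le> (\<Sum>p\<leftarrow>map (\<lambda>(u, x, y). (u, y)) R. \<bar>h (fst p) (snd p)\<bar>)
      + (\<Sum>p\<leftarrow>map (\<lambda>(u, x, y). (u, x)) R. \<bar>h (fst p) (snd p)\<bar>)"
    by (induction R) (auto simp: qsum_Cons)
  have "distinct (map (\<lambda>(u, x, y). (u, y)) R)" "distinct (map (\<lambda>(u, x, y). (u, x)) R)"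
    using R by (auto intro!: sorted_wrt_neq sorted_wrt_mono_rel[OF _ sR] simp: sorted_wrt_map) fastforce+
  then have "(\<Sum>p\<leftarrow>map (\<lambda>(u, x, y). (u, y)) R. \<bar>h (fst p) (snd p)\<bar>) \<le> (\<Sum>p\<in>J \<times> {..\<eta>}. \<bar>h (fst p) (snd p)\<bar>)"
    "(\<Sum>p\<leftarrow>map (\<lambda>(u, x, y). (u, x)) R. \<bar>h (fst p) (snd p)\<bar>) \<le> (\<Sum>p\<in>J \<times> {..\<eta>}. \<bar>h (fst p) (snd p)\<bar>)"
    using R fin by (auto simp only: sum_list_distinct_conv_sum_set intro!: sum_mono2) auto
  then show "qsum Q h \<le> 2 * (\<Sum>(u, x)\<in>J \<times> {..\<eta>}. \<bar>h u x\<bar>)"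
    using le by (simp add: Q'(2) eq case_prod_beta)
qed

lemma rball_abs_le:
  assumes "f \<in> rball UNIV"
  shows "\<bar>f i u x\<bar> \<le> 1"
  using var_leD[OF rballD(2)[OF assms, of i], of "[(u, 0, x)]"] rballD(3)[OF assms, of i u]
  by (simp add: nonov_def qsum_def)

text \<open>On finitely many points the squared L^2 norm \<open>q\<close> is available. A surviving
  \<open>f\<close> has a \<open>g\<close> in the previous set that is far from it and has almost the
  same inner product with \<open>f\<close> as \<open>f\<close> itself, so \<open>q g\<close> exceeds
  \<open>q f\<close> by a fixed amount \<open>b\<close>. Tracing \<open>n\<close> steps back yields
  a gain \<open>n * b\<close>, while \<open>q\<close> is at most \<open>card G\<close> on the
  ball.\<close>

lemma fin_rball_finite:
  fixes J :: "'u set" and \<eta> :: "'a ordinal"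
  assumes J: "finite J" and \<eta>: "\<eta> < omega" and \<epsilon>: "0 < \<epsilon>"
  shows "\<exists>n. sz_iter UNIV \<epsilon> (fin_ord n :: 'a ordinal) (fin_rball J \<eta>) = {}"
proof -
  let ?W = "fin_rball J \<eta> :: ('u, 'a ordinal) rfun set"
  define G where "G = J \<times> {..\<eta>}"
  have G: "finite G"
    using J \<eta> finite_atMost_fin_ord by (auto simp: G_def less_omega_iff)
  \<comment> \<open>The gain is about \<open>s * \<epsilon> - s\<^sup>2 * card G\<close>, and this
    \<open>s\<close> keeps the loss below half of the first term; adding 1 covers the case of empty
    \<open>G\<close>. With \<open>b = s * \<epsilon> / 4\<close> there remains \<open>2 * b\<close>,
    of which \<open>b\<close> pays for the error in the inner product.\<close>
  define s where "s = \<epsilon> / (2 * (card G + 1))"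
  have s: "0 < s" using \<epsilon> by (simp add: s_def)
  define b where "b = s * \<epsilon> / 4"
  have b: "0 < b" using s \<epsilon> by (simp add: b_def)
  define q where "q = (\<lambda>f :: ('u, 'a ordinal) rfun. \<Sum>(u, x)\<in>G. avg (\<lambda>i. (f i u x)\<^sup>2))"
  have step: "\<exists>g\<in>A. q f + b \<le> q g" if f: "f \<in> sz_deriv UNIV \<epsilon> A" and A: "A \<subseteq> ?W" for f A
  proof -
    have fA: "f \<in> A" and fr: "\<exists>\<^sub>F g in nhd f. g \<in> A \<and> \<epsilon> < rdist UNIV f g"
      using f by (auto simp: sz_deriv_def)
    have pf: "periodic f"
      using fA A rballD(1) fin_rballD(1) by blast
    have pfc: "periodic (\<lambda>i. f i u x)" for u x
      by (rule periodic_via[OF pf]) simp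
    \<comment> \<open>The values of \<open>f\<close> itself serve as weights, so the inner product
      with \<open>f\<close> is weakly continuous.\<close>
    define L where "L = (\<lambda>g :: ('u, 'a ordinal) rfun. \<Sum>(u, x)\<in>G. avg (\<lambda>i. f i u x * g i u x))"
    have "(L \<longlongrightarrow> L f) (nhd f)"
      unfolding L_def by (intro tendsto_sum) (auto split: prod.split intro!: tendsto_nhd pfc)
    then have "\<forall>\<^sub>F g in nhd f. L f - b / 2 < L g"
      using b by (intro order_tendstoD(1)) auto
    with fr have "\<exists>\<^sub>F g in nhd f. (g \<in> A \<and> \<epsilon> < rdist UNIV f g) \<and> L f - b / 2 < L g"
      by (rule frequently_eventually_frequently)
    then obtain g where gA: "g \<in> A" and d: "\<epsilon> < rdist UNIV f g" and Lg: "L f - b / 2 < L g"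
      using frequently_ex by blast
    have pg: "periodic g"
      using gA A rballD(1) fin_rballD(1) by blast
    have pfg: "periodic (\<lambda>i. F (f i u x) (g i u x))" for F :: "real \<Rightarrow> real \<Rightarrow> real" and u x
      by (rule periodic_via2[OF pf pg]) simp
    have "rdist UNIV f g \<le> avg (\<lambda>i. 2 * (\<Sum>(u, x)\<in>G. \<bar>f i u x - g i u x\<bar>))"
      unfolding rdist_def
    proof (rule avg_mono)
      show "periodic (\<lambda>i. tvar UNIV (\<lambda>u x. f i u x - g i u x))"
        "periodic (\<lambda>i. 2 * (\<Sum>(u, x)\<in>G. \<bar>f i u x - g i u x\<bar>))"
        by (rule periodic_via2[OF pf pg]; simp)+
      show "tvar UNIV (\<lambda>u x. f i u x - g i u x) \<le> 2 * (\<Sum>(u, x)\<in>G. \<bar>f i u x - g i u x\<bar>)" for i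
      proof -
        have "trunc J \<eta> (f i) = f i" "trunc J \<eta> (g i) = g i"
          using fA gA A fin_rballD(2) by blast+
        then show ?thesis
          unfolding G_def using G by (intro tvar_le var_le_finite) (simp_all add: trunc_diff G_def)
      qed
    qed
    also have "\<dots> = 2 * (\<Sum>(u, x)\<in>G. avg (\<lambda>i. \<bar>f i u x - g i u x\<bar>))"
      using pfg[of "\<lambda>a b. \<bar>a - b\<bar>"]
      by (subst avg_cmult) (auto intro!: periodic_sum simp: avg_sum case_prod_beta)
    finally have d2: "\<epsilon> / 2 < (\<Sum>(u, x)\<in>G. avg (\<lambda>i. \<bar>f i u x - g i u x\<bar>))"
      using d by simp
    have "2 * avg (\<lambda>i. f i u x * g i u x) - 2 * avg (\<lambda>i. f i u x * f i u x) + 2 * s * avg (\<lambda>i. \<bar>f i u x - g i u x\<bar>) - s\<^sup>2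
       \<le> avg (\<lambda>i. (g i u x)\<^sup>2) - avg (\<lambda>i. (f i u x)\<^sup>2)" for u x
    proof -
      have "2 * avg (\<lambda>i. f i u x * g i u x) - 2 * avg (\<lambda>i. f i u x * f i u x) + 2 * s * avg (\<lambda>i. \<bar>f i u x - g i u x\<bar>) - s\<^sup>2
       = avg (\<lambda>i. 2 * (f i u x * g i u x) - 2 * (f i u x * f i u x) + 2 * s * \<bar>f i u x - g i u x\<bar> - s\<^sup>2)"
        using pfg[of "\<lambda>a b. a * b"] pfg[of "\<lambda>a b. a * a"] pfg[of "\<lambda>a b. \<bar>a - b\<bar>"]
          pfg[of "\<lambda>a b. 2 * (a * b)"] pfg[of "\<lambda>a b. 2 * (a * a)"] pfg[of "\<lambda>a b. 2 * s * \<bar>a - b\<bar>"]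
          pfg[of "\<lambda>a b. 2 * (a * b) - 2 * (a * a)"] pfg[of "\<lambda>a b. 2 * (a * b) - 2 * (a * a) + 2 * s * \<bar>a - b\<bar>"]
        by (simp add: avg_diff avg_add avg_cmult)
      also have "\<dots> \<le> avg (\<lambda>i. (g i u x)\<^sup>2 - (f i u x)\<^sup>2)"
      proof (rule avg_mono)
        fix i
        \<comment> \<open>This bounds a square from below by a linear term in the absolute value, so
          that the averaged absolute difference enters without the Cauchy-Schwarz
          inequality.\<close>
        have "0 \<le> (\<bar>f i u x - g i u x\<bar> - s)\<^sup>2" by simp
        then show "2 * (f i u x * g i u x) - 2 * (f i u x * f i u x) + 2 * s * \<bar>f i u x - g i u x\<bar> - s\<^sup>2
          \<le> (g i u x)\<^sup>2 - (f i u x)\<^sup>2"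
          by (simp add: power2_eq_square algebra_simps flip: abs_mult)
      qed (rule pfg)+
      also have "\<dots> = avg (\<lambda>i. (g i u x)\<^sup>2) - avg (\<lambda>i. (f i u x)\<^sup>2)"
        using pfg[of "\<lambda>a b. a\<^sup>2"] pfg[of "\<lambda>a b. b\<^sup>2"] by (intro avg_diff)
      finally show ?thesis .
    qed
    then have "(\<Sum>(u, x)\<in>G. 2 * avg (\<lambda>i. f i u x * g i u x) - 2 * avg (\<lambda>i. f i u x * f i u x) + 2 * s * avg (\<lambda>i. \<bar>f i u x - g i u x\<bar>) - s\<^sup>2)
      \<le> (\<Sum>(u, x)\<in>G. avg (\<lambda>i. (g i u x)\<^sup>2) - avg (\<lambda>i. (f i u x)\<^sup>2))"
      by (intro sum_mono) auto
    then have "2 * L g - 2 * L f + 2 * s * (\<Sum>(u, x)\<in>G. avg (\<lambda>i. \<bar>f i u x - g i u x\<bar>)) - s\<^sup>2 * card G \<le> q g - q f"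
      by (simp add: L_def q_def case_prod_beta sum.distrib sum_subtractf sum_distrib_left mult.commute)
    moreover have "2 * s * (\<epsilon> / 2) \<le> 2 * s * (\<Sum>(u, x)\<in>G. avg (\<lambda>i. \<bar>f i u x - g i u x\<bar>))"
      using d2 s by (intro mult_left_mono) auto
    moreover have "s\<^sup>2 * card G \<le> s * \<epsilon> / 2"
    proof -
      have "s * card G \<le> s * (card G + 1)" using s by simp
      also have "\<dots> = \<epsilon> / 2" by (simp add: s_def field_simps)
      finally have "s * (s * card G) \<le> s * (\<epsilon> / 2)"
        using s by (intro mult_left_mono) auto
      then show ?thesis by (simp add: power2_eq_square)
    qed
    ultimately have "q f + b \<le> q g"
      using Lg by (simp add: b_def)
    with gA show ?thesis by blast
  qed
  have iter: "\<exists>g\<in>?W. q f + n * b \<le> q g" if "f \<in> sz_iter UNIV \<epsilon> (fin_ord n :: 'a ordinal) ?W" for f n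
    using that
  proof (induction n arbitrary: f)
    case 0
    then show ?case by (auto simp: sz_iter_def ord_rec_0)
  next
    case (Suc n)
    then have "f \<in> sz_deriv UNIV \<epsilon> (sz_iter UNIV \<epsilon> (fin_ord n :: 'a ordinal) ?W)"
      by (simp add: sz_iter_def ord_rec_osuc)
    then obtain g where g: "g \<in> sz_iter UNIV \<epsilon> (fin_ord n :: 'a ordinal) ?W" "q f + b \<le> q g"
      using step[OF _ sz_iter_subset] by blast
    obtain g' where "g' \<in> ?W" "q g + n * b \<le> q g'"
      using Suc.IH[OF g(1)] by blast
    then show ?case
      using g(2) by (intro bexI[of _ g']) (auto simp: algebra_simps)
  qed
  have q_le: "q f \<le> card G" if "f \<in> ?W" for f
  proof -
    have f: "f \<in> rball UNIV" using that fin_rballD(1) by blast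
    have "q f \<le> (\<Sum>(u, x)\<in>G. 1)"
      unfolding q_def case_prod_beta
      by (intro sum_mono avg_le periodic_via[OF rballD(1)[OF f]])
        (use rball_abs_le[OF f] in \<open>auto simp: power2_le_iff_abs_le abs_square_le_1\<close>)
    then show ?thesis by simp
  qed
  have q_ge: "0 \<le> q f" if "f \<in> ?W" for f
    unfolding q_def case_prod_beta
    by (intro sum_nonneg avg_nonneg periodic_via[OF rballD(1)[OF fin_rballD(1)[OF that]]]) auto
  obtain n :: nat where n: "card G < n * b"
    using reals_Archimedean3[OF b] by blast
  have "sz_iter UNIV \<epsilon> (fin_ord n :: 'a ordinal) ?W = {}"
  proof (rule ccontr)
    assume "sz_iter UNIV \<epsilon> (fin_ord n :: 'a ordinal) ?W \<noteq> {}"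
    then obtain f where f: "f \<in> sz_iter UNIV \<epsilon> (fin_ord n :: 'a ordinal) ?W" by blast
    then have "f \<in> ?W" using sz_iter_subset by blast
    with iter[OF f] q_ge q_le n show False by force
  qed
  then show ?thesis ..
qed

section \<open>Splitting into blocks\<close>

fun opow :: "'a ordinal \<Rightarrow> nat \<Rightarrow> 'a ordinal" where
  "opow k 0 = 1"
| "opow k (Suc n) = opow k n * k"

lemma opow_commute: "k * opow k n = opow k n * k"
  by (induction n) (simp_all flip: times_assoc_ordinal)

lemma opow_pos: "0 < k \<Longrightarrow> 0 < opow k n"
  by (induction n) (use times_less_iff(1)[of _ 0 k] in \<open>auto simp: one_ordinal_def\<close>)

text \<open>The index \<open>(j, \<xi>) # u\<close> stands for the block of the points \<open>k\<^bsup>j+1\<^esup>\<xi> + k\<^sup>jx\<close> with \<open>x < k\<close> in the copy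
  with index \<open>u\<close>.  With lists as indices, splitting repeatedly does not change the type.\<close>

type_synonym 'a idx = "(nat \<times> 'a ordinal) list"

text \<open>Each of the \<open>n\<close> levels may carry the whole variation of \<open>h\<close>;
  dividing by \<open>n\<close> keeps the unit ball inside the unit ball. Subtracting the value at
  the start of the block restores the normalisation at 0.\<close>

definition split_blocks :: "nat \<Rightarrow> 'a ordinal \<Rightarrow> ('a idx \<Rightarrow> 'a ordinal \<Rightarrow> real) \<Rightarrow> 'a idx \<Rightarrow> 'a ordinal \<Rightarrow> real" where
  "split_blocks n k h v x = (case v of [] \<Rightarrow> 0 | (j, \<xi>) # u \<Rightarrow>
     if j < n then (h u (opow k (Suc j) * \<xi> + opow k j * x) - h u (opow k (Suc j) * \<xi>)) / n else 0)"

lemma qsum_levels: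
  fixes n :: nat
  assumes "\<And>v x y. (v, x, y) \<in> set Q \<Longrightarrow> v = [] \<or> n \<le> fst (hd v) \<Longrightarrow> h v y = h v x"
  shows "qsum Q h = (\<Sum>j<n. qsum (filter (\<lambda>(v, x, y). v \<noteq> [] \<and> fst (hd v) = j) Q) h)"
  using assms
proof (induction Q)
  case (Cons q Q)
  obtain v x y where q: "q = (v, x, y)" by (cases q)
  have "qsum (filter (\<lambda>(v, x, y). v \<noteq> [] \<and> fst (hd v) = j) (q # Q)) h
     = (if j = fst (hd v) then (if v \<noteq> [] then \<bar>h v y - h v x\<bar> else 0) else 0)
       + qsum (filter (\<lambda>(v, x, y). v \<noteq> [] \<and> fst (hd v) = j) Q) h" for j
    by (auto simp: q qsum_Cons)
  then have "(\<Sum>j<n. qsum (filter (\<lambda>(v, x, y). v \<noteq> [] \<and> fst (hd v) = j) (q # Q)) h)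
    = (if fst (hd v) < n then (if v \<noteq> [] then \<bar>h v y - h v x\<bar> else 0) else 0) + qsum Q h"
    using Cons.IH Cons.prems
      sum.delta[of "{..<n}" "fst (hd v)" "\<lambda>_. if v \<noteq> [] then \<bar>h v y - h v x\<bar> else 0"]
    by (simp only: sum.distrib) auto
  also have "\<dots> = qsum (q # Q) h"
    using Cons.prems[of v x y] by (auto simp: q qsum_Cons)
  finally show ?case by simp
qed simp

text \<open>The blocks of one level follow one another inside the interval they come from, so
  intervals in all of them form a single family for \<open>h\<close>. A level thus contributes at
  most \<open>c / n\<close>.\<close>

lemma var_le_split_blocks:
  assumes h: "var_le UNIV h c" and k: "0 < k" and n: "0 < n"
  shows "var_le {..<k} (split_blocks n k h) c"
  unfolding var_le_def
proof (intro allI impI)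
  fix Q :: "('a idx \<times> 'a ordinal \<times> 'a ordinal) list"
  assume Q: "nonov {..<k} Q"
  have le: "qsum (filter (\<lambda>(v, x, y). v \<noteq> [] \<and> fst (hd v) = j) Q) (split_blocks n k h) \<le> c / n"
    if j: "j < n" for j
  proof -
    define P where "P = filter (\<lambda>(v, x, y). v \<noteq> [] \<and> fst (hd v) = j) Q"
    have P: "nonov {..<k} P"
      unfolding P_def using Q by (rule nonov_filter)
    define \<rho> where "\<rho> = (\<lambda>(v :: 'a idx) x. opow k (Suc j) * snd (hd v) + opow k j * x)"
    have P_mem: "v \<noteq> [] \<and> fst (hd v) = j \<and> x < k \<and> y < k" if "(v, x, y) \<in> set P" for v x y
      using that P by (auto simp: P_def nonov_def)
    have lt: "\<rho> v y \<le> \<rho> w x" if "snd (hd v) < snd (hd w)" "y < k" for v w x y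
    proof -
      have "opow k j * y < opow k (Suc j)"
        using that(2) times_less_iff(1)[OF opow_pos[OF k]] by simp
      then have "\<rho> v y < opow k (Suc j) * snd (hd w)"
        unfolding \<rho>_def using that(1) by (intro ordinal_division_less)
      then show ?thesis
        unfolding \<rho>_def by (meson le_plus_ordinal less_imp_le order_trans)
    qed
    have "nonov UNIV (map (\<lambda>(v, x, y). (tl v, \<rho> v x, \<rho> v y)) P)"
    proof (rule nonov_map[OF P])
      show "x \<le> y \<Longrightarrow> \<rho> v x \<le> \<rho> v y" for v x y
        using times_less_iff(2)[OF opow_pos[OF k]] by (simp add: \<rho>_def)
      fix v w x y x' y'
      assume m: "(v, x, y) \<in> set P" "(w, x', y') \<in> set P" and "tl v = tl w" "v \<noteq> w"
      then have "snd (hd v) \<noteq> snd (hd w)"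
        using P_mem[OF m(1)] P_mem[OF m(2)] by (metis list.expand prod_eqI)
      then show "\<rho> v y \<le> \<rho> w x' \<or> \<rho> w y' \<le> \<rho> v x"
        using lt P_mem[OF m(1)] P_mem[OF m(2)] by (meson neqE)
    qed auto
    then have "qsum P (\<lambda>v x. h (tl v) (\<rho> v x)) \<le> c"
      unfolding qsum_map[of tl \<rho> P h, symmetric] by (rule var_leD[OF h])
    moreover
    have "qsum P (split_blocks n k h) = qsum P (\<lambda>v x. (1 / n) * h (tl v) (\<rho> v x))"
    proof (rule qsum_cong)
      fix v x y assume "(v, x, y) \<in> set P"
      then obtain \<xi> u where v: "v = (j, \<xi>) # u"
        using P_mem by (metis list.exhaust_sel prod.collapse)
      show "\<bar>split_blocks n k h v y - split_blocks n k h v x\<bar>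
        = \<bar>1 / n * h (tl v) (\<rho> v y) - 1 / n * h (tl v) (\<rho> v x)\<bar>"
        using j by (simp add: split_blocks_def v \<rho>_def diff_divide_distrib)
    qed
    then have "qsum P (split_blocks n k h) = \<bar>1 / n\<bar> * qsum P (\<lambda>v x. h (tl v) (\<rho> v x))"
      by (rule trans[OF _ qsum_cmult])
    ultimately show ?thesis
      using n unfolding P_def[symmetric] by (simp add: divide_right_mono)
  qed
  have "qsum Q (split_blocks n k h) = (\<Sum>j<n. qsum (filter (\<lambda>(v, x, y). v \<noteq> [] \<and> fst (hd v) = j) Q) (split_blocks n k h))"
    by (rule qsum_levels) (auto simp: split_blocks_def split: list.splits)
  also have "\<dots> \<le> (\<Sum>j<n. c / n)"
    using le by (intro sum_mono) auto
  also have "\<dots> = c"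
    using n by simp
  finally show "qsum Q (split_blocks n k h) \<le> c" .
qed

text \<open>Induction on the number \<open>i\<close> of digits, for \<open>h\<close> restricted to
  the multiples of \<open>opow k (n - i)\<close>. A further digit costs \<open>2 * n * c\<close>:
  the factor 2 stands for the two block families of \<open>block_qsum\<close>, the factor
  \<open>n\<close> undoes the division in \<open>split_blocks\<close>.\<close>

lemma var_le_unsplit:
  assumes sp: "var_le {..<k} (split_blocks n k h) c" and k: "0 < k"
    and h: "trunc J \<eta> h = h" and \<eta>: "\<eta> < opow k n"
  shows "var_le UNIV h (2 * real n * real n * c)"
proof -
  have lev: "i \<le> n \<Longrightarrow> var_le {..<opow k i} (\<lambda>u x. h u (opow k (n - i) * x)) (2 * real n * real i * c)" for i
  proof (induction i)
    case 0
    show ?case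
      unfolding var_le_def
    proof (intro allI impI)
      fix Q :: "('a idx \<times> 'a ordinal \<times> 'a ordinal) list"
      assume Q: "nonov {..<opow k 0} Q"
      have "qsum Q (\<lambda>u x. h u (opow k (n - 0) * x)) = qsum Q (\<lambda>u x. 0)"
      proof (rule qsum_cong)
        fix u x y assume "(u, x, y) \<in> set Q"
        then have "x < 1" "y < 1"
          using Q by (auto simp: nonov_def)
        then have "x = 0" "y = 0"
          by (simp_all add: one_ordinal_def less_osuc_iff order.antisym)
        then show "\<bar>h u (opow k (n - 0) * y) - h u (opow k (n - 0) * x)\<bar> = \<bar>0 - 0\<bar>"
          by simp
      qed
      also have "\<dots> = 0"
        by (induction Q) (auto simp: qsum_Cons)
      finally show "qsum Q (\<lambda>u x. h u (opow k (n - 0) * x)) \<le> 2 * real n * real 0 * c" by simp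
    qed
  next
    case (Suc i)
    define j where "j = n - Suc i"
    have j: "j < n" "n - i = Suc j"
      using Suc.prems by (auto simp: j_def)
    show ?case
      unfolding var_le_def j_def[symmetric]
    proof (intro allI impI)
      fix Q :: "('a idx \<times> 'a ordinal \<times> 'a ordinal) list"
      assume "nonov {..<opow k (Suc i)} Q"
      then have "nonov {..<k * opow k i} Q"
        by (simp add: opow_commute)
      from block_qsum[OF this k, of "\<lambda>u x. h u (opow k j * x)"]
      obtain Q1 Q2 Q3 where Q: "nonov {..<k} Q1" "nonov {..<k} Q2" "nonov {..<opow k i} Q3"
        "qsum Q (\<lambda>u x. h u (opow k j * x)) \<le> qsum Q1 (\<lambda>(\<xi>, u) x. h u (opow k j * (k * \<xi> + x)))
          + qsum Q2 (\<lambda>(\<xi>, u) x. h u (opow k j * (k * \<xi> + x))) + qsum Q3 (\<lambda>u x. h u (opow k j * (k * x)))"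
        by blast
      have q3: "qsum Q3 (\<lambda>u x. h u (opow k j * (k * x))) \<le> 2 * real n * real i * c"
        using var_leD[OF Suc.IH Q(3)] Suc.prems by (simp add: j times_assoc_ordinal)
      have qR: "qsum R (\<lambda>(\<xi>, u) x. h u (opow k j * (k * \<xi> + x))) \<le> n * c" if R: "nonov {..<k} R" for R
      proof -
        define R' where "R' = map (\<lambda>((\<xi>, u), x, y). ((j, \<xi>) # u, x, y)) R"
        have R': "R' = map (\<lambda>(v, x, y). (case v of (\<xi>, u) \<Rightarrow> (j, \<xi>) # u, x, y)) R"
          unfolding R'_def by (intro map_cong) auto
        have "nonov {..<k} R'"
          unfolding R' by (rule nonov_map[OF R, where \<rho> = "\<lambda>_ x. x"]) auto
        then have "qsum R' (split_blocks n k h) \<le> c"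
          using var_leD[OF sp] by blast
        moreover have "qsum R' (split_blocks n k h) = qsum R (\<lambda>v. split_blocks n k h (case v of (\<xi>, u) \<Rightarrow> (j, \<xi>) # u))"
          unfolding R' by (rule qsum_map[where \<rho> = "\<lambda>_ x. x"])
        moreover have "\<dots> = qsum R (\<lambda>v x. (1 / n) * (case v of (\<xi>, u) \<Rightarrow> \<lambda>x. h u (opow k j * (k * \<xi> + x))) x)"
          using j by (intro qsum_cong) (auto simp: split_blocks_def times_plus_ordinal times_assoc_ordinal diff_divide_distrib)
        moreover have "\<dots> = \<bar>1 / n\<bar> * qsum R (\<lambda>(\<xi>, u) x. h u (opow k j * (k * \<xi> + x)))"
          by (rule qsum_cmult)
        ultimately have "(1 / n) * qsum R (\<lambda>(\<xi>, u) x. h u (opow k j * (k * \<xi> + x))) \<le> c"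
          by simp
        then show ?thesis
          using j by (simp add: field_simps)
      qed
      have "2 * real n * real (Suc i) * c = n * c + n * c + 2 * real n * real i * c"
        by (simp add: algebra_simps)
      then show "qsum Q (\<lambda>u x. h u (opow k j * x)) \<le> 2 * real n * real (Suc i) * c"
        using Q(4) q3 qR[OF Q(1)] qR[OF Q(2)] by linarith
    qed
  qed
  have lev_n: "var_le {..<opow k n} h (2 * real n * real n * c)"
    using lev[of n] by simp
  \<comment> \<open>Beyond \<open>\<eta>\<close> the function \<open>h\<close> is constant, so the
    variation below \<open>opow k n\<close> is all of it.\<close>
  moreover have "{..\<eta>} \<subseteq> {..<opow k n}"
    using \<eta> by auto
  ultimately show ?thesis
    using var_le_trunc[of "{..<opow k n}" h _ \<eta> J] h by simp
qed

section \<open>Block splitting of random functions\<close>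

definition rsplit :: "nat \<Rightarrow> 'a ordinal \<Rightarrow> ('a idx, 'a ordinal) rfun \<Rightarrow> ('a idx, 'a ordinal) rfun" where
  "rsplit n k f = (\<lambda>i. split_blocks n k (f i))"

lemma split_blocks_diff:
  "split_blocks n k (\<lambda>u x. h u x - l u x) = (\<lambda>v x. split_blocks n k h v x - split_blocks n k l v x)"
  by (auto simp: split_blocks_def fun_eq_iff split: list.split) (simp add: field_simps)

text \<open>A value of the split function is a multiple of a difference of two values of the
  original one, so each test pulls back to a difference of two tests.\<close>

lemma filterlim_rsplit:
  assumes f: "periodic f"
  shows "filterlim (rsplit n k) (nhd (rsplit n k f)) (nhd f)"
proof (rule filterlim_nhdI)
  show "periodic (rsplit n k g)" if "periodic g" for g :: "('a idx, 'a ordinal) rfun"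
    unfolding rsplit_def by (rule periodic_via[OF that]) simp
  fix c :: "nat \<Rightarrow> real" and v :: "'a idx" and x :: "'a ordinal"
  assume c: "periodic c"
  show "((\<lambda>g. avg (\<lambda>i. c i * rsplit n k g i v x)) \<longlongrightarrow> avg (\<lambda>i. c i * rsplit n k f i v x)) (nhd f)"
  proof (cases "\<exists>j \<xi> u. v = (j, \<xi>) # u \<and> j < n")
    case True
    then obtain j \<xi> u where v: "v = (j, \<xi>) # u" "j < n" by blast
    define a where "a = opow k (Suc j) * \<xi> + opow k j * x"
    define b where "b = opow k (Suc j) * \<xi>"
    have c': "periodic (\<lambda>i. c i / n)"
      by (rule periodic_via[OF c]) simp
    have eq: "avg (\<lambda>i. c i * rsplit n k g i v x) = avg (\<lambda>i. c i / n * g i u a) - avg (\<lambda>i. c i / n * g i u b)"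
      if "periodic g" for g
    proof -
      have "periodic (\<lambda>i. c i / n * g i u a)" "periodic (\<lambda>i. c i / n * g i u b)"
        by (rule periodic_via2[OF c that]; simp)+
      from avg_diff[OF this] show ?thesis
        using v by (simp add: rsplit_def split_blocks_def a_def b_def right_diff_distrib diff_divide_distrib)
    qed
    have "((\<lambda>g. avg (\<lambda>i. c i / n * g i u a) - avg (\<lambda>i. c i / n * g i u b)) \<longlongrightarrow>
        avg (\<lambda>i. c i / n * f i u a) - avg (\<lambda>i. c i / n * f i u b)) (nhd f)"
      by (intro tendsto_diff tendsto_nhd c')
    moreover have "\<forall>\<^sub>F g in nhd f. avg (\<lambda>i. c i / n * g i u a) - avg (\<lambda>i. c i / n * g i u b)
        = avg (\<lambda>i. c i * rsplit n k g i v x)"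
      using eventually_nhd_periodic by (rule eventually_mono) (simp only: eq)
    ultimately show ?thesis
      unfolding eq[OF f] by (rule Lim_transform_eventually)
  next
    case False
    then have "rsplit n k g i v x = 0" for g i
      by (auto simp: rsplit_def split_blocks_def split: list.split)
    then show ?thesis by simp
  qed
qed

lemma rsplit_in_rball:
  assumes f: "f \<in> rball UNIV" and "0 < k" "0 < n"
  shows "rsplit n k f \<in> rball {..<k}"
proof -
  have "periodic (rsplit n k f)"
    unfolding rsplit_def by (rule periodic_via[OF rballD(1)[OF f]]) simp
  moreover have "var_le {..<k} (rsplit n k f i) 1" for i
    unfolding rsplit_def using rballD(2)[OF f] assms(2,3) by (rule var_le_split_blocks)
  moreover have "rsplit n k f i v 0 = 0" for i v
    by (auto simp: rsplit_def split_blocks_def split: list.split)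
  ultimately show ?thesis
    by (simp add: rball_def)
qed

lemma rdist_rsplit:
  assumes f: "f \<in> fin_rball J \<eta>" and g: "g \<in> fin_rball J \<eta>" and k: "0 < k" and n: "0 < n"
    and \<eta>: "\<eta> < opow k n"
  shows "rdist UNIV f g \<le> 2 * real n * real n * rdist {..<k} (rsplit n k f) (rsplit n k g)"
proof -
  note f' = fin_rballD(1)[OF f] and g' = fin_rballD(1)[OF g]
  let ?d = "\<lambda>i. tvar {..<k} (\<lambda>v x. rsplit n k f i v x - rsplit n k g i v x)"
  have p: "periodic ?d"
    unfolding rsplit_def by (rule periodic_via2[OF rballD(1)[OF f'] rballD(1)[OF g']]) simp
  have "rdist UNIV f g \<le> avg (\<lambda>i. 2 * real n * real n * ?d i)"
    unfolding rdist_def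
  proof (rule avg_mono)
    show "periodic (\<lambda>i. tvar UNIV (\<lambda>u x. f i u x - g i u x))"
      by (rule periodic_via2[OF rballD(1)[OF f'] rballD(1)[OF g']]) simp
    show "periodic (\<lambda>i. 2 * real n * real n * ?d i)"
      by (rule periodic_via[OF p]) simp
    fix i
    have "var_le {..<k} (\<lambda>v x. rsplit n k f i v x - rsplit n k g i v x) (1 + 1)"
      using rballD(2)[OF rsplit_in_rball[OF f' k n]] rballD(2)[OF rsplit_in_rball[OF g' k n]]
      by (rule var_le_diff)
    then have "var_le {..<k} (split_blocks n k (\<lambda>u x. f i u x - g i u x)) (?d i)"
      using var_le_tvar by (simp add: rsplit_def split_blocks_diff)
    moreover have "trunc J \<eta> (\<lambda>u x. f i u x - g i u x) = (\<lambda>u x. f i u x - g i u x)"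
      using fin_rballD(2)[OF f] fin_rballD(2)[OF g] by (simp add: trunc_diff)
    ultimately show "tvar UNIV (\<lambda>u x. f i u x - g i u x) \<le> 2 * real n * real n * ?d i"
      using k \<eta> by (intro tvar_le var_le_unsplit)
  qed
  also have "\<dots> = 2 * real n * real n * rdist {..<k} (rsplit n k f) (rsplit n k g)"
    unfolding rdist_def by (rule avg_cmult[OF p])
  finally show ?thesis .
qed

section \<open>The index of finitely many intervals\<close>

text \<open>This is the hypothesis of \<open>rball_iter_empty\<close> for
  \<open>\<kappa> = omega_pow (omega_pow \<gamma>)\<close> and
  \<open>\<theta> = omega_pow (1 + \<gamma>)\<close>, at every \<open>\<epsilon>\<close>. The stage
  \<open>\<sigma>\<close> may depend on \<open>J\<close>, \<open>\<eta>\<close> and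
  \<open>\<epsilon>\<close>, but it has to stay strictly below \<open>\<theta>\<close>.\<close>

definition small_index :: "'a ordinal \<Rightarrow> bool" where
  "small_index \<gamma> \<longleftrightarrow> (\<forall>(J :: 'a idx set) \<eta> \<epsilon>. finite J \<longrightarrow> \<eta> < omega_pow (omega_pow \<gamma>) \<longrightarrow> 0 < \<epsilon> \<longrightarrow>
     (\<exists>\<sigma> < omega_pow (1 + \<gamma>). sz_iter UNIV \<epsilon> \<sigma> (fin_rball J \<eta>) = {}))"

lemma opow_omega_pow: "opow (omega_pow (omega_pow \<gamma>)) n = omega_pow (omega_pow \<gamma> * fin_ord n)"
  by (induction n) (simp_all add: omega_pow_simps omega_pow_plus times_ordinal_simps)

lemma less_omega_pow_omega_pow_osuc:
  assumes "\<eta> < omega_pow (omega_pow (osuc \<gamma>))"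
  obtains n where "0 < n" "\<eta> < opow (omega_pow (omega_pow \<gamma>)) n"
proof -
  have lim: "limit_ordinal (omega_pow \<gamma> * omega)"
    by (intro times_limit limit_omega omega_pow_pos)
  then obtain \<delta> where "\<delta> < omega_pow \<gamma> * omega" "\<eta> < omega_pow \<delta>"
    using assms less_omega_pow_limit[OF lim, of \<eta>] by (auto simp: omega_pow_simps(2))
  moreover from this(1) obtain n where n: "\<delta> < omega_pow \<gamma> * fin_ord n"
    using less_omega_mult by blast
  ultimately have "\<eta> < omega_pow (omega_pow \<gamma> * fin_ord n)"
    by (meson less_trans omega_pow_less_iff(1))
  moreover have "0 < n"
    using n by (cases n) auto
  ultimately show ?thesis
    using that by (simp add: opow_omega_pow)
qed

lemma small_index_osuc:
  assumes "small_index (\<gamma> :: 'a ordinal)"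
  shows "small_index (osuc \<gamma>)"
  unfolding small_index_def
proof (intro allI impI)
  fix J :: "'a idx set" and \<eta> :: "'a ordinal" and \<epsilon> :: real
  assume J: "finite J" and \<eta>: "\<eta> < omega_pow (omega_pow (osuc \<gamma>))" and \<epsilon>: "0 < \<epsilon>"
  define k where "k = omega_pow (omega_pow \<gamma>)"
  have k: "0 < k" by (simp add: k_def)
  obtain n where n: "0 < n" "\<eta> < opow k n"
    using less_omega_pow_omega_pow_osuc[OF \<eta>] by (auto simp: k_def)
  \<comment> \<open>Splitting divides distances by at most \<open>2 * n * n\<close>, so a separation
    \<open>\<epsilon>\<close> becomes more than \<open>6 * e\<close>, enough for the
    \<open>3 * e\<close> at which the split ball is known to vanish.\<close>
  define e where "e = \<epsilon> / (12 * real n * real n)"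
  have e: "0 < e" using \<epsilon> n by (simp add: e_def)
  have fin: "\<exists>\<sigma><omega_pow (1 + \<gamma>). sz_iter UNIV e \<sigma> (fin_rball J' \<eta>') = {}"
    if "finite (J' :: 'a idx set)" "\<eta>' < k" for J' \<eta>'
    using assms that e by (auto simp: small_index_def k_def)
  obtain m where m: "sz_iter {..<k} (3 * e) (omega_pow (1 + \<gamma>) * fin_ord m) (rball {..<k} :: ('a idx, 'a ordinal) rfun set) = {}"
    using rball_iter_empty[OF k e fin] by blast
  let ?\<sigma> = "omega_pow (1 + \<gamma>) * fin_ord m"
  have "sz_iter UNIV \<epsilon> ?\<sigma> (fin_rball J \<eta>) = {}"
  proof (rule ccontr)
    assume "sz_iter UNIV \<epsilon> ?\<sigma> (fin_rball J \<eta>) \<noteq> {}"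
    then obtain f where f: "f \<in> sz_iter UNIV \<epsilon> ?\<sigma> (fin_rball J \<eta>)" by blast
    have "rsplit n k f \<in> sz_iter {..<k} (3 * e) ?\<sigma> (rball {..<k})"
    proof (rule sz_iter_image[where C = "\<lambda>_. True", OF _ _ _ _ f])
      fix g assume g: "g \<in> fin_rball J \<eta>"
      then show "rsplit n k g \<in> rball {..<k}"
        using rsplit_in_rball[OF _ k n(1)] fin_rballD(1) by blast
      show "filterlim (rsplit n k) (nhd (rsplit n k g)) (nhd g)"
        using filterlim_rsplit[OF rballD(1)[OF fin_rballD(1)[OF g]]] .
    next
      fix g h assume gh: "g \<in> fin_rball J \<eta>" "h \<in> fin_rball J \<eta>" and d: "\<epsilon> < rdist UNIV g h"
      have "\<epsilon> < 2 * real n * real n * rdist {..<k} (rsplit n k g) (rsplit n k h)"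
        using rdist_rsplit[OF gh k n] d by simp
      moreover have "2 * real n * real n * (6 * e) = \<epsilon>"
        using n by (simp add: e_def)
      ultimately have "2 * real n * real n * (6 * e) < 2 * real n * real n * rdist {..<k} (rsplit n k g) (rsplit n k h)"
        by simp
      then show "3 * e < rdist {..<k} (rsplit n k g) (rsplit n k h)"
        using e n by simp
    qed auto
    with m show False by simp
  qed
  moreover have "?\<sigma> < omega_pow (1 + osuc \<gamma>)"
    by (simp add: plus_ordinal_simps omega_pow_simps times_less_iff(1))
  ultimately show "\<exists>\<sigma><omega_pow (1 + osuc \<gamma>). sz_iter UNIV \<epsilon> \<sigma> (fin_rball J \<eta>) = {}"
    by blast
qed

text \<open>Limit stages cost nothing: below a limit \<open>\<gamma>\<close> every
  \<open>\<eta>\<close> is already below \<open>omega_pow (omega_pow \<gamma>')\<close> for some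
  \<open>\<gamma>' < \<gamma>\<close>. Only successors multiply the bound by
  \<open>omega\<close>.\<close>

lemma small_index: "small_index \<gamma>"
proof (induction \<gamma> rule: ordinal_induct)
  case zero
  show ?case
    unfolding small_index_def
  proof (intro allI impI)
    fix J :: "'a idx set" and \<eta> :: "'a ordinal" and \<epsilon> :: real
    assume J: "finite J" and \<eta>: "\<eta> < omega_pow (omega_pow 0)" and \<epsilon>: "0 < \<epsilon>"
    have lt: "\<eta> < omega" using \<eta> by (simp add: omega_pow_simps(1))
    from fin_rball_finite[OF J lt \<epsilon>]
    obtain n where "sz_iter UNIV \<epsilon> (fin_ord n :: 'a ordinal) (fin_rball J \<eta>) = {}" ..
    then show "\<exists>\<sigma><omega_pow (1 + (0 :: 'a ordinal)). sz_iter UNIV \<epsilon> \<sigma> (fin_rball J \<eta>) = {}"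
      by (intro exI[of _ "fin_ord n"]) simp
  qed
next
  case (suc \<gamma>)
  then show ?case by (rule small_index_osuc)
next
  case (limit \<gamma>)
  show ?case
    unfolding small_index_def
  proof (intro allI impI)
    fix J :: "'a idx set" and \<eta> :: "'a ordinal" and \<epsilon> :: real
    assume J: "finite J" and \<eta>: "\<eta> < omega_pow (omega_pow \<gamma>)" and \<epsilon>: "0 < \<epsilon>"
    have "limit_ordinal (omega_pow \<gamma>)"
      using limit(1) by (intro limit_omega_pow) (auto simp: limit_ordinal_def)
    then obtain \<delta> where \<delta>: "\<delta> < omega_pow \<gamma>" "\<eta> < omega_pow \<delta>"
      using \<eta> by (auto simp: less_omega_pow_limit)
    then obtain \<gamma>' where \<gamma>': "\<gamma>' < \<gamma>" "\<delta> < omega_pow \<gamma>'"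
      using limit(1) by (auto simp: less_omega_pow_limit)
    then have "\<eta> < omega_pow (omega_pow \<gamma>')"
      using \<delta> by (meson less_trans omega_pow_less_iff(1))
    then obtain \<sigma> where "\<sigma> < omega_pow (1 + \<gamma>')" "sz_iter UNIV \<epsilon> \<sigma> (fin_rball J \<eta>) = {}"
      using limit(2)[OF \<gamma>'(1)] J \<epsilon> unfolding small_index_def by blast
    moreover have "omega_pow (1 + \<gamma>') < omega_pow (1 + \<gamma>)"
      using \<gamma>'(1) by simp
    ultimately show "\<exists>\<sigma><omega_pow (1 + \<gamma>). sz_iter UNIV \<epsilon> \<sigma> (fin_rball J \<eta>) = {}"
      by (meson less_trans)
  qed
qed

section \<open>Functionals on \<open>C([0,\<alpha>])\<close>\<close>

locale ordinal_interval =
  fixes \<alpha> :: "'a ordinal" and p :: "'k::topological_space \<Rightarrow> 'a ordinal" and r :: "'a ordinal \<Rightarrow> 'k"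
  assumes hom: "homeomorphism UNIV {..\<alpha>} p r" and \<alpha>_pos: "0 < \<alpha>"
begin

lemma p_le: "p t \<le> \<alpha>" and r_p: "r (p t) = t" and p_r: "x \<le> \<alpha> \<Longrightarrow> p (r x) = x"
  and cont_p: "continuous_on UNIV p" and cont_r: "continuous_on {..\<alpha>} r"
  using hom by (auto simp: homeomorphism_def)

text \<open>An initial segment \<open>{..x}\<close> is clopen, its complement being the closed set
  \<open>{osuc x..}\<close>.\<close>

lemma continuous_cut:
  fixes g :: "'k \<Rightarrow> real"
  assumes "continuous_on UNIV g"
  shows "continuous_on UNIV (\<lambda>t. if p t \<le> x then g t else c)"
proof -
  have "closed (p -` {..x})" "closed (p -` {osuc x..})"
    using cont_p by (auto intro: closed_vimage)
  moreover have "p -` {..x} \<union> p -` {osuc x..} = UNIV"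
    by (auto simp: osuc_le_iff)
  ultimately show ?thesis
    using continuous_on_cases[of "p -` {..x}" "p -` {osuc x..}" g "\<lambda>_. c" "\<lambda>t. p t \<le> x"]
      continuous_on_subset[OF assms]
    by (fastforce simp: osuc_le_iff)
qed

definition cut :: "('k \<Rightarrow>\<^sub>C real) \<Rightarrow> 'a ordinal \<Rightarrow> real \<Rightarrow> 'k \<Rightarrow>\<^sub>C real" where
  "cut g x c = Bcontfun (\<lambda>t. if p t \<le> x then apply_bcontfun g t else c)"

lemma apply_cut: "apply_bcontfun (cut g x c) t = (if p t \<le> x then apply_bcontfun g t else c)"
proof -
  have "bounded (range (apply_bcontfun g))"
    using apply_bcontfun[of g] by (simp add: bcontfun_def)
  then have "bounded (insert c (range (apply_bcontfun g)))"
    by simp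
  then have "bounded (range (\<lambda>t. if p t \<le> x then apply_bcontfun g t else c))"
    by (rule bounded_subset) auto
  moreover have "continuous_on UNIV (\<lambda>t. if p t \<le> x then apply_bcontfun g t else c)"
    using apply_bcontfun[of g] by (intro continuous_cut) (simp add: bcontfun_def)
  ultimately show ?thesis
    unfolding cut_def by (subst Bcontfun_inverse) (auto simp: bcontfun_def)
qed

definition ind :: "'a ordinal \<Rightarrow> 'k \<Rightarrow>\<^sub>C real" where
  "ind x = cut (const_bcontfun 1) x 0"

lemma apply_ind: "apply_bcontfun (ind x) t = (if p t \<le> x then 1 else 0)"
  by (simp add: ind_def apply_cut const_bcontfun.rep_eq)

text \<open>Subtracting \<open>ind 0\<close> makes \<open>theta\<close> vanish at 0, as
  \<open>rball\<close> demands. The index \<open>[(0, 0)]\<close> is an arbitrary second copy; there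
  the functions have a single jump, between 0 and all later points.\<close>

definition elt :: "'a idx \<Rightarrow> 'a ordinal \<Rightarrow> 'k \<Rightarrow>\<^sub>C real" where
  "elt u x = (if u = [] then ind (min x \<alpha>) - ind 0
     else if u = [(0, 0)] \<and> x \<noteq> 0 then ind 0 else 0)"

lemma apply_elt:
  "apply_bcontfun (elt u x) t =
     (if u = [] \<and> p t \<noteq> 0 \<and> p t \<le> x \<or> u = [(0, 0)] \<and> x \<noteq> 0 \<and> p t = 0 then 1 else 0)"
proof -
  have "p t \<le> min x \<alpha> \<longleftrightarrow> p t \<le> x" "p t \<le> 0 \<longleftrightarrow> p t = 0"
    using p_le[of t] by (auto simp: order.antisym)
  then show ?thesis
    by (auto simp: elt_def apply_ind minus_bcontfun.rep_eq zero_bcontfun.rep_eq)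
qed

definition theta :: "(('k \<Rightarrow>\<^sub>C real) \<Rightarrow>\<^sub>L real) \<Rightarrow> 'a idx \<Rightarrow> 'a ordinal \<Rightarrow> real" where
  "theta f u x = blinfun_apply f (elt u x)"

text \<open>The copy \<open>[(0, 0)]\<close> carries the value \<open>f(1\<^bsub>{0}\<^esub>)\<close>, which the variation of \<open>x \<mapsto> f(1\<^bsub>[0,x]\<^esub>)\<close> does not see.\<close>

definition idx_set :: "'a idx set" where
  "idx_set = {[], [(0, 0)]}"

lemma theta_zero: "theta f u 0 = 0"
  by (simp add: theta_def elt_def min.absorb1)

lemma theta_diff: "(\<lambda>u x. theta f u x - theta g u x) = theta (f - g)"
  by (simp add: theta_def fun_eq_iff blinfun.diff_left)

lemma trunc_theta: "trunc idx_set \<alpha> (theta f) = theta f"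
proof (intro ext)
  fix u x
  have "min x \<alpha> = 0 \<longleftrightarrow> x = 0"
    using \<alpha>_pos by (auto simp: min_def)
  then show "trunc idx_set \<alpha> (theta f) u x = theta f u x"
    by (auto simp: trunc_def theta_def elt_def idx_set_def)
qed

text \<open>Up to signs, the sum over a family is \<open>f\<close> applied to a sum of functions
  with values 0 and 1 and disjoint supports, whose norm is at most 1.\<close>

lemma var_le_theta: "var_le UNIV (theta f) (norm f)"
  unfolding var_le_def
proof (intro allI impI)
  fix Q :: "('a idx \<times> 'a ordinal \<times> 'a ordinal) list"
  assume Q: "nonov UNIV Q"
  define e where "e = (\<lambda>(u, x, y). elt u y - elt u x)"
  define G where "G = (\<Sum>q\<leftarrow>Q. sgn (blinfun_apply f (e q)) *\<^sub>R e q)"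
  have fG: "blinfun_apply f (\<Sum>q\<leftarrow>R. sgn (blinfun_apply f (e q)) *\<^sub>R e q) = (\<Sum>q\<leftarrow>R. \<bar>blinfun_apply f (e q)\<bar>)" for R
    by (induction R) (auto simp: blinfun.add_right blinfun.scaleR_right blinfun.zero_right abs_sgn mult.commute)
  have "qsum Q (theta f) = (\<Sum>q\<leftarrow>Q. \<bar>blinfun_apply f (e q)\<bar>)"
    unfolding qsum_def by (intro arg_cong[where f = sum_list] map_cong) (auto simp: e_def theta_def blinfun.diff_right)
  also have "\<dots> = blinfun_apply f G"
    by (simp add: G_def fG)
  also have "\<dots> \<le> norm f * norm G"
    using norm_blinfun[of f G] by simp
  also have "\<dots> \<le> norm f * 1"
  proof (intro mult_left_mono norm_bound)
    fix t
    \<comment> \<open>The support of \<open>e q\<close> contains \<open>t\<close>: the points after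
      \<open>x\<close> and up to \<open>y\<close> in the copy \<open>[]\<close>, the point 0 in the
      other copy. Non-overlapping intervals cannot both be hit.\<close>
    define hit where "hit = (\<lambda>(u :: 'a idx, x, y). u = [] \<and> x < p t \<and> p t \<le> y
      \<or> u = [(0, 0)] \<and> x = 0 \<and> y \<noteq> 0 \<and> p t = 0)"
    have e_hit: "\<bar>apply_bcontfun (e q) t\<bar> = (if hit q then 1 else 0)" if "q \<in> set Q" for q
    proof -
      obtain u x y where q: "q = (u, x, y)" by (cases q)
      have xy: "x \<le> y" using that Q by (auto simp: nonov_def q)
      have eq: "apply_bcontfun (e q) t = apply_bcontfun (elt u y) t - apply_bcontfun (elt u x) t"
        by (simp add: e_def q minus_bcontfun.rep_eq)
      consider "u = []" | "u = [(0, 0)]" | "u \<noteq> []" "u \<noteq> [(0, 0)]" by blast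
      then show ?thesis
      proof cases
        case 1
        have "p t \<noteq> 0" if "x < p t" using that by (metis not_less_zero_ordinal)
        moreover have "p t \<le> y" if "p t \<le> x" using that xy by (rule order_trans)
        ultimately show ?thesis
          unfolding eq using 1 by (simp add: apply_elt hit_def q not_le[symmetric])
      next
        case 2
        have "x = 0" if "y = 0" using that xy by (simp add: order.antisym)
        then show ?thesis
          unfolding eq using 2 by (simp add: apply_elt hit_def q)
      next
        case 3
        then show ?thesis
          unfolding eq by (simp add: apply_elt hit_def q)
      qed
    qed
    have "sorted_wrt (\<lambda>a b. \<not> (hit a \<and> hit b)) Q"
    proof (rule sorted_wrt_mono_rel)
      show "sorted_wrt (\<lambda>(u, x, y) (u', x', y'). u = u' \<longrightarrow> y \<le> x' \<or> y' \<le> x) Q"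
        using Q by (simp add: nonov_def)
      fix a b :: "'a idx \<times> 'a ordinal \<times> 'a ordinal"
      assume "(\<lambda>(u, x, y) (u', x', y'). u = u' \<longrightarrow> y \<le> x' \<or> y' \<le> x) a b"
      then show "\<not> (hit a \<and> hit b)"
        by (cases a, cases b) (auto simp: hit_def order.antisym not_le[symmetric] dest: order_trans)
    qed
    then have hits: "(\<Sum>q\<leftarrow>Q. if hit q then 1 else 0) \<le> (1 :: real)"
    proof (induction Q)
      case (Cons q Q)
      show ?case
      proof (cases "hit q")
        case True
        then have "(\<Sum>q\<leftarrow>Q. if hit q then 1 else (0 :: real)) = (\<Sum>q\<leftarrow>Q. 0)"
          using Cons.prems by (intro arg_cong[where f = sum_list] map_cong) auto
        then show ?thesis using True by simp
      qed (use Cons in simp)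
    qed simp
    have "\<bar>apply_bcontfun (\<Sum>q\<leftarrow>R. sgn (blinfun_apply f (e q)) *\<^sub>R e q) t\<bar> \<le> (\<Sum>q\<leftarrow>R. \<bar>apply_bcontfun (e q) t\<bar>)" for R
    proof (induction R)
      case (Cons q R)
      have "\<bar>sgn (blinfun_apply f (e q)) * apply_bcontfun (e q) t\<bar> \<le> \<bar>apply_bcontfun (e q) t\<bar>"
        by (simp add: abs_mult sgn_if)
      with Cons show ?case
        by (simp add: plus_bcontfun.rep_eq scaleR_bcontfun.rep_eq)
    qed (simp add: zero_bcontfun.rep_eq)
    also have "(\<Sum>q\<leftarrow>Q. \<bar>apply_bcontfun (e q) t\<bar>) = (\<Sum>q\<leftarrow>Q. if hit q then 1 else 0)"
      using e_hit by (intro arg_cong[where f = sum_list] map_cong) auto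
    finally show "norm (apply_bcontfun G t) \<le> 1"
      using hits by (simp add: G_def)
  qed auto
  finally show "qsum Q (theta f) \<le> norm f" by simp
qed

section \<open>Step functions and the converse norm estimate\<close>

lemma left_continuous:
  assumes "x \<le> \<alpha>" "0 < x" "0 < (\<delta> :: real)"
  shows "\<exists>y<x. \<forall>z. y < z \<longrightarrow> z \<le> x \<longrightarrow> \<bar>apply_bcontfun g (r z) - apply_bcontfun g (r x)\<bar> < \<delta>"
proof -
  have "continuous_on {..\<alpha>} (\<lambda>z. apply_bcontfun g (r z))"
    using continuous_on_compose[OF cont_r, of "apply_bcontfun g"] apply_bcontfun[of g]
    by (auto simp: bcontfun_def o_def intro: continuous_on_subset)
  then have "((\<lambda>z. apply_bcontfun g (r z)) \<longlongrightarrow> apply_bcontfun g (r x)) (at x within {..\<alpha>})"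
    using assms by (simp add: continuous_on_def)
  then have "\<forall>\<^sub>F z in at x within {..\<alpha>}. dist (apply_bcontfun g (r z)) (apply_bcontfun g (r x)) < \<delta>"
    using assms(3) by (rule tendstoD)
  then obtain S where S: "open S" "x \<in> S"
    "\<And>z. z \<in> S \<Longrightarrow> z \<noteq> x \<Longrightarrow> z \<le> \<alpha> \<Longrightarrow> dist (apply_bcontfun g (r z)) (apply_bcontfun g (r x)) < \<delta>"
    by (auto simp: eventually_at_topological)
  obtain y where y: "y < x" "{y<..x} \<subseteq> S"
    using open_left[OF S(1,2) assms(2)] by blast
  have "\<bar>apply_bcontfun g (r z) - apply_bcontfun g (r x)\<bar> < \<delta>" if "y < z" "z \<le> x" for z
  proof (cases "z = x")
    case False
    have "z \<in> S" "z \<le> \<alpha>" using that y(2) assms(1) by auto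
    then show ?thesis using S(3) False by (simp add: dist_real_def)
  qed (use assms(3) in simp)
  with y(1) show ?thesis by blast
qed

text \<open>By left continuity \<open>g\<close> is nearly constant on the points after some
  \<open>y < x\<close> and up to \<open>x\<close>; below \<open>y\<close> the induction hypothesis
  applies. Well-foundedness takes the place of compactness. The condition on the ends
  \<open>b\<close> keeps the new interval behind the old ones.\<close>

lemma step_approximation:
  assumes \<delta>: "0 < \<delta>" and "x \<le> \<alpha>"
  shows "\<exists>s Q. nonov UNIV Q \<and> (\<forall>(u, a, b)\<in>set Q. u = [] \<longrightarrow> b \<le> x)
    \<and> (\<forall>t. p t \<le> x \<longrightarrow> \<bar>apply_bcontfun g t - apply_bcontfun s t\<bar> \<le> \<delta>)
    \<and> (\<forall>t. x < p t \<longrightarrow> apply_bcontfun s t = 0)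
    \<and> \<bar>blinfun_apply f s\<bar> \<le> norm g * qsum Q (theta f)"
  using \<open>x \<le> \<alpha>\<close>
proof (induction x rule: less_induct)
  case (less x)
  have g_le: "\<bar>apply_bcontfun g t\<bar> \<le> norm g" for t
    using norm_bounded[of g t] by simp
  show ?case
  proof (cases "x = 0")
    case True
    define s where "s = apply_bcontfun g (r 0) *\<^sub>R ind 0"
    have "\<bar>apply_bcontfun g t - apply_bcontfun s t\<bar> \<le> \<delta>" if "p t \<le> 0" for t
    proof -
      have "p t = 0" using that by (simp add: order.antisym)
      then have "r 0 = t" using r_p by metis
      then show ?thesis
        using \<delta> that by (simp add: s_def scaleR_bcontfun.rep_eq apply_ind)
    qed
    moreover have "apply_bcontfun s t = 0" if "0 < p t" for t
      using that by (simp add: s_def scaleR_bcontfun.rep_eq apply_ind)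
    \<comment> \<open>The mass at the point 0 is paid for by an interval of the second copy.\<close>
    moreover have "\<bar>blinfun_apply f s\<bar> \<le> norm g * qsum [([(0, 0)], 0, 1)] (theta f)"
      using g_le[of "r 0"]
      by (simp add: s_def blinfun.scaleR_right abs_mult qsum_def theta_def elt_def one_ordinal_def
          blinfun.zero_right mult_right_mono)
    moreover have "nonov UNIV [([(0, 0)] :: 'a idx, 0, 1 :: 'a ordinal)]"
      by (simp add: nonov_def)
    ultimately show ?thesis
      using True by (intro exI[of _ s] exI[of _ "[([(0, 0)], 0, 1)]"]) auto
  next
    case False
    then have x: "0 < x" by (simp add: ordinal_gt_zero)
    obtain y where y: "y < x"
      "\<And>z. y < z \<Longrightarrow> z \<le> x \<Longrightarrow> \<bar>apply_bcontfun g (r z) - apply_bcontfun g (r x)\<bar> < \<delta>"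
      using left_continuous[OF less.prems x \<delta>] by blast
    obtain s Q where IH: "nonov UNIV Q" "\<forall>(u, a, b)\<in>set Q. u = [] \<longrightarrow> b \<le> y"
      "\<And>t. p t \<le> y \<Longrightarrow> \<bar>apply_bcontfun g t - apply_bcontfun s t\<bar> \<le> \<delta>"
      "\<And>t. y < p t \<Longrightarrow> apply_bcontfun s t = 0"
      "\<bar>blinfun_apply f s\<bar> \<le> norm g * qsum Q (theta f)"
      using less.IH[OF y(1)] y(1) less.prems by fastforce
    define s' where "s' = s + apply_bcontfun g (r x) *\<^sub>R (ind x - ind y)"
    have s': "apply_bcontfun s' t = apply_bcontfun s t
        + apply_bcontfun g (r x) * (if y < p t \<and> p t \<le> x then 1 else 0)" for t
      using y(1) by (auto simp: s'_def plus_bcontfun.rep_eq scaleR_bcontfun.rep_eq minus_bcontfun.rep_eq apply_ind)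
    have "nonov UNIV (([], y, x) # Q)"
      using IH(1,2) y(1) by (auto simp: nonov_def)
    moreover have "\<forall>(u, a, b)\<in>set (([], y, x) # Q). u = [] \<longrightarrow> b \<le> x"
      using IH(2) y(1) by fastforce
    moreover have "\<bar>apply_bcontfun g t - apply_bcontfun s' t\<bar> \<le> \<delta>" if t: "p t \<le> x" for t
    proof (cases "p t \<le> y")
      case True
      then show ?thesis using IH(3) by (simp add: s' leD)
    next
      case False
      then have "p t \<noteq> x \<Longrightarrow> \<bar>apply_bcontfun g t - apply_bcontfun g (r x)\<bar> < \<delta>"
        using y(2)[of "p t"] t by (simp add: r_p)
      moreover have "p t = x \<Longrightarrow> r x = t"
        using r_p by blast
      ultimately show ?thesis
        using False t IH(4)[of t] \<delta> by (cases "p t = x") (auto simp: s')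
    qed
    moreover have "apply_bcontfun s' t = 0" if "x < p t" for t
    proof -
      have "\<not> p t \<le> x" "y < p t" using that y(1) by (auto intro: less_trans)
      then show ?thesis using IH(4) by (simp add: s')
    qed
    moreover have "\<bar>blinfun_apply f s'\<bar> \<le> norm g * qsum (([], y, x) # Q) (theta f)"
    proof -
      have d: "theta f [] x - theta f [] y = blinfun_apply f (ind x - ind y)"
        using less.prems y(1) by (simp add: theta_def elt_def blinfun.diff_right min.absorb1)
      have "\<bar>blinfun_apply f s'\<bar> \<le> \<bar>blinfun_apply f s\<bar> + \<bar>apply_bcontfun g (r x)\<bar> * \<bar>blinfun_apply f (ind x - ind y)\<bar>"
        by (simp add: s'_def blinfun.add_right blinfun.scaleR_right flip: abs_mult)
      also have "\<dots> \<le> norm g * qsum Q (theta f) + norm g * \<bar>blinfun_apply f (ind x - ind y)\<bar>"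
        using IH(5) g_le by (intro add_mono mult_right_mono) auto
      finally show ?thesis
        by (simp add: qsum_Cons d algebra_simps)
    qed
    ultimately show ?thesis
      by (intro exI[of _ s'] exI[of _ "([], y, x) # Q"]) blast
  qed
qed

lemma norm_le_tvar_theta: "norm f \<le> tvar UNIV (theta f)"
proof (rule norm_blinfun_bound)
  show V0: "0 \<le> tvar UNIV (theta f)"
    using tvar_nonneg[OF var_le_theta] .
  fix g :: "'k \<Rightarrow>\<^sub>C real"
  show "norm (blinfun_apply f g) \<le> tvar UNIV (theta f) * norm g"
  proof (rule field_le_epsilon)
    fix e :: real
    assume e: "0 < e"
    \<comment> \<open>The added 1 allows for \<open>f = 0\<close>.\<close>
    define \<delta> where "\<delta> = e / (norm f + 1)"
    have \<delta>: "0 < \<delta>" using e by (simp add: \<delta>_def add_nonneg_pos)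
    obtain s Q where s: "nonov UNIV Q"
      "\<And>t. p t \<le> \<alpha> \<Longrightarrow> \<bar>apply_bcontfun g t - apply_bcontfun s t\<bar> \<le> \<delta>"
      "\<bar>blinfun_apply f s\<bar> \<le> norm g * qsum Q (theta f)"
      using step_approximation[OF \<delta> order_refl, of g f] by blast
    have "norm (g - s) \<le> \<delta>"
      using s(2) p_le by (intro norm_bound) (simp add: minus_bcontfun.rep_eq)
    then have "\<bar>blinfun_apply f (g - s)\<bar> \<le> norm f * \<delta>"
      using norm_blinfun[of f "g - s"] mult_left_mono[of "norm (g - s)" \<delta> "norm f"] by simp
    also have "\<dots> \<le> e"
    proof -
      have "norm f * \<delta> \<le> (norm f + 1) * \<delta>" using \<delta> by simp
      also have "\<dots> = e" using norm_ge_zero[of f] by (simp add: \<delta>_def add_nonneg_eq_0_iff)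
      finally show ?thesis .
    qed
    finally have "\<bar>blinfun_apply f g\<bar> \<le> \<bar>blinfun_apply f s\<bar> + e"
      by (simp add: blinfun.diff_right)
    also have "\<dots> \<le> norm g * tvar UNIV (theta f) + e"
      using s(3) mult_left_mono[OF qsum_le_tvar[OF var_le_theta s(1), of f] norm_ge_zero[of g]] by simp
    finally show "norm (blinfun_apply f g) \<le> tvar UNIV (theta f) * norm g + e"
      by (simp add: mult.commute)
  qed
qed

end

section \<open>From dentability to periodic functions\<close>

lemma dent_deriv_subset: "dent_deriv \<epsilon> B \<subseteq> B"
  by (auto simp: dent_deriv_def)

text \<open>If all points of the slice were within \<open>\<epsilon> / 4\<close> of
  \<open>f\<close>, its diameter would be at most \<open>\<epsilon> / 2\<close>.\<close>

lemma dent_deriv_slice: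
  assumes f: "f \<in> dent_deriv \<epsilon> A" and "t < blinfun_apply f x" and "0 < \<epsilon>"
  shows "\<exists>y\<in>A. t < blinfun_apply y x \<and> \<epsilon> / 4 < norm (y - f)"
proof (rule ccontr)
  assume "\<not> ?thesis"
  then have le: "norm (y - f) \<le> \<epsilon> / 4" if "y \<in> A \<inter> halfspace x t" for y
    using that by (auto simp: halfspace_def not_less)
  have "diameter (A \<inter> halfspace x t) \<le> \<epsilon> / 2"
  proof (rule diameter_le)
    fix y z assume yz: "y \<in> A \<inter> halfspace x t" "z \<in> A \<inter> halfspace x t"
    have "norm (y - z) \<le> norm (y - f) + norm (z - f)"
      using norm_triangle_ineq4[of "y - f" "z - f"] by simp
    then show "norm (y - z) \<le> \<epsilon> / 2"
      using le[OF yz(1)] le[OF yz(2)] by simp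
  qed (use assms in auto)
  moreover have "\<epsilon> < diameter (A \<inter> halfspace x t)"
    using f assms(2) by (auto simp: dent_deriv_def halfspace_def)
  ultimately show False
    using assms(3) by simp
qed

text \<open>Choosing each \<open>y m\<close> in a slice that points away from the accumulated error keeps the
  squared error of the sums linear in \<open>m\<close>, so the means converge without any separation argument.\<close>

lemma dent_deriv_means:
  fixes A :: "('x::real_normed_vector \<Rightarrow>\<^sub>L real) set"
  assumes f: "f \<in> dent_deriv \<epsilon> A" and A: "A \<subseteq> cball 0 1" and \<epsilon>: "0 < \<epsilon>"
  shows "\<exists>y. (\<forall>m. y m \<in> A \<and> \<epsilon> / 4 < norm (y m - f)) \<and>
    (\<forall>m. (\<Sum>e\<in>E. (\<Sum>c<m. blinfun_apply (y c) e - blinfun_apply f e)\<^sup>2) \<le> real m * (1 + (\<Sum>e\<in>E. (2 * norm e)\<^sup>2)))"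
proof -
  define K where "K = (\<Sum>e\<in>E. (2 * norm e)\<^sup>2)"
  have "\<exists>y\<in>A. (\<Sum>e\<in>E. blinfun_apply D e * blinfun_apply (y - f) e) < 1 / 2 \<and> \<epsilon> / 4 < norm (y - f)" for D
  proof -
    \<comment> \<open>The slice is taken against the accumulated error \<open>D\<close>, so the
      cross term in the next squared error is less than 1. This is the 1 in the bound
      \<open>1 + K\<close> per step.\<close>
    define x where "x = - (\<Sum>e\<in>E. blinfun_apply D e *\<^sub>R e)"
    have x: "blinfun_apply g x = - (\<Sum>e\<in>E. blinfun_apply D e * blinfun_apply g e)" for g
      by (simp add: x_def blinfun.minus_right blinfun.sum_right blinfun.scaleR_right)
    obtain y where "y \<in> A" "blinfun_apply f x - 1 / 2 < blinfun_apply y x" "\<epsilon> / 4 < norm (y - f)"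
      using dent_deriv_slice[OF f _ \<epsilon>, of "blinfun_apply f x - 1 / 2" x] by auto
    moreover from this(2) have "(\<Sum>e\<in>E. blinfun_apply D e * blinfun_apply (y - f) e) < 1 / 2"
      using x[of "y - f"] by (simp add: blinfun.diff_left)
    ultimately show ?thesis by blast
  qed
  then obtain Y where Y: "\<And>D. Y D \<in> A" "\<And>D. \<epsilon> / 4 < norm (Y D - f)"
    "\<And>D. (\<Sum>e\<in>E. blinfun_apply D e * blinfun_apply (Y D - f) e) < 1 / 2"
    by metis
  define D where "D = rec_nat 0 (\<lambda>_ D. D + (Y D - f))"
  have D: "D 0 = 0" "D (Suc m) = D m + (Y (D m) - f)" for m
    by (simp_all add: D_def)
  have sum: "blinfun_apply (D m) e = (\<Sum>c<m. blinfun_apply (Y (D c)) e - blinfun_apply f e)" for m e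
    by (induction m) (simp_all add: D blinfun.add_left blinfun.diff_left)
  have "(\<Sum>e\<in>E. (blinfun_apply (D m) e)\<^sup>2) \<le> real m * (1 + K)" for m
  proof (induction m)
    case (Suc m)
    let ?d = "Y (D m) - f"
    have "norm ?d \<le> 2"
    proof -
      have "Y (D m) \<in> cball 0 1" "f \<in> cball 0 1"
        using Y(1) A f dent_deriv_subset by blast+
      then show ?thesis
        using norm_triangle_ineq4[of "Y (D m)" f] by simp
    qed
    then have d: "(blinfun_apply ?d e)\<^sup>2 \<le> (2 * norm e)\<^sup>2" for e
    proof -
      have "\<bar>blinfun_apply ?d e\<bar> \<le> \<bar>2 * norm e\<bar>"
        using norm_blinfun[of ?d e] mult_right_mono[OF \<open>norm ?d \<le> 2\<close> norm_ge_zero[of e]] by simp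
      then show ?thesis by (simp only: abs_le_square_iff)
    qed
    have "(\<Sum>e\<in>E. (blinfun_apply (D (Suc m)) e)\<^sup>2) = (\<Sum>e\<in>E. (blinfun_apply (D m) e)\<^sup>2)
        + 2 * (\<Sum>e\<in>E. blinfun_apply (D m) e * blinfun_apply ?d e) + (\<Sum>e\<in>E. (blinfun_apply ?d e)\<^sup>2)"
      unfolding D blinfun.add_left power2_sum sum.distrib sum_distrib_left by (simp add: ac_simps)
    also have "\<dots> \<le> m * (1 + K) + 1 + K"
    proof -
      have "(\<Sum>e\<in>E. (blinfun_apply ?d e)\<^sup>2) \<le> K"
        unfolding K_def by (intro sum_mono d)
      then show ?thesis
        using Suc Y(3)[of "D m"] by linarith
    qed
    finally show ?case by (simp add: algebra_simps)
  qed (simp add: D)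
  then show ?thesis
    using Y(1,2) by (intro exI[of _ "\<lambda>m. Y (D m)"]) (simp add: sum K_def)
qed

lemma sum_lessThan_mult:
  fixes a :: "nat \<Rightarrow> real"
  shows "(\<Sum>i<q * m. a i) = (\<Sum>s<m. \<Sum>r<q. a (q * s + r))"
proof (induction m)
  case (Suc m)
  then show ?case
    using sum_lessThan_plus[of a "q * m" q] by (simp add: add.commute)
qed simp

lemma finite_common_per:
  assumes "finite T" "\<And>c. c \<in> T \<Longrightarrow> periodic c" "periodic F"
  shows "\<exists>q. per q F \<and> (\<forall>c\<in>T. per q c)"
  using assms
proof (induction T rule: finite_induct)
  case (insert c T)
  then obtain q where q: "per q F" "\<forall>c\<in>T. per q c" by auto
  obtain q' where q': "per q' c" using insert.prems by (auto simp: periodic_def)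
  have "per (q * q') F" "\<forall>c\<in>T. per (q * q') c" "per (q * q') c"
  proof -
    have "0 < q" "0 < q'" using q q' by (auto simp: per_def)
    then show "per (q * q') F" "\<forall>c\<in>T. per (q * q') c" "per (q * q') c"
      using q per_mult[OF _ \<open>0 < q'\<close>, of q] per_mult[OF q' \<open>0 < q\<close>] by (auto simp: mult.commute)
  qed
  then show ?case by blast
qed (auto simp: periodic_def)

section \<open>Oscillating sequences and the lift to random functions\<close>

context ordinal_interval
begin

lemma theta_in_fin_rball:
  assumes "periodic F" and "\<And>i. norm (F i) \<le> 1"
  shows "(\<lambda>i. theta (F i)) \<in> fin_rball idx_set \<alpha>"
proof -
  have "periodic (\<lambda>i. theta (F i))"
    by (rule periodic_via[OF assms(1)]) simp
  moreover have "var_le UNIV (theta (F i)) 1" for i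
    using var_le_theta order_refl assms(2) by (rule var_le_mono)
  ultimately show ?thesis
    by (simp add: fin_rball_def rball_def rtrunc_def theta_zero trunc_theta)
qed

text \<open>Let \<open>q\<close> be a common period of \<open>F\<close> and the weights. In the
  \<open>s\<close>-th repetition of that period \<open>F i\<close> is replaced by the
  \<open>s\<close>-th of \<open>m\<close> points whose mean is close to \<open>F i\<close>. A weight
  of period \<open>q\<close> does not distinguish the repetitions, so it sees only the means,
  although every value of \<open>G\<close> is far from that of \<open>F\<close>.\<close>

lemma dent_deriv_frequently:
  fixes X :: "(('k \<Rightarrow>\<^sub>C real) \<Rightarrow>\<^sub>L real) set"
  assumes X: "X \<subseteq> cball 0 1" and \<epsilon>: "0 < \<epsilon>" and F: "periodic F" "\<And>i. F i \<in> dent_deriv \<epsilon> X"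
    and P: "eventually P (nhd (\<lambda>i. theta (F i)))"
  shows "\<exists>G. periodic G \<and> (\<forall>i. G i \<in> X \<and> \<epsilon> / 4 < norm (G i - F i)) \<and> P (\<lambda>i. theta (G i))"
proof -
  obtain T e where T: "finite T" "\<And>c u x. (c, u, x) \<in> T \<Longrightarrow> periodic c" and e: "0 < e"
    and PT: "\<And>g. periodic g \<Longrightarrow> (\<And>c u x. (c, u, x) \<in> T \<Longrightarrow>
       \<bar>avg (\<lambda>i. c i * g i u x) - avg (\<lambda>i. c i * theta (F i) u x)\<bar> < e) \<Longrightarrow> P g"
    using eventually_nhdE[OF P] by blast
  obtain q where q: "per q F" "\<And>c u x. (c, u, x) \<in> T \<Longrightarrow> per q c"
    using finite_common_per[of "fst ` T" F] T F(1) by force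
  have q0: "0 < q" using q(1) by (simp add: per_def)
  define E where "E = (\<lambda>(c :: nat \<Rightarrow> real, u, x). elt u x) ` T"
  have E: "finite E" using T(1) by (simp add: E_def)
  define K where "K = 1 + (\<Sum>e\<in>E. (2 * norm e)\<^sup>2)"
  have K: "0 < K" unfolding K_def by (intro add_pos_nonneg sum_nonneg) auto
  define C where "C = 1 + (\<Sum>t\<in>T. \<Sum>i<q. \<bar>fst t i\<bar>)"
  have C_pos: "0 < C" unfolding C_def by (intro add_pos_nonneg sum_nonneg) auto
  have C: "(\<Sum>i<q. \<bar>c i\<bar>) < C" if "(c, u, x) \<in> T" for c u x
  proof -
    have "(\<Sum>i<q. \<bar>fst (c, u, x) i\<bar>) \<le> (\<Sum>t\<in>T. \<Sum>i<q. \<bar>fst t i\<bar>)"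
      using that T(1) by (intro member_le_sum[where f = "\<lambda>t. \<Sum>i<q. \<bar>fst t i\<bar>"] sum_nonneg) auto
    then show ?thesis by (simp add: C_def)
  qed
  have "\<forall>f\<in>dent_deriv \<epsilon> X. \<exists>y. (\<forall>m. y m \<in> X \<and> \<epsilon> / 4 < norm (y m - f)) \<and>
    (\<forall>m. (\<Sum>e\<in>E. (\<Sum>c<m. blinfun_apply (y c) e - blinfun_apply f e)\<^sup>2) \<le> real m * K)"
    unfolding K_def by (intro ballI dent_deriv_means[OF _ X \<epsilon>])
  \<comment> \<open>The points depend on the value \<open>F i\<close> and not on the index
    \<open>i\<close>, so that \<open>G\<close> becomes periodic.\<close>
  from bchoice[OF this] obtain Y where Y: "\<And>f m. f \<in> dent_deriv \<epsilon> X \<Longrightarrow> Y f m \<in> X \<and> \<epsilon> / 4 < norm (Y f m - f)"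
    "\<And>f m. f \<in> dent_deriv \<epsilon> X \<Longrightarrow>
      (\<Sum>e\<in>E. (\<Sum>c<m. blinfun_apply (Y f c) e - blinfun_apply f e)\<^sup>2) \<le> real m * K"
    by auto
  \<comment> \<open>The squared error of a sum of \<open>m\<close> terms is at most
    \<open>m * K\<close>, so the mean errs by at most \<open>e / C\<close> once \<open>m\<close> is
    this large. The constant \<open>C\<close> exceeds the total weight of each test over a
    period.\<close>
  obtain m :: nat where m: "K / (e / C)\<^sup>2 < m"
    using reals_Archimedean2 by blast
  have m0: "0 < m"
    using order_le_less_trans[OF _ m, of 0] K by (simp add: zero_le_divide_iff)
  have small: "\<bar>\<Sum>s<m. blinfun_apply (Y f s) x - blinfun_apply f x\<bar> \<le> m * (e / C)"
    if f: "f \<in> dent_deriv \<epsilon> X" and x: "x \<in> E" for f x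
  proof -
    have "(\<Sum>s<m. blinfun_apply (Y f s) x - blinfun_apply f x)\<^sup>2
        \<le> (\<Sum>e\<in>E. (\<Sum>c<m. blinfun_apply (Y f c) e - blinfun_apply f e)\<^sup>2)"
      using x E by (intro member_le_sum[where f = "\<lambda>x. (\<Sum>s<m. blinfun_apply (Y f s) x - blinfun_apply f x)\<^sup>2"]) auto
    also have "\<dots> \<le> m * K" using Y(2)[OF f] .
    also have "\<dots> \<le> m * (m * (e / C)\<^sup>2)"
      using m e C_pos by (intro mult_left_mono) (simp_all add: divide_less_eq)
    also have "\<dots> = (m * (e / C))\<^sup>2"
      by (simp add: power2_eq_square)
    finally have "\<bar>\<Sum>s<m. blinfun_apply (Y f s) x - blinfun_apply f x\<bar> \<le> \<bar>m * (e / C)\<bar>"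
      by (simp only: abs_le_square_iff)
    then show ?thesis
      using e C_pos by simp
  qed
  define G where "G = (\<lambda>i. Y (F i) ((i div q) mod m))"
  have F_mod: "F (q * s + i) = F i" for s i
    using per_add_mult[OF q(1), of i s] by (simp add: add.commute)
  have pG: "per (q * m) G"
    unfolding per_def
  proof (intro conjI allI)
    show "0 < q * m" using q0 m0 by simp
    fix i
    have "(i + q * m) div q = i div q + m" using q0 by simp
    then show "G (i + q * m) = G i"
      using per_add_mult[OF q(1), of i m] by (simp add: G_def)
  qed
  have G: "G i \<in> X" "\<epsilon> / 4 < norm (G i - F i)" for i
    using Y(1)[OF F(2)] by (simp_all add: G_def)
  have "P (\<lambda>i. theta (G i))"
  proof (rule PT)
    show "periodic (\<lambda>i. theta (G i))"
      by (rule periodic_via[OF periodicI[OF pG]]) simp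
    fix c u x assume t: "(c, u, x) \<in> T"
    let ?v = "elt u x"
    have v: "?v \<in> E" using t by (force simp: E_def)
    have c: "per q c" "per (q * m) c"
      using q(2)[OF t] per_mult m0 by blast+
    have c_mod: "c (q * s + i) = c i" for s i
      using per_add_mult[OF c(1), of i s] by (simp add: add.commute)
    have pd: "per (q * m) (\<lambda>i. c i * blinfun_apply (G i - F i) ?v)"
      using pG c(2) per_mult[OF q(1) m0] unfolding per_def by simp
    have p1: "periodic (\<lambda>i. c i * theta (G i) u x)" "periodic (\<lambda>i. c i * theta (F i) u x)"
      by (rule periodic_via2[OF periodicI[OF c(2)] periodicI[OF pG]]
          periodic_via2[OF periodicI[OF c(2)] F(1)]; simp)+
    have "avg (\<lambda>i. c i * theta (G i) u x) - avg (\<lambda>i. c i * theta (F i) u x)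
        = avg (\<lambda>i. c i * blinfun_apply (G i - F i) ?v)"
      by (simp add: theta_def blinfun.diff_left right_diff_distrib flip: avg_diff[OF p1, unfolded theta_def])
    also have "\<dots> = (\<Sum>i<q * m. c i * blinfun_apply (G i - F i) ?v) / (q * m)"
      using avg_eq[OF pd] by simp
    also have "(\<Sum>i<q * m. c i * blinfun_apply (G i - F i) ?v)
      = (\<Sum>i<q. c i * (\<Sum>s<m. blinfun_apply (Y (F i) s) ?v - blinfun_apply (F i) ?v))"
      unfolding sum_lessThan_mult
      by (subst sum.swap) (auto simp: sum_distrib_left G_def F_mod c_mod blinfun.diff_left intro!: sum.cong)
    finally have eq: "avg (\<lambda>i. c i * theta (G i) u x) - avg (\<lambda>i. c i * theta (F i) u x)
      = (\<Sum>i<q. c i * (\<Sum>s<m. blinfun_apply (Y (F i) s) ?v - blinfun_apply (F i) ?v)) / (q * m)" .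
    have "\<bar>\<Sum>i<q. c i * (\<Sum>s<m. blinfun_apply (Y (F i) s) ?v - blinfun_apply (F i) ?v)\<bar>
      \<le> (\<Sum>i<q. \<bar>c i\<bar> * (m * (e / C)))"
      unfolding abs_mult[symmetric]
      by (intro sum_abs[THEN order_trans] sum_mono) (simp only: abs_mult mult_left_mono[OF small[OF F(2) v] abs_ge_zero])
    also have "\<dots> = (\<Sum>i<q. \<bar>c i\<bar>) * (m * (e / C))"
      by (rule sum_distrib_right[symmetric])
    also have "\<dots> < C * (m * (e / C))"
      using C[OF t] m0 e C_pos by (intro mult_strict_right_mono) auto
    also have "\<dots> = m * e"
      using C_pos by simp
    also have "\<dots> \<le> (q * m) * e"
      using q0 e mult_right_mono[of 1 "real q" "real m * e"] by (simp add: mult.assoc)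
    finally show "\<bar>avg (\<lambda>i. c i * theta (G i) u x) - avg (\<lambda>i. c i * theta (F i) u x)\<bar> < e"
      unfolding eq using q0 m0 by (simp add: abs_divide divide_less_eq mult.commute)
  qed
  then show ?thesis
    using G periodicI[OF pG] by blast
qed

text \<open>Constant sequences alone would not carry the induction, since approximating them already
  requires oscillating ones. The relation therefore speaks of all periodic sequences with values in
  the derived set.\<close>

lemma dent_iter_imp_sz_iter:
  fixes \<beta> :: "'a ordinal"
  assumes \<epsilon>: "0 < \<epsilon>" and F: "periodic F" "\<And>i. F i \<in> dent_deriv_iter \<epsilon> \<beta> (cball 0 1)"
  shows "(\<lambda>i. theta (F i)) \<in> sz_iter UNIV (\<epsilon> / 4) \<beta> (fin_rball idx_set \<alpha>)"
proof -
  define Rel where "Rel = (\<lambda>X Y. \<forall>F. periodic F \<longrightarrow> (\<forall>i. F i \<in> X) \<longrightarrow> (\<lambda>i. theta (F i)) \<in> Y)"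
  have "Rel (ord_rec (cball 0 1) (dent_deriv \<epsilon>) Inter \<beta>)
    (ord_rec (fin_rball idx_set \<alpha>) (sz_deriv UNIV (\<epsilon> / 4)) Inter \<beta>)"
  proof (rule iter_rel)
    show "Rel (cball 0 1) (fin_rball idx_set \<alpha>)"
      unfolding Rel_def by (intro allI impI theta_in_fin_rball) auto
  next
    fix X :: "(('k \<Rightarrow>\<^sub>C real) \<Rightarrow>\<^sub>L real) set" and Y
    assume X: "X \<subseteq> cball 0 1" and rel: "Rel X Y"
    have "(\<lambda>i. theta (F i)) \<in> sz_deriv UNIV (\<epsilon> / 4) Y" if F: "periodic F" "\<And>i. F i \<in> dent_deriv \<epsilon> X" for F
      unfolding sz_deriv_def mem_Collect_eq
    proof
      show "(\<lambda>i. theta (F i)) \<in> Y"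
        using rel F dent_deriv_subset unfolding Rel_def by blast
      show "\<exists>\<^sub>F g in nhd (\<lambda>i. theta (F i)). g \<in> Y \<and> \<epsilon> / 4 < rdist UNIV (\<lambda>i. theta (F i)) g"
        unfolding frequently_def
      proof
        assume "\<forall>\<^sub>F g in nhd (\<lambda>i. theta (F i)). \<not> (g \<in> Y \<and> \<epsilon> / 4 < rdist UNIV (\<lambda>i. theta (F i)) g)"
        from dent_deriv_frequently[OF X \<epsilon> F this]
        obtain G where G: "periodic G" "\<And>i. G i \<in> X" "\<And>i. \<epsilon> / 4 < norm (G i - F i)"
          "\<not> ((\<lambda>i. theta (G i)) \<in> Y \<and> \<epsilon> / 4 < rdist UNIV (\<lambda>i. theta (F i)) (\<lambda>i. theta (G i)))"
          by blast
        have "(\<lambda>i. theta (G i)) \<in> Y"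
          using rel G(1,2) unfolding Rel_def by blast
        moreover have "avg (\<lambda>_. \<epsilon> / 4) < rdist UNIV (\<lambda>i. theta (F i)) (\<lambda>i. theta (G i))"
          unfolding rdist_def theta_diff
        proof (rule avg_strict_mono)
          show "periodic (\<lambda>i. tvar UNIV (theta (F i - G i)))"
            by (rule periodic_via2[OF F(1) G(1)]) simp
          show "\<epsilon> / 4 < tvar UNIV (theta (F i - G i))" for i
            using norm_le_tvar_theta[of "F i - G i"] G(3)[of i] by (simp add: norm_minus_commute)
        qed simp
        ultimately show False using G(4) by simp
      qed
    qed
    then show "Rel (dent_deriv \<epsilon> X) (sz_deriv UNIV (\<epsilon> / 4) Y)"
      by (simp add: Rel_def)
  next
    fix I :: "'a ordinal set" and X Y
    assume "\<And>i. i \<in> I \<Longrightarrow> Rel (X i) (Y i)"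
    then show "Rel (\<Inter>i\<in>I. X i) (\<Inter>i\<in>I. Y i)"
      unfolding Rel_def by blast
  qed (rule dent_deriv_subset sz_deriv_subset)+
  then show ?thesis
    using F unfolding Rel_def sz_iter_def dent_deriv_iter_def by blast
qed

lemma dent_iter_empty:
  assumes \<alpha>: "\<alpha> < omega_pow (omega_pow \<gamma>)" and \<epsilon>: "0 < \<epsilon>"
  shows "\<exists>\<sigma> < omega_pow (1 + \<gamma>). dent_deriv_iter \<epsilon> \<sigma> (cball 0 1 :: (('k \<Rightarrow>\<^sub>C real) \<Rightarrow>\<^sub>L real) set) = {}"
proof -
  have "finite idx_set" by (simp add: idx_set_def)
  then obtain \<sigma> where \<sigma>: "\<sigma> < omega_pow (1 + \<gamma>)" "sz_iter UNIV (\<epsilon> / 4) \<sigma> (fin_rball idx_set \<alpha>) = {}"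
    using small_index[of \<gamma>] \<alpha> \<epsilon> unfolding small_index_def by (metis zero_less_divide_iff zero_less_numeral)
  have "f \<notin> dent_deriv_iter \<epsilon> \<sigma> (cball 0 1)" for f :: "('k \<Rightarrow>\<^sub>C real) \<Rightarrow>\<^sub>L real"
    using dent_iter_imp_sz_iter[OF \<epsilon>, of "\<lambda>_. f" \<sigma>] \<sigma>(2) by auto
  with \<sigma>(1) show ?thesis by blast
qed

end

section \<open>The lower bound\<close>

lemma dent_deriv_iff:
  assumes A: "A \<subseteq> cball 0 1" and \<epsilon>: "0 < \<epsilon>"
  shows "f \<in> dent_deriv \<epsilon> A \<longleftrightarrow> f \<in> A \<and> (\<forall>x t. t < blinfun_apply f x \<longrightarrow>
    (\<exists>y\<in>A. \<exists>z\<in>A. t < blinfun_apply y x \<and> t < blinfun_apply z x \<and> \<epsilon> < norm (y - z)))"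
proof -
  have "\<epsilon> < diameter S \<longleftrightarrow> (\<exists>y\<in>S. \<exists>z\<in>S. \<epsilon> < norm (y - z))"
    if "S \<subseteq> A" for S
  proof
    have bd: "bounded S"
      by (rule bounded_subset[OF bounded_subset[OF bounded_cball A] that])
    show "\<epsilon> < diameter S \<Longrightarrow> \<exists>y\<in>S. \<exists>z\<in>S. \<epsilon> < norm (y - z)"
      using diameter_lower_bounded[OF bd \<epsilon>] by (simp add: dist_norm)
    show "\<exists>y\<in>S. \<exists>z\<in>S. \<epsilon> < norm (y - z) \<Longrightarrow> \<epsilon> < diameter S"
      using diameter_bounded_bound[OF bd] by (fastforce simp: dist_norm)
  qed
  then have "\<epsilon> < diameter (A \<inter> halfspace x t) \<longleftrightarrow>
      (\<exists>y\<in>A \<inter> halfspace x t. \<exists>z\<in>A \<inter> halfspace x t. \<epsilon> < norm (y - z))" for x t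
    by blast
  then have diam: "\<epsilon> < diameter (A \<inter> halfspace x t) \<longleftrightarrow>
      (\<exists>y\<in>A. \<exists>z\<in>A. t < blinfun_apply y x \<and> t < blinfun_apply z x \<and> \<epsilon> < norm (y - z))" for x t
    unfolding halfspace_def by blast
  show ?thesis
    unfolding dent_deriv_def diam by (simp add: halfspace_def)
qed

section \<open>Iterated dentability derivation and its homogeneity\<close>

lemma dent_iter_subset: "dent_deriv_iter \<epsilon> \<beta> A \<subseteq> A"
  unfolding dent_deriv_iter_def by (rule iter_subset) (rule dent_deriv_subset)

lemma dent_iter_antimono: "\<beta> \<le> \<gamma> \<Longrightarrow> dent_deriv_iter \<epsilon> \<gamma> A \<subseteq> dent_deriv_iter \<epsilon> \<beta> A"
  unfolding dent_deriv_iter_def by (rule iter_antimono) (rule dent_deriv_subset)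

lemma dent_iter_plus:
  "dent_deriv_iter \<epsilon> (\<beta> + \<gamma>) A = dent_deriv_iter \<epsilon> \<gamma> (dent_deriv_iter \<epsilon> \<beta> A)"
  unfolding dent_deriv_iter_def by (rule iter_plus) (rule dent_deriv_subset)

text \<open>The map from \<open>f\<close> to the midpoint of \<open>a\<close> and \<open>f\<close>
  pulls slices back to slices and halves distances. The target \<open>A'\<close> need only contain
  the image of the ball; below it is also taken to be a derived set.\<close>

lemma dent_iter_midpoint:
  fixes \<beta> :: "'a ordinal"
  assumes \<epsilon>: "0 < \<epsilon>" and A': "A' \<subseteq> cball 0 1"
    and T: "\<And>f. f \<in> cball 0 1 \<Longrightarrow> (1/2) *\<^sub>R (a + f) \<in> A'"
    and f: "f \<in> dent_deriv_iter \<epsilon> \<beta> (cball 0 1)"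
  shows "(1/2) *\<^sub>R (a + f) \<in> dent_deriv_iter (\<epsilon> / 2) \<beta> A'"
proof -
  define Rel where "Rel = (\<lambda>X Y. \<forall>f\<in>X. (1/2) *\<^sub>R (a + f) \<in> Y)"
  have "Rel (ord_rec (cball 0 1) (dent_deriv \<epsilon>) Inter \<beta>) (ord_rec A' (dent_deriv (\<epsilon> / 2)) Inter \<beta>)"
  proof (rule iter_rel)
    show "Rel (cball 0 1) A'"
      using T by (simp add: Rel_def)
  next
    fix X Y
    assume X: "X \<subseteq> cball 0 1" and Y: "Y \<subseteq> A'" and rel: "Rel X Y"
    have Y1: "Y \<subseteq> cball 0 1" using Y A' by blast
    have "(1/2) *\<^sub>R (a + f) \<in> dent_deriv (\<epsilon> / 2) Y" if f: "f \<in> dent_deriv \<epsilon> X" for f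
      unfolding dent_deriv_iff[OF Y1 half_gt_zero[OF \<epsilon>]]
    proof (intro conjI allI impI)
      show "(1/2) *\<^sub>R (a + f) \<in> Y"
        using rel f dent_deriv_subset unfolding Rel_def by blast
      fix x t
      assume "t < blinfun_apply ((1/2) *\<^sub>R (a + f)) x"
      then have "2 * t - blinfun_apply a x < blinfun_apply f x"
        by (simp add: blinfun.scaleR_left blinfun.add_left)
      then obtain y z where yz: "y \<in> X" "z \<in> X" "2 * t - blinfun_apply a x < blinfun_apply y x"
        "2 * t - blinfun_apply a x < blinfun_apply z x" "\<epsilon> < norm (y - z)"
        using f unfolding dent_deriv_iff[OF X \<epsilon>] by blast
      have "(1/2) *\<^sub>R (a + y) - (1/2) *\<^sub>R (a + z) = (1/2) *\<^sub>R (y - z)"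
        by (simp add: algebra_simps)
      then show "\<exists>y\<in>Y. \<exists>z\<in>Y. t < blinfun_apply y x \<and> t < blinfun_apply z x \<and> \<epsilon> / 2 < norm (y - z)"
        using yz rel unfolding Rel_def
        by (intro bexI[of _ "(1/2) *\<^sub>R (a + y)"] bexI[of _ "(1/2) *\<^sub>R (a + z)"])
          (auto simp: blinfun.scaleR_left blinfun.add_left)
    qed
    then show "Rel (dent_deriv \<epsilon> X) (dent_deriv (\<epsilon> / 2) Y)"
      by (simp add: Rel_def)
  qed (auto simp: Rel_def dent_deriv_subset)
  then show ?thesis
    using f by (simp add: Rel_def dent_deriv_iter_def)
qed

lemma midpoint_cball:
  fixes a f :: "'x::real_normed_vector"
  assumes "norm a \<le> 1" "norm f \<le> 1"
  shows "norm ((1/2) *\<^sub>R (a + f)) \<le> 1"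
  using norm_triangle_ineq[of a f] assms by simp

text \<open>If 0 survives \<open>\<beta>\<close> steps, then at \<open>\<epsilon> / 2\<close> so
  does \<open>a / 2\<close> for every \<open>a\<close> in the ball. The derived set thus contains a
  ball of radius 1/2, at whose centre the argument is repeated.\<close>

lemma zero_dent_iter_double:
  assumes \<epsilon>: "0 < \<epsilon>" and 0: "0 \<in> dent_deriv_iter \<epsilon> \<beta> (cball 0 1 :: ('x::real_normed_vector \<Rightarrow>\<^sub>L real) set)"
  shows "0 \<in> dent_deriv_iter (\<epsilon> / 2) (\<beta> + \<beta>) (cball 0 1 :: ('x \<Rightarrow>\<^sub>L real) set)"
proof -
  let ?A = "dent_deriv_iter (\<epsilon> / 2) \<beta> (cball 0 1 :: ('x \<Rightarrow>\<^sub>L real) set)"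
  have mem: "(1/2) *\<^sub>R (0 + a) \<in> ?A" if "a \<in> cball 0 1" for a :: "'x \<Rightarrow>\<^sub>L real"
  proof -
    have "(1/2) *\<^sub>R (a + 0) \<in> ?A"
    proof (rule dent_iter_midpoint[OF \<epsilon> order_refl _ 0])
      show "(1/2) *\<^sub>R (a + f) \<in> cball 0 1" if "f \<in> cball 0 1" for f
        using midpoint_cball[of a f] that \<open>a \<in> cball 0 1\<close> by simp
    qed
    then show ?thesis by simp
  qed
  have "(1/2) *\<^sub>R (0 + 0) \<in> dent_deriv_iter (\<epsilon> / 2) \<beta> ?A"
    by (rule dent_iter_midpoint[OF \<epsilon> dent_iter_subset mem 0])
  then show ?thesis
    by (simp add: dent_iter_plus)
qed

section \<open>Convexity and weak* closedness of the derived sets\<close>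

definition weak_star_closed :: "('x::real_normed_vector \<Rightarrow>\<^sub>L real) set \<Rightarrow> bool" where
  "weak_star_closed A \<longleftrightarrow> (\<forall>f. (\<forall>E \<eta>. finite E \<longrightarrow> 0 < \<eta> \<longrightarrow>
     (\<exists>a\<in>A. \<forall>e\<in>E. \<bar>blinfun_apply a e - blinfun_apply f e\<bar> < \<eta>)) \<longrightarrow> f \<in> A)"

lemma weak_star_closedD:
  assumes "weak_star_closed A"
    and "\<And>E \<eta>. finite E \<Longrightarrow> 0 < \<eta> \<Longrightarrow> \<exists>a\<in>A. \<forall>e\<in>E. \<bar>blinfun_apply a e - blinfun_apply f e\<bar> < \<eta>"
  shows "f \<in> A"
  using assms unfolding weak_star_closed_def by blast

lemma weak_star_closed_cball: "weak_star_closed (cball 0 1 :: ('x::real_normed_vector \<Rightarrow>\<^sub>L real) set)"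
  unfolding weak_star_closed_def
proof (intro allI impI)
  fix f :: "'x \<Rightarrow>\<^sub>L real"
  assume *: "\<forall>E \<eta>. finite E \<longrightarrow> 0 < \<eta> \<longrightarrow>
     (\<exists>a\<in>cball 0 1. \<forall>e\<in>E. \<bar>blinfun_apply a e - blinfun_apply f e\<bar> < \<eta>)"
  have "norm f \<le> 1"
  proof (rule norm_blinfun_bound)
    fix x
    show "norm (blinfun_apply f x) \<le> 1 * norm x"
    proof (rule field_le_epsilon)
      fix \<eta> :: real assume "0 < \<eta>"
      then obtain a where a: "norm a \<le> 1" "\<bar>blinfun_apply a x - blinfun_apply f x\<bar> < \<eta>"
        using *[rule_format, of "{x}" \<eta>] by auto
      have "\<bar>blinfun_apply a x\<bar> \<le> norm x"
        using norm_blinfun[of a x] mult_right_mono[OF a(1) norm_ge_zero[of x]] by simp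
      with a(2) show "norm (blinfun_apply f x) \<le> 1 * norm x + \<eta>" by simp
    qed
  qed simp
  then show "f \<in> cball 0 1" by simp
qed

text \<open>A slice that contains a convex combination contains one of its two points, and a slice
  that contains a weak* limit contains one of the approximating points. Both properties therefore
  pass to the derived set.\<close>

lemma dent_iter_convex_closed:
  fixes \<beta> :: "'a ordinal" and A :: "('x::real_normed_vector \<Rightarrow>\<^sub>L real) set"
  assumes "convex A" "weak_star_closed A"
  shows "convex (dent_deriv_iter \<epsilon> \<beta> A) \<and> weak_star_closed (dent_deriv_iter \<epsilon> \<beta> A)"
proof -
  \<comment> \<open>The second argument is a dummy: \<open>iter_rel\<close> is used here for an
    invariant of one iteration.\<close>
  define Rel where "Rel = (\<lambda>X (Y :: unit set). convex X \<and> weak_star_closed (X :: ('x \<Rightarrow>\<^sub>L real) set))"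
  have "Rel (ord_rec A (dent_deriv \<epsilon>) Inter \<beta>) (ord_rec UNIV (\<lambda>Y. Y) Inter \<beta>)"
  proof (rule iter_rel)
    fix X Y assume "Rel X Y"
    then have X: "convex X" "weak_star_closed X" by (auto simp: Rel_def)
    have "convex (dent_deriv \<epsilon> X)"
      unfolding convex_def
    proof (intro ballI allI impI)
      fix f g and u v :: real
      assume f: "f \<in> dent_deriv \<epsilon> X" and g: "g \<in> dent_deriv \<epsilon> X" and uv: "0 \<le> u" "0 \<le> v" "u + v = 1"
      show "u *\<^sub>R f + v *\<^sub>R g \<in> dent_deriv \<epsilon> X"
        unfolding dent_deriv_def mem_Collect_eq
      proof (intro conjI allI impI)
        show "u *\<^sub>R f + v *\<^sub>R g \<in> X"
          using X(1) f g uv dent_deriv_subset by (intro convexD) blast+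
        fix x t
        assume "u *\<^sub>R f + v *\<^sub>R g \<in> halfspace x t"
        then have "t < u * blinfun_apply f x + v * blinfun_apply g x"
          by (simp add: halfspace_def blinfun.add_left blinfun.scaleR_left)
        then have "t < blinfun_apply f x \<or> t < blinfun_apply g x"
          using convex_bound_le[of "blinfun_apply f x" t "blinfun_apply g x" u v] uv by (meson not_le)
        then show "\<epsilon> < diameter (X \<inter> halfspace x t)"
          using f g by (auto simp: dent_deriv_def halfspace_def)
      qed
    qed
    moreover have "weak_star_closed (dent_deriv \<epsilon> X)"
      unfolding weak_star_closed_def
    proof (intro allI impI)
      fix f
      assume *: "\<forall>E \<eta>. finite E \<longrightarrow> 0 < \<eta> \<longrightarrow>
        (\<exists>a\<in>dent_deriv \<epsilon> X. \<forall>e\<in>E. \<bar>blinfun_apply a e - blinfun_apply f e\<bar> < \<eta>)"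
      have "f \<in> X"
        using * dent_deriv_subset by (intro weak_star_closedD[OF X(2)]) blast
      moreover have "\<epsilon> < diameter (X \<inter> halfspace x t)" if t: "t < blinfun_apply f x" for x t
      proof -
        obtain a where "a \<in> dent_deriv \<epsilon> X" "\<bar>blinfun_apply a x - blinfun_apply f x\<bar> < blinfun_apply f x - t"
          using *[rule_format, of "{x}" "blinfun_apply f x - t"] t by auto
        then show ?thesis
          by (auto simp: dent_deriv_def halfspace_def)
      qed
      ultimately show "f \<in> dent_deriv \<epsilon> X"
        by (auto simp: dent_deriv_def halfspace_def)
    qed
    ultimately show "Rel (dent_deriv \<epsilon> X) Y"
      by (simp add: Rel_def)
  next
    fix I :: "'a ordinal set" and X and Y :: "'a ordinal \<Rightarrow> unit set"
    assume *: "\<And>i. i \<in> I \<Longrightarrow> Rel (X i) (Y i)"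
    have "weak_star_closed (\<Inter>i\<in>I. X i)"
      unfolding weak_star_closed_def
    proof (intro allI impI INT_I)
      fix f i
      assume **: "\<forall>E \<eta>. finite E \<longrightarrow> 0 < \<eta> \<longrightarrow>
        (\<exists>a\<in>\<Inter>i\<in>I. X i. \<forall>e\<in>E. \<bar>blinfun_apply a e - blinfun_apply f e\<bar> < \<eta>)" and i: "i \<in> I"
      have "weak_star_closed (X i)" using *[OF i] by (simp add: Rel_def)
      then show "f \<in> X i"
        using ** i by (rule_tac weak_star_closedD) blast+
    qed
    moreover have "convex (\<Inter>i\<in>I. X i)"
      using * by (intro convex_INT) (simp add: Rel_def)
    ultimately show "Rel (\<Inter>i\<in>I. X i) (\<Inter>i\<in>I. Y i)"
      by (simp add: Rel_def)
  qed (use assms in \<open>auto simp: Rel_def dent_deriv_subset\<close>)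
  then show ?thesis
    by (simp add: Rel_def dent_deriv_iter_def)
qed

section \<open>Evaluation functionals and their means\<close>

context ordinal_interval
begin

definition point_eval :: "'a ordinal \<Rightarrow> ('k \<Rightarrow>\<^sub>C real) \<Rightarrow>\<^sub>L real" where
  "point_eval x = Blinfun (\<lambda>g. apply_bcontfun g (r x))"

lemma point_eval_apply [simp]: "blinfun_apply (point_eval x) g = apply_bcontfun g (r x)"
proof -
  have "bounded_linear (\<lambda>g :: 'k \<Rightarrow>\<^sub>C real. apply_bcontfun g (r x))"
    by (rule bounded_linear_intro[where K = 1])
      (auto simp: plus_bcontfun.rep_eq scaleR_bcontfun.rep_eq simp flip: real_norm_def intro: norm_bounded)
  then show ?thesis
    by (simp add: point_eval_def bounded_linear_Blinfun_apply)
qed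

lemma norm_point_eval: "norm (point_eval x) \<le> 1"
  by (rule norm_blinfun_bound) (simp_all del: real_norm_def add: norm_bounded)

text \<open>Points are added in increasing order: the function found so far is cut behind the
  largest old point and continued by the new value.\<close>

lemma interpolation:
  fixes c :: "'a ordinal \<Rightarrow> real"
  assumes "finite S" "S \<subseteq> {..\<alpha>}" "\<And>x. x \<in> S \<Longrightarrow> \<bar>c x\<bar> \<le> 1"
  shows "\<exists>g. norm g \<le> 1 \<and> (\<forall>x\<in>S. apply_bcontfun g (r x) = c x)"
  using assms
proof (induction S rule: finite_linorder_max_induct)
  case empty
  show ?case by (intro exI[of _ 0]) simp
next
  case (insert b S)
  then obtain g where g: "norm g \<le> 1" "\<And>x. x \<in> S \<Longrightarrow> apply_bcontfun g (r x) = c x"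
    by auto
  have b: "\<bar>c b\<bar> \<le> 1" "b \<le> \<alpha>" using insert.prems by auto
  show ?case
  proof (cases "S = {}")
    case True
    have "norm (const_bcontfun (c b) :: 'k \<Rightarrow>\<^sub>C real) \<le> 1"
      using b by (intro norm_bound) (simp add: const_bcontfun.rep_eq)
    then show ?thesis
      using True by (intro exI[of _ "const_bcontfun (c b)"]) (simp add: const_bcontfun.rep_eq)
  next
    case False
    define z where "z = Max S"
    have z: "z < b" "\<And>x. x \<in> S \<Longrightarrow> x \<le> z"
      using insert.hyps False by (auto simp: z_def)
    have "\<bar>apply_bcontfun g t\<bar> \<le> 1" for t
      using norm_bounded[of g t] g(1) by simp
    then have "norm (cut g z (c b)) \<le> 1"
      using b by (intro norm_bound) (simp add: apply_cut)
    moreover have "apply_bcontfun (cut g z (c b)) (r x) = c x" if "x \<in> insert b S" for x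
    proof -
      have "p (r x) = x" using that insert.prems by (intro p_r) auto
      then show ?thesis
        using that z g(2) by (auto simp: apply_cut not_le[symmetric])
    qed
    ultimately show ?thesis by blast
  qed
qed

definition mean_eval :: "'a ordinal set \<Rightarrow> ('k \<Rightarrow>\<^sub>C real) \<Rightarrow>\<^sub>L real" where
  "mean_eval S = (1 / card S) *\<^sub>R (\<Sum>x\<in>S. point_eval x)"

lemma mean_eval_apply: "blinfun_apply (mean_eval S) g = (\<Sum>x\<in>S. apply_bcontfun g (r x)) / card S"
  by (simp add: mean_eval_def blinfun.scaleR_left blinfun.sum_left)

text \<open>The witness is a function of norm at most 1 that is 1 on \<open>S\<close> and -1 on
  \<open>S'\<close>.\<close>

lemma norm_mean_eval_diff:
  assumes "finite S" "finite S'" "S \<union> S' \<subseteq> {..\<alpha>}" "S \<inter> S' = {}" "S \<noteq> {}" "S' \<noteq> {}"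
  shows "2 \<le> norm (mean_eval S - mean_eval S')"
proof -
  have "\<exists>g :: 'k \<Rightarrow>\<^sub>C real. norm g \<le> 1 \<and> (\<forall>x\<in>S \<union> S'. apply_bcontfun g (r x) = (if x \<in> S then 1 else -1))"
    by (rule interpolation) (use assms(1-3) in auto)
  then obtain g :: "'k \<Rightarrow>\<^sub>C real" where g: "norm g \<le> 1" "\<And>x. x \<in> S \<union> S' \<Longrightarrow> apply_bcontfun g (r x) = (if x \<in> S then 1 else -1)"
    by blast
  have "(\<Sum>x\<in>S. apply_bcontfun g (r x)) = (\<Sum>x\<in>S. 1)"
    using g(2) by (intro sum.cong) auto
  moreover have "(\<Sum>x\<in>S'. apply_bcontfun g (r x)) = (\<Sum>x\<in>S'. -1)"
    using g(2) assms(4) by (intro sum.cong) auto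
  ultimately have "blinfun_apply (mean_eval S - mean_eval S') g = 2"
    using assms by (simp add: blinfun.diff_left mean_eval_apply)
  then have "2 \<le> norm (mean_eval S - mean_eval S') * norm g"
    using norm_blinfun[of "mean_eval S - mean_eval S'" g] by simp
  also have "\<dots> \<le> norm (mean_eval S - mean_eval S')"
    using g(1) by (simp add: mult_left_le)
  finally show ?thesis .
qed

text \<open>The mean is the midpoint of the means over two halves of \<open>S\<close>, at distance
  at least 1 from either, and any slice containing it contains one of these. The claim is for
  \<open>n \<le> m\<close> because a step needs not only the halves but also \<open>S\<close> itself
  in the previous derived set.\<close>

lemma mean_eval_in_iter:
  assumes A: "convex A" "A \<subseteq> cball 0 1" and "n \<le> m"
    and S: "finite S" "card S = 2 ^ m" "S \<subseteq> {..\<alpha>}" "\<And>x. x \<in> S \<Longrightarrow> point_eval x \<in> A"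
  shows "mean_eval S \<in> dent_deriv_iter (1/2) (fin_ord n :: 'a ordinal) A"
  using \<open>n \<le> m\<close> S
proof (induction n arbitrary: m S)
  case 0
  have "(\<Sum>x\<in>S. (1 / card S) *\<^sub>R point_eval x) \<in> A"
    using A(1) 0 by (intro convex_sum) auto
  then show ?case
    by (simp add: mean_eval_def dent_deriv_iter_def ord_rec_0 scaleR_sum_right)
next
  case (Suc n)
  let ?D = "dent_deriv_iter (1/2) (fin_ord n :: 'a ordinal) A"
  have D: "?D \<subseteq> cball 0 1"
    using A(2) dent_iter_subset by blast
  obtain m' where m: "m = Suc m'" "n \<le> m'"
    using Suc.prems(1) by (cases m) auto
  obtain S1 where S1: "S1 \<subseteq> S" "card S1 = 2 ^ m'" "finite S1"
    using obtain_subset_with_card_n[of "2 ^ m'" S] Suc.prems m by auto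
  define S2 where "S2 = S - S1"
  have S2: "S2 \<subseteq> S" "card S2 = 2 ^ m'" "finite S2" "S1 \<inter> S2 = {}" "S1 \<union> S2 = S"
    using S1 Suc.prems m by (auto simp: S2_def card_Diff_subset)
  have in_D: "mean_eval S1 \<in> ?D" "mean_eval S2 \<in> ?D" "mean_eval S \<in> ?D"
    using Suc.IH[of m' S1] Suc.IH[of m' S2] Suc.IH[of m S] Suc.prems m S1 S2 by auto
  have ne: "S1 \<noteq> {}" "S2 \<noteq> {}"
    using S1 S2 by auto
  have half: "mean_eval S = (1/2) *\<^sub>R (mean_eval S1 + mean_eval S2)"
  proof -
    have "(\<Sum>x\<in>S. point_eval x) = (\<Sum>x\<in>S1. point_eval x) + (\<Sum>x\<in>S2. point_eval x)"
      using S1 S2 by (metis sum.union_disjoint)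
    then show ?thesis
      using Suc.prems(3) S1(2) S2(2) m by (simp add: mean_eval_def scaleR_add_right)
  qed
  have n2: "2 \<le> norm (mean_eval S1 - mean_eval S2)"
    using S1 S2 Suc.prems ne by (intro norm_mean_eval_diff) auto
  have "mean_eval S - mean_eval S1 = (1/2) *\<^sub>R (mean_eval S2 - mean_eval S1)"
    "mean_eval S - mean_eval S2 = (1/2) *\<^sub>R (mean_eval S1 - mean_eval S2)"
    using half scaleR_half_double[of "mean_eval S1"] scaleR_half_double[of "mean_eval S2"]
    by (simp_all add: algebra_simps flip: scaleR_add_left)
  then have d: "1/2 < norm (mean_eval S - mean_eval S1)" "1/2 < norm (mean_eval S - mean_eval S2)"
    using n2 by (simp_all add: norm_minus_commute)
  have "mean_eval S \<in> dent_deriv (1/2) ?D"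
    unfolding dent_deriv_iff[OF D half_gt_zero[OF zero_less_one]]
  proof (intro conjI allI impI in_D)
    fix x t
    assume t: "t < blinfun_apply (mean_eval S) x"
    then have "t < (blinfun_apply (mean_eval S1) x + blinfun_apply (mean_eval S2) x) / 2"
      by (simp add: half blinfun.scaleR_left blinfun.add_left)
    then have "t < blinfun_apply (mean_eval S1) x \<or> t < blinfun_apply (mean_eval S2) x"
      using convex_bound_le[of "blinfun_apply (mean_eval S1) x" t "blinfun_apply (mean_eval S2) x" "1/2" "1/2"]
      by (auto simp: not_less field_simps)
    then show "\<exists>y\<in>?D. \<exists>z\<in>?D. t < blinfun_apply y x \<and> t < blinfun_apply z x \<and> 1/2 < norm (y - z)"
      using t d in_D by blast
  qed
  then show ?case
    by (simp add: dent_deriv_iter_def ord_rec_osuc)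
qed

lemma left_continuous_finite:
  assumes "finite E" "x \<le> \<alpha>" "0 < x" "0 < (\<delta> :: real)"
  shows "\<exists>y<x. \<forall>g\<in>E. \<forall>z. y < z \<longrightarrow> z \<le> x \<longrightarrow> \<bar>apply_bcontfun g (r z) - apply_bcontfun g (r x)\<bar> < \<delta>"
  using assms(1)
proof (induction E rule: finite_induct)
  case empty
  then show ?case using assms(3) by auto
next
  case (insert g E)
  then obtain y where y: "y < x" "\<forall>g\<in>E. \<forall>z. y < z \<longrightarrow> z \<le> x \<longrightarrow> \<bar>apply_bcontfun g (r z) - apply_bcontfun g (r x)\<bar> < \<delta>"
    by blast
  obtain y' where y': "y' < x" "\<forall>z. y' < z \<longrightarrow> z \<le> x \<longrightarrow> \<bar>apply_bcontfun g (r z) - apply_bcontfun g (r x)\<bar> < \<delta>"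
    using left_continuous[OF assms(2-4)] by blast
  show ?case
    using y y' by (intro exI[of _ "max y y'"]) auto
qed

text \<open>The starting point \<open>\<xi>\<close> varies in the induction, since the points that
  approximate \<open>\<xi> + omega_pow (osuc \<beta>)\<close> have the form
  \<open>\<xi>' + omega_pow \<beta>\<close> with other \<open>\<xi>'\<close>. In the limit case
  single evaluations suffice as approximants.\<close>

lemma point_eval_in_iter:
  "\<xi> + omega_pow \<beta> \<le> \<alpha> \<Longrightarrow> point_eval (\<xi> + omega_pow \<beta>) \<in> dent_deriv_iter (1/2) (omega * \<beta>) (cball 0 1)"
proof (induction \<beta> arbitrary: \<xi> rule: ordinal_induct)
  case zero
  then show ?case
    using norm_point_eval by (simp add: dent_deriv_iter_def ord_rec_0)
next
  case (suc \<beta>)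
  let ?A = "dent_deriv_iter (1/2) (omega * \<beta>) (cball 0 1) :: (('k \<Rightarrow>\<^sub>C real) \<Rightarrow>\<^sub>L real) set"
  define x where "x = \<xi> + omega_pow (osuc \<beta>)"
  have x: "x \<le> \<alpha>" using suc.prems by (simp add: x_def)
  have lim: "limit_ordinal (omega_pow \<beta> * omega)"
    by (intro times_limit limit_omega omega_pow_pos)
  have x_pos: "0 < x"
    using less_plus_limit[OF lim, of 0 \<xi>] limit_ordinal_pos[OF lim]
    by (simp add: x_def omega_pow_simps) (metis limit_ordinal_pos[OF normal_fun_limit[OF normal_fun_plus lim]])
  have A: "convex ?A" "?A \<subseteq> cball 0 1"
    using dent_iter_convex_closed[OF convex_cball weak_star_closed_cball] dent_iter_subset by blast+
  have "point_eval x \<in> dent_deriv_iter (1/2) (fin_ord n :: 'a ordinal) ?A" for n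
  proof (rule weak_star_closedD)
    show "weak_star_closed (dent_deriv_iter (1/2) (fin_ord n :: 'a ordinal) ?A)"
      using dent_iter_convex_closed dent_iter_convex_closed[OF convex_cball weak_star_closed_cball] by blast
    fix E :: "('k \<Rightarrow>\<^sub>C real) set" and \<eta> :: real
    assume E: "finite E" and \<eta>: "0 < \<eta>"
    obtain y where y: "y < x" "\<And>g z. g \<in> E \<Longrightarrow> y < z \<Longrightarrow> z \<le> x \<Longrightarrow> \<bar>apply_bcontfun g (r z) - apply_bcontfun g (r x)\<bar> < \<eta>"
      using left_continuous_finite[OF E x x_pos \<eta>] by blast
    obtain \<delta> where \<delta>: "\<delta> < omega_pow \<beta> * omega" "y < \<xi> + \<delta>"
      using y(1) less_plus_limit[OF lim] by (auto simp: x_def omega_pow_simps)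
    then obtain l where l: "\<delta> < omega_pow \<beta> * fin_ord l"
      using less_omega_mult by blast
    \<comment> \<open>The offset \<open>l\<close> puts all these points behind \<open>y\<close>,
      where the functions of \<open>E\<close> are almost constant. From the second point on they end
      in a summand \<open>omega_pow \<beta>\<close>, so the induction hypothesis applies to
      them.\<close>
    define q where "q = (\<lambda>j. \<xi> + omega_pow \<beta> * fin_ord (l + j))"
    have q_less: "q j < x" for j
      by (simp add: q_def x_def omega_pow_simps times_less_iff(1))
    have q_gt: "y < q j" for j
    proof -
      have "omega_pow \<beta> * fin_ord l \<le> omega_pow \<beta> * fin_ord (l + j)"
        by (simp add: times_less_iff(2) fin_ord_mono)
      then have "\<xi> + \<delta> < q j"
        using l by (simp add: q_def)
      with \<delta>(2) show ?thesis by (rule less_trans)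
    qed
    have q_Suc: "q (Suc j) = (\<xi> + omega_pow \<beta> * fin_ord (l + j)) + omega_pow \<beta>" for j
      by (simp add: q_def times_ordinal_simps plus_assoc_ordinal)
    have "strict_mono q"
      unfolding strict_mono_Suc_iff q_def by (simp add: times_less_iff(1) less_osuc)
    then have inj: "inj q"
      by (rule strict_mono_imp_inj_on)
    define S where "S = (\<lambda>j. q (Suc j)) ` {..<2 ^ n}"
    have card: "card S = 2 ^ n"
      unfolding S_def using inj by (subst card_image) (auto simp: inj_on_def dest: injD)
    have mem: "point_eval z \<in> ?A" "z \<le> \<alpha>" "y < z" "z \<le> x" if z: "z \<in> S" for z
    proof -
      obtain j where j: "z = q (Suc j)" using z by (auto simp: S_def)
      show "y < z" "z \<le> x" using q_less q_gt j by (auto intro: less_imp_le)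
      then show "z \<le> \<alpha>" using x by order
      then show "point_eval z \<in> ?A" using suc.IH unfolding j q_Suc by blast
    qed
    have "mean_eval S \<in> dent_deriv_iter (1/2) (fin_ord n :: 'a ordinal) ?A"
      using card mem by (intro mean_eval_in_iter[OF A order_refl]) (auto simp: S_def)
    moreover have "\<bar>blinfun_apply (mean_eval S) g - blinfun_apply (point_eval x) g\<bar> < \<eta>" if g: "g \<in> E" for g
    proof -
      have fin: "finite S" "S \<noteq> {}" using card by (auto simp: S_def)
      have "blinfun_apply (mean_eval S) g - blinfun_apply (point_eval x) g
        = (\<Sum>z\<in>S. apply_bcontfun g (r z) - apply_bcontfun g (r x)) / card S"
        using fin by (simp add: mean_eval_apply sum_subtractf diff_divide_distrib)
      moreover have "\<bar>\<Sum>z\<in>S. apply_bcontfun g (r z) - apply_bcontfun g (r x)\<bar> < (\<Sum>z\<in>S. \<eta>)"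
        using mem y(2)[OF g] fin by (intro order_le_less_trans[OF sum_abs] sum_strict_mono) auto
      ultimately show ?thesis
        using fin by (simp add: abs_divide divide_less_eq card_gt_0_iff mult.commute)
    qed
    ultimately show "\<exists>a\<in>dent_deriv_iter (1/2) (fin_ord n :: 'a ordinal) ?A.
        \<forall>e\<in>E. \<bar>blinfun_apply a e - blinfun_apply (point_eval x) e\<bar> < \<eta>"
      by blast
  qed
  then have "point_eval x \<in> dent_deriv_iter (1/2) (omega :: 'a ordinal) ?A"
    unfolding dent_deriv_iter_def[of "1/2" "omega :: 'a ordinal"] ord_rec_limit[OF limit_omega]
    by (auto simp: less_omega_iff dent_deriv_iter_def)
  then show ?case
    by (simp add: x_def times_ordinal_simps dent_iter_plus)
next
  case (limit \<beta>)
  define x where "x = \<xi> + omega_pow \<beta>"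
  have x: "x \<le> \<alpha>" using limit.prems by (simp add: x_def)
  have lim: "limit_ordinal (omega_pow \<beta>)"
    using limit(1) by (intro limit_omega_pow) (auto simp: limit_ordinal_def)
  have x_pos: "0 < x"
    unfolding x_def by (rule limit_ordinal_pos[OF normal_fun_limit[OF normal_fun_plus lim]])
  have "0 < (omega :: 'a ordinal)" by (rule limit_ordinal_pos[OF limit_omega])
  then have lim': "limit_ordinal (omega * \<beta>)"
    using limit(1) by (intro times_limit)
  have mem: "point_eval x \<in> dent_deriv_iter (1/2) (omega * \<sigma>) (cball 0 1)" if \<sigma>: "\<sigma> < \<beta>" for \<sigma>
  proof (rule weak_star_closedD)
    show "weak_star_closed (dent_deriv_iter (1/2) (omega * \<sigma>) (cball 0 1 :: (('k \<Rightarrow>\<^sub>C real) \<Rightarrow>\<^sub>L real) set))"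
      using dent_iter_convex_closed[OF convex_cball weak_star_closed_cball] by blast
    fix E :: "('k \<Rightarrow>\<^sub>C real) set" and \<eta> :: real
    assume E: "finite E" and \<eta>: "0 < \<eta>"
    obtain y where y: "y < x" "\<And>g z. g \<in> E \<Longrightarrow> y < z \<Longrightarrow> z \<le> x \<Longrightarrow> \<bar>apply_bcontfun g (r z) - apply_bcontfun g (r x)\<bar> < \<eta>"
      using left_continuous_finite[OF E x x_pos \<eta>] by blast
    obtain \<delta> where \<delta>: "\<delta> < omega_pow \<beta>" "y < \<xi> + \<delta>"
      using y(1) less_plus_limit[OF lim] by (auto simp: x_def)
    then obtain \<tau> where \<tau>: "\<tau> < \<beta>" "\<delta> < omega_pow \<tau>"
      using less_omega_pow_limit[OF limit(1)] by blast
    \<comment> \<open>At least \<open>\<sigma>\<close>, to survive long enough, and at least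
      \<open>\<tau>\<close>, to lie behind \<open>y\<close>.\<close>
    define \<rho> where "\<rho> = max \<sigma> \<tau>"
    have \<rho>: "\<rho> < \<beta>" "\<sigma> \<le> \<rho>" "\<tau> \<le> \<rho>"
      using \<sigma> \<tau> by (auto simp: \<rho>_def)
    define z where "z = \<xi> + omega_pow \<rho>"
    have z: "z \<le> x" using \<rho> by (simp add: z_def x_def less_imp_le)
    have "omega_pow \<tau> \<le> omega_pow \<rho>" using \<rho> by simp
    with \<tau>(2) have "\<delta> < omega_pow \<rho>" by (rule order_less_le_trans)
    then have "\<xi> + \<delta> < z" by (simp add: z_def)
    then have "y < z" using \<delta>(2) by (rule less_trans[rotated])
    have "z \<le> \<alpha>" using z x by order
    then have "point_eval z \<in> dent_deriv_iter (1/2) (omega * \<rho>) (cball 0 1)"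
      using limit(2)[OF \<rho>(1)] by (simp add: z_def)
    moreover have "omega * \<sigma> \<le> omega * \<rho>"
      using \<rho>(2) \<open>0 < omega\<close> by (simp add: times_less_iff(2))
    ultimately have "point_eval z \<in> dent_deriv_iter (1/2) (omega * \<sigma>) (cball 0 1)"
      using dent_iter_antimono by blast
    then show "\<exists>a\<in>dent_deriv_iter (1/2) (omega * \<sigma>) (cball 0 1).
        \<forall>e\<in>E. \<bar>blinfun_apply a e - blinfun_apply (point_eval x) e\<bar> < \<eta>"
      using y(2)[OF _ \<open>y < z\<close> z] by (intro bexI[of _ "point_eval z"]) auto
  qed
  have "point_eval x \<in> dent_deriv_iter (1/2) \<delta> (cball 0 1)" if \<delta>: "\<delta> < omega * \<beta>" for \<delta>
  proof -
    obtain \<sigma> where "\<sigma> < \<beta>" "\<delta> < omega * \<sigma>"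
      using \<delta> less_times_limit[OF \<open>0 < omega\<close> limit(1)] by auto
    then show ?thesis
      using mem dent_iter_antimono[OF less_imp_le] by blast
  qed
  then show ?case
    unfolding x_def[symmetric] dent_deriv_iter_def[of _ "omega * \<beta>"] ord_rec_limit[OF lim']
    by (auto simp: dent_deriv_iter_def)
qed

text \<open>The midpoint of an evaluation and its negative is 0, which turns the 1/2 for evaluations
  into 1/4; each doubling of the number of steps then halves the constant again.\<close>

lemma zero_in_iter:
  assumes "omega_pow (omega_pow \<gamma>) \<le> \<alpha>"
  shows "0 \<in> dent_deriv_iter (1 / 4 / 2 ^ n) (omega_pow (1 + \<gamma>) * fin_ord (2 ^ n))
    (cball 0 1 :: (('k \<Rightarrow>\<^sub>C real) \<Rightarrow>\<^sub>L real) set)"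
proof (induction n)
  case 0
  have "point_eval (0 + omega_pow (omega_pow \<gamma>)) \<in> dent_deriv_iter (1/2) (omega * omega_pow \<gamma>) (cball 0 1)"
    using assms by (intro point_eval_in_iter) simp
  then have m: "point_eval (omega_pow (omega_pow \<gamma>)) \<in> dent_deriv_iter (1/2) (omega_pow (1 + \<gamma>)) (cball 0 1)"
    by (simp add: omega_times_omega_pow)
  have "(1/2) *\<^sub>R (- point_eval (omega_pow (omega_pow \<gamma>)) + point_eval (omega_pow (omega_pow \<gamma>)))
      \<in> dent_deriv_iter (1 / 2 / 2) (omega_pow (1 + \<gamma>)) (cball 0 1)"
  proof (rule dent_iter_midpoint[OF _ order_refl _ m])
    fix f :: "('k \<Rightarrow>\<^sub>C real) \<Rightarrow>\<^sub>L real"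
    assume "f \<in> cball 0 1"
    then show "(1/2) *\<^sub>R (- point_eval (omega_pow (omega_pow \<gamma>)) + f) \<in> cball 0 1"
      using midpoint_cball[of "- point_eval (omega_pow (omega_pow \<gamma>))" f] norm_point_eval by simp
  qed simp
  then show ?case
    by (simp flip: one_ordinal_def)
next
  case (Suc n)
  have "(1 :: real) / 4 / 2 ^ Suc n = 1 / 4 / 2 ^ n / 2" "(2 :: nat) ^ Suc n = 2 ^ n + 2 ^ n"
    by simp_all
  then show ?case
    using zero_dent_iter_double[OF _ Suc] by (simp only: times_fin_ord_add) simp
qed

end

section \<open>The value of the index\<close>

theorem theorem3p2:
  fixes \<alpha> \<gamma> :: "'a ordinal"
  assumes "omega \<le> \<alpha>"
    and "omega_pow (omega_pow \<gamma>) \<le> \<alpha>" and "\<alpha> < omega_pow (omega_pow (\<gamma> + 1))"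
    and "(UNIV :: 'k::topological_space set) homeomorphic {..\<alpha>}"
  shows "(\<forall>\<epsilon>>0. \<exists>\<beta> :: 'a ordinal.
            dent_deriv_iter \<epsilon> \<beta> (cball 0 1 :: (('k \<Rightarrow>\<^sub>C real) \<Rightarrow>\<^sub>L real) set) = {})
       \<and> Dz TYPE('k \<Rightarrow>\<^sub>C real) = omega_pow (1 + \<gamma> + 1)"
proof -
  let ?B = "cball 0 1 :: (('k \<Rightarrow>\<^sub>C real) \<Rightarrow>\<^sub>L real) set"
  let ?X = "TYPE('k \<Rightarrow>\<^sub>C real)"
  obtain p r where "homeomorphism (UNIV :: 'k set) {..\<alpha>} p r"
    using assms(4) by (auto simp: homeomorphic_def)
  moreover have "0 < \<alpha>"
    using assms(1) limit_ordinal_pos[OF limit_omega] by (rule order_less_le_trans[rotated])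
  ultimately interpret ordinal_interval \<alpha> p r
    by (rule ordinal_interval.intro)
  have exp: "1 + (\<gamma> + 1) = 1 + \<gamma> + 1"
    by (simp add: plus_assoc_ordinal)
  have empty: "\<exists>\<sigma> :: 'a ordinal. \<sigma> < omega_pow (1 + \<gamma> + 1) \<and> dent_deriv_iter \<epsilon> \<sigma> ?B = {}" if "0 < \<epsilon>" for \<epsilon>
    using dent_iter_empty[OF assms(3) that] by (simp only: exp)
  have Dz_eps: "dent_deriv_iter \<epsilon> (Dz_eps ?X \<epsilon> :: 'a ordinal) ?B = {}" if "0 < \<epsilon>" for \<epsilon>
    unfolding Dz_eps_def by (rule LeastI_ex) (use empty[OF that] in blast)
  have le: "(Dz_eps ?X \<epsilon> :: 'a ordinal) \<le> omega_pow (1 + \<gamma> + 1)" if \<epsilon>: "0 < \<epsilon>" for \<epsilon>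
  proof -
    obtain \<sigma> :: "'a ordinal" where "\<sigma> < omega_pow (1 + \<gamma> + 1)" "dent_deriv_iter \<epsilon> \<sigma> ?B = {}"
      using empty[OF \<epsilon>] by blast
    then show ?thesis
      unfolding Dz_eps_def by (meson Least_le less_imp_le order_trans)
  qed
  have "(Dz ?X :: 'a ordinal) \<le> omega_pow (1 + \<gamma> + 1)"
    unfolding Dz_def using le by (intro cSUP_least) auto
  moreover have "\<not> (Dz ?X :: 'a ordinal) < omega_pow (1 + \<gamma> + 1)"
  proof
    assume "(Dz ?X :: 'a ordinal) < omega_pow (1 + \<gamma> + 1)"
    then obtain n where n: "Dz ?X < omega_pow (1 + \<gamma>) * fin_ord n"
      by (auto simp: plus_one_ordinal omega_pow_simps less_omega_mult)
    \<comment> \<open>At this value 0 survives \<open>2 ^ n\<close> rounds of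
      \<open>omega_pow (1 + \<gamma>)\<close> steps. As \<open>2 ^ n\<close> is at least
      \<open>n\<close>, these are more steps than \<open>Dz\<close> admits.\<close>
    define \<epsilon> :: real where "\<epsilon> = 1 / 4 / 2 ^ n"
    have \<epsilon>: "0 < \<epsilon>" by (simp add: \<epsilon>_def)
    have "bdd_above (Dz_eps ?X ` {0<..} :: 'a ordinal set)"
      using le by (auto simp: bdd_above_def)
    then have "Dz_eps ?X \<epsilon> \<le> (Dz ?X :: 'a ordinal)"
      unfolding Dz_def using \<epsilon> by (intro cSUP_upper) auto
    also note n
    also have "omega_pow (1 + \<gamma>) * fin_ord n \<le> omega_pow (1 + \<gamma>) * fin_ord (2 ^ n)"
      by (simp add: times_less_iff(2) fin_ord_mono)
    finally have "dent_deriv_iter \<epsilon> (omega_pow (1 + \<gamma>) * fin_ord (2 ^ n)) ?B \<subseteq> dent_deriv_iter \<epsilon> (Dz_eps ?X \<epsilon> :: 'a ordinal) ?B"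
      by (intro dent_iter_antimono less_imp_le)
    then show False
      using zero_in_iter[OF assms(2), of n] Dz_eps[OF \<epsilon>] by (auto simp: \<epsilon>_def)
  qed
  ultimately show ?thesis
    using empty by (auto simp: order_le_less)
qed

end
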